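(* For every integer $n\geq 0$, there exists a faithfully flat map of Boolean rings $B\to B'$ that is not descendable of index $\leq n$ and satisfies $\lvert B'\rvert<\aleph_{2n}$.
   Context: A Boolean ring is a ring in which every element is idempotent. For a ring map $f\colon A\to B$, let $\operatorname{fib}(f)$ be its fiber in the derived category $\operatorname{D}(A)$. The map $f$ is descendable of index $\leq n$ if the natural map $\operatorname{fib}(f)^{\otimes_{A}n}\to A$ (derived tensor power over $A$) is null-homotopic. *)

theory Defs
  imports "HOL-Algebra.Algebra"
begin

section \<open>The cardinals aleph-m\<close>

text \<open>
  \<open>is_aleph m r\<close> says that the well-order \<open>r\<close> is a cardinal of size aleph-m. The index is a
  predicate and not a function because \<open>cardSuc\<close> raises the type; asking for the predecessor
  cardinal on the same type is no restriction, as it embeds into the field of \<open>r\<close>. The lemma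
  \<open>is_aleph_exists_Suc\<close> shows that every aleph-m is realised on an iterated powerset of \<open>nat\<close>.
\<close>

primrec is_aleph :: "nat \<Rightarrow> 'a rel \<Rightarrow> bool" where
  "is_aleph 0 r \<longleftrightarrow> (r, natLeq) \<in> ordIso"
| "is_aleph (Suc m) r \<longleftrightarrow> (\<exists>s :: 'a rel. is_aleph m s \<and> (r, cardSuc s) \<in> ordIso)"

lemma is_aleph_Card_order:
  fixes r :: "'a rel"
  shows "is_aleph m r \<Longrightarrow> Card_order r"
proof (induction m arbitrary: r)
  case 0
  then show ?case using Card_order_ordIso natLeq_Card_order by auto
next
  case (Suc m)
  then obtain s :: "'a rel" where "is_aleph m s" "(r, cardSuc s) \<in> ordIso" by auto
  with Suc.IH show ?case using Card_order_ordIso cardSuc_Card_order by blast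
qed

lemma ordIso_card_of_image:
  assumes "inj g" "Card_order r"
  shows "(card_of (g ` Field r), r) \<in> ordIso"
proof -
  have "bij_betw g (Field r) (g ` Field r)"
    using assms(1) by (auto intro: inj_on_imp_bij_betw inj_on_subset)
  then have "(card_of (Field r), card_of (g ` Field r)) \<in> ordIso" by (rule card_of_ordIsoI)
  then show ?thesis
    using card_of_Field_ordIso[OF assms(2)] by (rule ordIso_transitive[OF ordIso_symmetric])
qed

lemma is_aleph_transport:
  fixes r :: "'a rel" and g :: "'a \<Rightarrow> 'b"
  assumes "inj g" "is_aleph m r"
  shows "\<exists>r' :: 'b rel. is_aleph m r' \<and> (r', r) \<in> ordIso"
  using assms(2)
proof (induction m arbitrary: r)
  case 0
  have *: "(card_of (g ` Field r), r) \<in> ordIso"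
    using assms(1) is_aleph_Card_order[OF 0] by (rule ordIso_card_of_image)
  moreover have "is_aleph 0 (card_of (g ` Field r))"
    using ordIso_transitive[OF *] 0 by simp
  ultimately show ?case by blast
next
  case (Suc m)
  then obtain s :: "'a rel" where s: "is_aleph m s" "(r, cardSuc s) \<in> ordIso" by auto
  then obtain s' :: "'b rel" where s': "is_aleph m s'" "(s', s) \<in> ordIso" using Suc.IH by blast
  have *: "(card_of (g ` Field r), r) \<in> ordIso"
    using assms(1) is_aleph_Card_order[OF Suc.prems] by (rule ordIso_card_of_image)
  have "(cardSuc s, cardSuc s') \<in> ordIso"
    using cardSuc_invar_ordIso[OF is_aleph_Card_order[OF s(1)] is_aleph_Card_order[OF s'(1)]]
      ordIso_symmetric[OF s'(2)] by simp
  then have "(card_of (g ` Field r), cardSuc s') \<in> ordIso"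
    by (rule ordIso_transitive[OF ordIso_transitive[OF * s(2)]])
  with s'(1) have "is_aleph (Suc m) (card_of (g ` Field r))" by auto
  with * show ?case by blast
qed

lemma is_aleph_exists_0: "is_aleph 0 natLeq"
  using natLeq_Well_order by (simp add: ordIso_reflexive)

lemma is_aleph_exists_Suc:
  fixes r :: "'a rel"
  assumes "is_aleph m r"
  shows "\<exists>r' :: 'a set rel. is_aleph (Suc m) r'"
proof -
  have "inj (\<lambda>x :: 'a. {x})" by simp
  from is_aleph_transport[OF this assms]
  obtain s :: "'a set rel" where s: "is_aleph m s" "(s, r) \<in> ordIso" by blast
  have "(cardSuc r, cardSuc s) \<in> ordIso"
    using cardSuc_invar_ordIso[OF is_aleph_Card_order[OF assms] is_aleph_Card_order[OF s(1)]]
      ordIso_symmetric[OF s(2)] by simp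
  with s(1) show ?thesis by auto
qed

section \<open>Boolean rings\<close>

definition boolean_ring :: "('a, 'm) ring_scheme \<Rightarrow> bool" where
  "boolean_ring R \<longleftrightarrow> ring R \<and> (\<forall>x \<in> carrier R. x \<otimes>\<^bsub>R\<^esub> x = x)"

section \<open>Modules\<close>

text \<open>
  The fields \<open>mult\<close> and \<open>one\<close> of a \<open>module\<close> record play no role for the locale \<open>module\<close>; they are
  left \<open>undefined\<close> below.
\<close>

definition linear_maps ::
  "'a ring \<Rightarrow> ('a, 'm) module \<Rightarrow> ('a, 'n) module \<Rightarrow> ('m \<Rightarrow> 'n) set" where
  "linear_maps A M N = {h \<in> carrier M \<rightarrow> carrier N.
     (\<forall>x \<in> carrier M. \<forall>y \<in> carrier M. h (x \<oplus>\<^bsub>M\<^esub> y) = h x \<oplus>\<^bsub>N\<^esub> h y) \<and>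
     (\<forall>r \<in> carrier A. \<forall>x \<in> carrier M. h (r \<odot>\<^bsub>M\<^esub> x) = r \<odot>\<^bsub>N\<^esub> h x)}"

definition restrict_scalars :: "('a \<Rightarrow> 'b) \<Rightarrow> 'b ring \<Rightarrow> ('a, 'b) module" where
  "restrict_scalars f B =
     \<lparr>carrier = carrier B, monoid.mult = undefined, monoid.one = undefined,
      ring.zero = \<zero>\<^bsub>B\<^esub>, add = add B, smult = (\<lambda>a b. f a \<otimes>\<^bsub>B\<^esub> b)\<rparr>"

definition regular_module :: "'a ring \<Rightarrow> ('a, 'a) module" where
  "regular_module A = restrict_scalars (\<lambda>x. x) A"

definition direct_sum :: "('a, 'm) module \<Rightarrow> ('a, 'n) module \<Rightarrow> ('a, 'm \<times> 'n) module" where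
  "direct_sum M N =
     \<lparr>carrier = carrier M \<times> carrier N, monoid.mult = undefined, monoid.one = undefined,
      ring.zero = (\<zero>\<^bsub>M\<^esub>, \<zero>\<^bsub>N\<^esub>),
      add = (\<lambda>(x, y) (x', y'). (x \<oplus>\<^bsub>M\<^esub> x', y \<oplus>\<^bsub>N\<^esub> y')),
      smult = (\<lambda>r (x, y). (r \<odot>\<^bsub>M\<^esub> x, r \<odot>\<^bsub>N\<^esub> y))\<rparr>"

definition quotient_module :: "('a, 'm) module \<Rightarrow> 'm set \<Rightarrow> ('a, 'm set) module" where
  "quotient_module M N =
     \<lparr>carrier = a_rcosets\<^bsub>M\<^esub> N, monoid.mult = undefined, monoid.one = undefined,
      ring.zero = N, add = set_add M,
      smult = (\<lambda>r S. \<Union>x \<in> S. N +>\<^bsub>M\<^esub> (r \<odot>\<^bsub>M\<^esub> x))\<rparr>"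

definition submodule_span :: "'a ring \<Rightarrow> ('a, 'm) module \<Rightarrow> 'm set \<Rightarrow> 'm set" where
  "submodule_span A M S = \<Inter>{N. submodule N A M \<and> S \<subseteq> N}"

definition free_module :: "'a ring \<Rightarrow> 'x set \<Rightarrow> ('a, 'x \<Rightarrow> 'a) module" where
  "free_module A E =
     \<lparr>carrier = {F. (\<forall>x. F x \<in> carrier A) \<and> {x. F x \<noteq> \<zero>\<^bsub>A\<^esub>} \<subseteq> E \<and>
                 finite {x. F x \<noteq> \<zero>\<^bsub>A\<^esub>}},
      monoid.mult = undefined, monoid.one = undefined,
      ring.zero = (\<lambda>_. \<zero>\<^bsub>A\<^esub>), add = (\<lambda>F G x. F x \<oplus>\<^bsub>A\<^esub> G x),
      smult = (\<lambda>r F x. r \<otimes>\<^bsub>A\<^esub> F x)\<rparr>"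

definition basis_elem :: "'a ring \<Rightarrow> 'x \<Rightarrow> ('x \<Rightarrow> 'a)" where
  "basis_elem A x = (\<lambda>y. if y = x then \<one>\<^bsub>A\<^esub> else \<zero>\<^bsub>A\<^esub>)"

definition linear_extension ::
  "'a ring \<Rightarrow> ('a, 'n) module \<Rightarrow> ('x \<Rightarrow> 'n) \<Rightarrow> ('x \<Rightarrow> 'a) \<Rightarrow> 'n" where
  "linear_extension A N \<phi> F = finsum N (\<lambda>x. F x \<odot>\<^bsub>N\<^esub> \<phi> x) {x. F x \<noteq> \<zero>\<^bsub>A\<^esub>}"

text \<open>
  The module with generators \<open>E\<close> and relations \<open>R\<close>, its generators, and the map out of it that
  sends the generator \<open>x\<close> to \<open>\<phi> x\<close> (meaningful when \<open>\<phi>\<close> respects the relations, so that the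
  image of every coset is a singleton).
\<close>

definition presented :: "'a ring \<Rightarrow> 'x set \<Rightarrow> ('x \<Rightarrow> 'a) set \<Rightarrow> ('a, ('x \<Rightarrow> 'a) set) module" where
  "presented A E R = quotient_module (free_module A E) (submodule_span A (free_module A E) R)"

definition presented_gen :: "'a ring \<Rightarrow> 'x set \<Rightarrow> ('x \<Rightarrow> 'a) set \<Rightarrow> 'x \<Rightarrow> ('x \<Rightarrow> 'a) set" where
  "presented_gen A E R x =
     submodule_span A (free_module A E) R +>\<^bsub>free_module A E\<^esub> basis_elem A x"

definition presented_map ::
  "'a ring \<Rightarrow> ('a, 'n) module \<Rightarrow> ('x \<Rightarrow> 'n) \<Rightarrow> ('x \<Rightarrow> 'a) set \<Rightarrow> 'n" where
  "presented_map A N \<phi> S = the_elem (linear_extension A N \<phi> ` S)"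

section \<open>Tensor products and faithful flatness\<close>

definition tensor_rels ::
  "'a ring \<Rightarrow> ('a, 'm) module \<Rightarrow> ('a, 'n) module \<Rightarrow> ('m \<times> 'n \<Rightarrow> 'a) set" where
  "tensor_rels A M N =
    (let F = free_module A (carrier M \<times> carrier N); e = basis_elem A in
       {e (x \<oplus>\<^bsub>M\<^esub> x', y) \<ominus>\<^bsub>F\<^esub> (e (x, y) \<oplus>\<^bsub>F\<^esub> e (x', y)) | x x' y.
          x \<in> carrier M \<and> x' \<in> carrier M \<and> y \<in> carrier N} \<union>
       {e (x, y \<oplus>\<^bsub>N\<^esub> y') \<ominus>\<^bsub>F\<^esub> (e (x, y) \<oplus>\<^bsub>F\<^esub> e (x, y')) | x y y'.
          x \<in> carrier M \<and> y \<in> carrier N \<and> y' \<in> carrier N} \<union>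
       {e (r \<odot>\<^bsub>M\<^esub> x, y) \<ominus>\<^bsub>F\<^esub> (r \<odot>\<^bsub>F\<^esub> e (x, y)) | r x y.
          r \<in> carrier A \<and> x \<in> carrier M \<and> y \<in> carrier N} \<union>
       {e (x, r \<odot>\<^bsub>N\<^esub> y) \<ominus>\<^bsub>F\<^esub> (r \<odot>\<^bsub>F\<^esub> e (x, y)) | r x y.
          r \<in> carrier A \<and> x \<in> carrier M \<and> y \<in> carrier N})"

definition tensor ::
  "'a ring \<Rightarrow> ('a, 'm) module \<Rightarrow> ('a, 'n) module \<Rightarrow> ('a, ('m \<times> 'n \<Rightarrow> 'a) set) module" where
  "tensor A M N = presented A (carrier M \<times> carrier N) (tensor_rels A M N)"

definition tensor_elem ::
  "'a ring \<Rightarrow> ('a, 'm) module \<Rightarrow> ('a, 'n) module \<Rightarrow> 'm \<Rightarrow> 'n \<Rightarrow> ('m \<times> 'n \<Rightarrow> 'a) set" where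
  "tensor_elem A M N x y =
     presented_gen A (carrier M \<times> carrier N) (tensor_rels A M N) (x, y)"

text \<open>The map \<open>M \<otimes> N \<rightarrow> M \<otimes> N'\<close> induced by \<open>u : N \<rightarrow> N'\<close>.\<close>

definition tensor_map ::
  "'a ring \<Rightarrow> ('a, 'm) module \<Rightarrow> ('a, 'n) module \<Rightarrow> ('n \<Rightarrow> 'n) \<Rightarrow>
   ('m \<times> 'n \<Rightarrow> 'a) set \<Rightarrow> ('m \<times> 'n \<Rightarrow> 'a) set" where
  "tensor_map A M N' u = presented_map A (tensor A M N') (\<lambda>(x, y). tensor_elem A M N' x (u y))"

definition exact_at ::
  "('a, 'l) module \<Rightarrow> ('a, 'm) module \<Rightarrow> ('a, 'n) module \<Rightarrow> ('l \<Rightarrow> 'm) \<Rightarrow> ('m \<Rightarrow> 'n) \<Rightarrow> bool" where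
  "exact_at L M N u v \<longleftrightarrow> u ` carrier L = {y \<in> carrier M. v y = \<zero>\<^bsub>N\<^esub>}"

text \<open>
  A module \<open>M\<close> is faithfully flat if a sequence is exact if and only if its tensor product with
  \<open>M\<close> is. HOL cannot quantify over types inside a definition; the test modules live on
  \<open>'a list set\<close>, which suffices: each finitely generated \<open>A\<close>-module is a quotient of some
  \<open>A\<^sup>n\<close>, hence isomorphic to one carried by sets of lists over \<open>A\<close>, and both flatness
  (via ideals) and faithfulness (via the modules \<open>A/I\<close>) are detected on finitely generated
  modules and ideals of \<open>A\<close>.
\<close>

definition faithfully_flat_module :: "'a ring \<Rightarrow> ('a, 'm) module \<Rightarrow> bool" where
  "faithfully_flat_module A M \<longleftrightarrow> module A M \<and>
     (\<forall>(N1 :: ('a, 'a list set) module) (N2 :: ('a, 'a list set) module)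
       (N3 :: ('a, 'a list set) module) u v.
        module A N1 \<and> module A N2 \<and> module A N3 \<and>
        u \<in> linear_maps A N1 N2 \<and> v \<in> linear_maps A N2 N3 \<longrightarrow>
        (exact_at N1 N2 N3 u v \<longleftrightarrow>
         exact_at (tensor A M N1) (tensor A M N2) (tensor A M N3)
           (tensor_map A M N2 u) (tensor_map A M N3 v)))"

definition faithfully_flat :: "'a ring \<Rightarrow> 'b ring \<Rightarrow> ('a \<Rightarrow> 'b) \<Rightarrow> bool" where
  "faithfully_flat A B f \<longleftrightarrow>
     f \<in> ring_hom A B \<and> faithfully_flat_module A (restrict_scalars f B)"

section \<open>Cochain complexes\<close>

text \<open>A complex is given by modules \<open>C i\<close> and differentials \<open>d i : C i \<rightarrow> C (i + 1)\<close>.\<close>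

definition cochain_complex ::
  "'a ring \<Rightarrow> (int \<Rightarrow> ('a, 'm) module) \<Rightarrow> (int \<Rightarrow> 'm \<Rightarrow> 'm) \<Rightarrow> bool" where
  "cochain_complex A C d \<longleftrightarrow>
     (\<forall>i. module A (C i) \<and> d i \<in> linear_maps A (C i) (C (i + 1)) \<and>
          (\<forall>x \<in> carrier (C i). d (i + 1) (d i x) = \<zero>\<^bsub>C (i + 2)\<^esub>))"

definition cochain_map ::
  "'a ring \<Rightarrow> (int \<Rightarrow> ('a, 'm) module) \<Rightarrow> (int \<Rightarrow> 'm \<Rightarrow> 'm) \<Rightarrow>
   (int \<Rightarrow> ('a, 'n) module) \<Rightarrow> (int \<Rightarrow> 'n \<Rightarrow> 'n) \<Rightarrow> (int \<Rightarrow> 'm \<Rightarrow> 'n) \<Rightarrow> bool" where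
  "cochain_map A C d C' d' q \<longleftrightarrow>
     (\<forall>i. q i \<in> linear_maps A (C i) (C' i) \<and>
          (\<forall>x \<in> carrier (C i). q (i + 1) (d i x) = d' i (q i x)))"

definition cocycles ::
  "(int \<Rightarrow> ('a, 'm) module) \<Rightarrow> (int \<Rightarrow> 'm \<Rightarrow> 'm) \<Rightarrow> int \<Rightarrow> 'm set" where
  "cocycles C d i = {x \<in> carrier (C i). d i x = \<zero>\<^bsub>C (i + 1)\<^esub>}"

definition coboundaries ::
  "(int \<Rightarrow> ('a, 'm) module) \<Rightarrow> (int \<Rightarrow> 'm \<Rightarrow> 'm) \<Rightarrow> int \<Rightarrow> 'm set" where
  "coboundaries C d i = d (i - 1) ` carrier (C (i - 1))"

definition cohomology ::
  "(int \<Rightarrow> ('a, 'm) module) \<Rightarrow> (int \<Rightarrow> 'm \<Rightarrow> 'm) \<Rightarrow> int \<Rightarrow> 'm set set" where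
  "cohomology C d i = (\<lambda>z. coboundaries C d i +>\<^bsub>C i\<^esub> z) ` cocycles C d i"

definition cohomology_map ::
  "(int \<Rightarrow> ('a, 'n) module) \<Rightarrow> (int \<Rightarrow> 'n \<Rightarrow> 'n) \<Rightarrow> (int \<Rightarrow> 'm \<Rightarrow> 'n) \<Rightarrow> int \<Rightarrow> 'm set \<Rightarrow> 'n set" where
  "cohomology_map C' d' q i S = the_elem ((\<lambda>z. coboundaries C' d' i +>\<^bsub>C' i\<^esub> q i z) ` S)"

definition quasi_isomorphism ::
  "'a ring \<Rightarrow> (int \<Rightarrow> ('a, 'm) module) \<Rightarrow> (int \<Rightarrow> 'm \<Rightarrow> 'm) \<Rightarrow>
   (int \<Rightarrow> ('a, 'n) module) \<Rightarrow> (int \<Rightarrow> 'n \<Rightarrow> 'n) \<Rightarrow> (int \<Rightarrow> 'm \<Rightarrow> 'n) \<Rightarrow> bool" where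
  "quasi_isomorphism A C d C' d' q \<longleftrightarrow>
     cochain_map A C d C' d' q \<and>
     (\<forall>i. bij_betw (cohomology_map C' d' q i) (cohomology C d i) (cohomology C' d' i))"

definition null_homotopic ::
  "'a ring \<Rightarrow> (int \<Rightarrow> ('a, 'm) module) \<Rightarrow> (int \<Rightarrow> 'm \<Rightarrow> 'm) \<Rightarrow>
   (int \<Rightarrow> ('a, 'n) module) \<Rightarrow> (int \<Rightarrow> 'n \<Rightarrow> 'n) \<Rightarrow> (int \<Rightarrow> 'm \<Rightarrow> 'n) \<Rightarrow> bool" where
  "null_homotopic A C d C' d' q \<longleftrightarrow>
     (\<exists>h. \<forall>i. h i \<in> linear_maps A (C i) (C' (i - 1)) \<and>
        (\<forall>x \<in> carrier (C i). q i x = d' (i - 1) (h i x) \<oplus>\<^bsub>C' i\<^esub> h (i + 1) (d i x)))"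

text \<open>The complex \<open>M\<close> concentrated in degree 0; its differential is \<open>stalk_diff M\<close>.\<close>

definition stalk :: "('a, 'm) module \<Rightarrow> int \<Rightarrow> ('a, 'm) module" where
  "stalk M i = (if i = 0 then M else M\<lparr>carrier := {\<zero>\<^bsub>M\<^esub>}\<rparr>)"

definition stalk_diff :: "('a, 'm) module \<Rightarrow> int \<Rightarrow> 'm \<Rightarrow> 'm" where
  "stalk_diff M i x = \<zero>\<^bsub>M\<^esub>"

text \<open>
  The homotopy fiber \<open>cone(q)[-1]\<close> of a map of complexes \<open>q : C \<rightarrow> D\<close>. The natural map to \<open>C\<close>
  is \<open>fst\<close> in each degree.
\<close>

definition fiber ::
  "(int \<Rightarrow> ('a, 'm) module) \<Rightarrow> (int \<Rightarrow> ('a, 'n) module) \<Rightarrow> int \<Rightarrow> ('a, 'm \<times> 'n) module" where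
  "fiber C D i = direct_sum (C i) (D (i - 1))"

definition fiber_diff ::
  "(int \<Rightarrow> 'm \<Rightarrow> 'm) \<Rightarrow> (int \<Rightarrow> ('a, 'n) module) \<Rightarrow> (int \<Rightarrow> 'n \<Rightarrow> 'n) \<Rightarrow> (int \<Rightarrow> 'm \<Rightarrow> 'n) \<Rightarrow>
   int \<Rightarrow> 'm \<times> 'n \<Rightarrow> 'm \<times> 'n" where
  "fiber_diff dC D dD q i = (\<lambda>(x, y). (dC i x, q i x \<ominus>\<^bsub>D i\<^esub> dD (i - 1) y))"

section \<open>Tensor powers of complexes\<close>

text \<open>
  The degree \<open>k\<close> part of the \<open>n\<close>-fold tensor power of \<open>C\<close>, that is the direct sum of the modules
  \<open>C i\<^sub>1 \<otimes> ... \<otimes> C i\<^sub>n\<close> over all \<open>i\<^sub>1 + ... + i\<^sub>n = k\<close>. The list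
  \<open>[(i\<^sub>1, x\<^sub>1), ..., (i\<^sub>n, x\<^sub>n)]\<close> stands for the pure tensor \<open>x\<^sub>1 \<otimes> ... \<otimes> x\<^sub>n\<close>
  with \<open>x\<^sub>j\<close> in degree \<open>i\<^sub>j\<close>. For \<open>n = 0\<close> this is \<open>A\<close> in degree 0.
\<close>

definition tensor_power_gens ::
  "(int \<Rightarrow> ('a, 'm) module) \<Rightarrow> nat \<Rightarrow> int \<Rightarrow> (int \<times> 'm) list set" where
  "tensor_power_gens C n k =
     {t. length t = n \<and> (\<forall>(i, x) \<in> set t. x \<in> carrier (C i)) \<and> sum_list (map fst t) = k}"

definition tensor_power_rels ::
  "'a ring \<Rightarrow> (int \<Rightarrow> ('a, 'm) module) \<Rightarrow> nat \<Rightarrow> int \<Rightarrow> ((int \<times> 'm) list \<Rightarrow> 'a) set" where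
  "tensor_power_rels A C n k =
    (let E = tensor_power_gens C n k; F = free_module A E; e = basis_elem A in
       {e (us @ (i, x \<oplus>\<^bsub>C i\<^esub> y) # vs) \<ominus>\<^bsub>F\<^esub>
          (e (us @ (i, x) # vs) \<oplus>\<^bsub>F\<^esub> e (us @ (i, y) # vs)) | us i x y vs.
          us @ (i, x) # vs \<in> E \<and> us @ (i, y) # vs \<in> E} \<union>
       {e (us @ (i, r \<odot>\<^bsub>C i\<^esub> x) # vs) \<ominus>\<^bsub>F\<^esub> (r \<odot>\<^bsub>F\<^esub> e (us @ (i, x) # vs)) | r us i x vs.
          r \<in> carrier A \<and> us @ (i, x) # vs \<in> E})"

definition tensor_power ::
  "'a ring \<Rightarrow> (int \<Rightarrow> ('a, 'm) module) \<Rightarrow> nat \<Rightarrow> int \<Rightarrow>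
   ('a, ((int \<times> 'm) list \<Rightarrow> 'a) set) module" where
  "tensor_power A C n k = presented A (tensor_power_gens C n k) (tensor_power_rels A C n k)"

definition tensor_power_elem ::
  "'a ring \<Rightarrow> (int \<Rightarrow> ('a, 'm) module) \<Rightarrow> nat \<Rightarrow> int \<Rightarrow> (int \<times> 'm) list \<Rightarrow>
   ((int \<times> 'm) list \<Rightarrow> 'a) set" where
  "tensor_power_elem A C n k =
     presented_gen A (tensor_power_gens C n k) (tensor_power_rels A C n k)"

text \<open>The differential, with the Koszul sign \<open>(-1)\<close> to the power \<open>i\<^sub>1 + ... + i\<^sub>j\<close> when \<open>d\<close> moves past the
  first \<open>j\<close> factors.\<close>

definition tensor_power_diff ::
  "'a ring \<Rightarrow> (int \<Rightarrow> ('a, 'm) module) \<Rightarrow> (int \<Rightarrow> 'm \<Rightarrow> 'm) \<Rightarrow> nat \<Rightarrow> int \<Rightarrow>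
   ((int \<times> 'm) list \<Rightarrow> 'a) set \<Rightarrow> ((int \<times> 'm) list \<Rightarrow> 'a) set" where
  "tensor_power_diff A C d n k =
    (let T = tensor_power A C n (k + 1) in
       presented_map A T (\<lambda>t. finsum T (\<lambda>j.
         let (i, x) = t ! j;
             c = tensor_power_elem A C n (k + 1) (t[j := (i + 1, d i x)])
         in if even (sum_list (map fst (take j t))) then c else \<ominus>\<^bsub>T\<^esub> c) {..<n}))"

text \<open>
  For a map of complexes \<open>\<epsilon>\<close> from \<open>C\<close> to \<open>A\<close> (in degree 0), the composite of its \<open>n\<close>-fold tensor
  power with the isomorphism from the \<open>n\<close>-fold tensor power of \<open>A\<close> to \<open>A\<close> given by multiplication.
  Tensors with a factor outside degree 0 go to 0, because there \<open>\<epsilon>\<close> takes values in the zero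
  module.
\<close>

definition tensor_power_to_base ::
  "'a ring \<Rightarrow> (int \<Rightarrow> 'm \<Rightarrow> 'a) \<Rightarrow> ((int \<times> 'm) list \<Rightarrow> 'a) set \<Rightarrow> 'a" where
  "tensor_power_to_base A \<epsilon> =
     presented_map A (regular_module A) (\<lambda>t. foldr (\<lambda>(i, x) r. \<epsilon> i x \<otimes>\<^bsub>A\<^esub> r) t \<one>\<^bsub>A\<^esub>)"

section \<open>Descendability\<close>

definition ring_fiber :: "'a ring \<Rightarrow> 'b ring \<Rightarrow> ('a \<Rightarrow> 'b) \<Rightarrow> int \<Rightarrow> ('a, 'a \<times> 'b) module" where
  "ring_fiber A B f = fiber (stalk (regular_module A)) (stalk (restrict_scalars f B))"

definition ring_fiber_diff ::
  "'a ring \<Rightarrow> 'b ring \<Rightarrow> ('a \<Rightarrow> 'b) \<Rightarrow> int \<Rightarrow> 'a \<times> 'b \<Rightarrow> 'a \<times> 'b" where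
  "ring_fiber_diff A B f =
     fiber_diff (stalk_diff (regular_module A))
       (stalk (restrict_scalars f B)) (stalk_diff (restrict_scalars f B)) (\<lambda>_. f)"

definition free_resolution ::
  "'a ring \<Rightarrow> (int \<Rightarrow> 'x set) \<Rightarrow> (int \<Rightarrow> ('x \<Rightarrow> 'a) \<Rightarrow> ('x \<Rightarrow> 'a)) \<Rightarrow>
   (int \<Rightarrow> ('a, 'm) module) \<Rightarrow> (int \<Rightarrow> 'm \<Rightarrow> 'm) \<Rightarrow> (int \<Rightarrow> ('x \<Rightarrow> 'a) \<Rightarrow> 'm) \<Rightarrow> bool" where
  "free_resolution A E d C dC q \<longleftrightarrow>
     (\<exists>N. \<forall>i > N. E i = {}) \<and>
     cochain_complex A (\<lambda>i. free_module A (E i)) d \<and>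
     quasi_isomorphism A (\<lambda>i. free_module A (E i)) d C dC q"

text \<open>
  The derived tensor power of \<open>fib f\<close> is computed by the tensor power of a bounded above free
  resolution \<open>P\<close> of \<open>fib f\<close>. This tensor power is again a bounded above complex of free modules, so
  that maps out of it in the derived category are homotopy classes of maps of complexes. The
  condition does not depend on \<open>P\<close>, so "for every \<open>P\<close>" amounts to "for some \<open>P\<close>". Resolutions with
  bases in \<open>('a \<times> 'b) list\<close> exist: this type is infinite and at least as large as \<open>A\<close> and \<open>B\<close>, so
  it has enough elements for a basis in each degree.
\<close>

definition descendable_index_le :: "'a ring \<Rightarrow> 'b ring \<Rightarrow> ('a \<Rightarrow> 'b) \<Rightarrow> nat \<Rightarrow> bool" where
  "descendable_index_le A B f n \<longleftrightarrow>
     (\<forall>(E :: int \<Rightarrow> ('a \<times> 'b) list set) d q.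
        free_resolution A E d (ring_fiber A B f) (ring_fiber_diff A B f) q \<longrightarrow>
        (let P = (\<lambda>i. free_module A (E i)) in
         null_homotopic A
           (tensor_power A P n) (tensor_power_diff A P d n)
           (stalk (regular_module A)) (stalk_diff (regular_module A))
           (\<lambda>_. tensor_power_to_base A (\<lambda>i x. fst (q i x)))))"

end

theory Submission
  imports Defs "HOL-Library.Z2"
begin

text \<open>
  Let \<open>Z\<close> be a set of size aleph-n. The points \<open>(S, y\<^sub>1, ..., y\<^sub>n)\<close> with \<open>S \<subseteq> Z\<close> and labellings
  \<open>y\<^sub>j : Z \<rightarrow> F\<^sub>2\<close> form a Cantor cube; \<open>B'\<close> is its ring of clopen functions and \<open>B\<close> the subring of functions
  that are invariant under adding the indicator function of \<open>S\<close> to any \<open>y\<^sub>j\<close>. Injective maps of Boolean rings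
  are faithfully flat, as one checks locally at the points of \<open>B'\<close>. For \<open>a \<in> Z\<close> let \<open>x\<^sub>a \<in> B\<close> be the function \<open>a \<in> S\<close>.
  The 1-cocycles \<open>x\<^sub>a x\<^sub>b (y\<^sub>j(a) + y\<^sub>j(b))\<close> define classes in the first Ext group from the ideal \<open>(x\<^sub>a)\<close> to \<open>B\<close>
  that die in \<open>B'\<close>. If the map were descendable of index at most \<open>n\<close>, then the product of these \<open>n\<close>
  classes would vanish, hence be the coboundary of a family \<open>b(a\<^sub>1, ..., a\<^sub>n) \<in> B\<close>. Each member of this family depends on
  finitely many coordinates only. As \<open>Z\<close> has size aleph-n, there are distinct \<open>a\<^sub>0, ..., a\<^sub>n\<close> such that
  each \<open>b\<close> of \<open>n\<close> of them does not depend on the coordinates of the remaining one. Summing the coboundary equation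
  over suitable points with \<open>S = {a\<^sub>0, ..., a\<^sub>n}\<close>, indexed by the injective maps \<open>{1, ..., n} \<rightarrow> {0, ..., n}\<close>, kills every
  \<open>b\<close> while the product cocycle contributes 1. The size of \<open>B'\<close> is aleph-n, which is
  less than aleph-2n unless \<open>n = 0\<close>.
\<close>

section \<open>Linear maps, free modules and presentations\<close>

text \<open>Why the product of the classes factors through the fiber: as the ring map is injective,
  its fiber is its cokernel placed in degree 1. The elements \<open>x\<^sub>a y\<^sub>j(a)\<close>
  define a linear map from the ideal of the \<open>x\<^sub>a\<close> to this cokernel, and following
  it by the natural map from the fiber to the base gives the j-th class. To multiply the classes on
  complexes, a list of indices is cut into n blocks, and each block is lifted to a resolution.
  Descendability speaks of every resolution, so one convenient resolution suffices to refute it.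

  Two devices keep the bookkeeping small: signs vanish because \<open>x + x = 0\<close> in all
  modules that occur, and identities in a Boolean ring are tested at its homomorphisms to the field
  with two elements, where they concern bits.

  The suitable points are step functions: labelling j takes the value \<open>m j \<le> l\<close> at
  \<open>a\<^sub>l\<close>. Exchanging the values i and i + 1 of m affects only
  \<open>a\<^sub>i\<close>; exchanging 0 and n complements whole labellings away from
  \<open>a\<^sub>n\<close>, and that is the symmetry under which the base is invariant.\<close>

lemma linear_mapsI:
  assumes "\<And>x. x \<in> carrier M \<Longrightarrow> h x \<in> carrier N"
    and "\<And>x y. x \<in> carrier M \<Longrightarrow> y \<in> carrier M \<Longrightarrow> h (x \<oplus>\<^bsub>M\<^esub> y) = h x \<oplus>\<^bsub>N\<^esub> h y"
    and "\<And>r x. r \<in> carrier A \<Longrightarrow> x \<in> carrier M \<Longrightarrow> h (r \<odot>\<^bsub>M\<^esub> x) = r \<odot>\<^bsub>N\<^esub> h x"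
  shows "h \<in> linear_maps A M N"
  using assms by (auto simp: linear_maps_def)

lemma linear_mapsD:
  assumes "h \<in> linear_maps A M N"
  shows "x \<in> carrier M \<Longrightarrow> h x \<in> carrier N"
    and "x \<in> carrier M \<Longrightarrow> y \<in> carrier M \<Longrightarrow> h (x \<oplus>\<^bsub>M\<^esub> y) = h x \<oplus>\<^bsub>N\<^esub> h y"
    and "r \<in> carrier A \<Longrightarrow> x \<in> carrier M \<Longrightarrow> h (r \<odot>\<^bsub>M\<^esub> x) = r \<odot>\<^bsub>N\<^esub> h x"
  using assms by (auto simp: linear_maps_def)

lemma linear_maps_comp:
  assumes "h \<in> linear_maps A M N" "k \<in> linear_maps A N L"
  shows "(\<lambda>x. k (h x)) \<in> linear_maps A M L"
  by (intro linear_mapsI) (simp_all add: linear_mapsD[OF assms(1)] linear_mapsD[OF assms(2)])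

lemma linear_maps_zero:
  assumes "module A M" "module A N" "h \<in> linear_maps A M N"
  shows "h \<zero>\<^bsub>M\<^esub> = \<zero>\<^bsub>N\<^esub>"
proof -
  interpret M: module A M by fact
  interpret N: module A N by fact
  have "h \<zero>\<^bsub>M\<^esub> = h (\<zero>\<^bsub>A\<^esub> \<odot>\<^bsub>M\<^esub> \<zero>\<^bsub>M\<^esub>)" by simp
  also have "\<dots> = \<zero>\<^bsub>A\<^esub> \<odot>\<^bsub>N\<^esub> h \<zero>\<^bsub>M\<^esub>" by (rule linear_mapsD(3)[OF assms(3)]) simp_all
  also have "\<dots> = \<zero>\<^bsub>N\<^esub>" by (simp add: linear_mapsD[OF assms(3)])
  finally show ?thesis .
qed

lemma linear_maps_uminus:
  assumes "module A M" "module A N" "h \<in> linear_maps A M N" "x \<in> carrier M"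
  shows "h (\<ominus>\<^bsub>M\<^esub> x) = \<ominus>\<^bsub>N\<^esub> h x"
proof -
  interpret M: module A M by fact
  interpret N: module A N by fact
  have "h (\<ominus>\<^bsub>M\<^esub> x) \<oplus>\<^bsub>N\<^esub> h x = h (\<ominus>\<^bsub>M\<^esub> x \<oplus>\<^bsub>M\<^esub> x)"
    using assms(4) by (simp add: linear_mapsD[OF assms(3)])
  also have "\<dots> = \<zero>\<^bsub>N\<^esub>"
    using assms(4) linear_maps_zero[OF assms(1-3)] by (simp add: M.M.l_neg)
  finally show ?thesis
    using assms(4) by (metis N.M.minus_equality M.M.a_inv_closed linear_mapsD(1)[OF assms(3)])
qed

lemma linear_maps_finsum:
  assumes "module A M" "module A N" "h \<in> linear_maps A M N" "g \<in> S \<rightarrow> carrier M"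
  shows "h (finsum M g S) = finsum N (\<lambda>i. h (g i)) S"
proof -
  interpret M: module A M by fact
  interpret N: module A N by fact
  show ?thesis using assms(4)
  proof (induction S rule: infinite_finite_induct)
    case (insert x F)
    then show ?case
      by (simp add: Pi_iff linear_mapsD[OF assms(3)])
  qed (simp_all add: linear_maps_zero[OF assms(1-3)])
qed

lemma submodule_kernel:
  assumes "module A M" "module A N" "h \<in> linear_maps A M N"
  shows "submodule {x \<in> carrier M. h x = \<zero>\<^bsub>N\<^esub>} A M"
proof -
  interpret M: module A M by fact
  interpret N: module A N by fact
  show ?thesis
    by (rule M.submoduleI)
      (auto simp: linear_mapsD[OF assms(3)] linear_maps_zero[OF assms] linear_maps_uminus[OF assms])
qed

text \<open>The axioms are carried along the surjection \<open>p\<close>, so \<open>Q\<close> may be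
  a bare record. Sets of cosets become modules in this way.\<close>

lemma module_image:
  assumes "module A M" "carrier Q = p ` carrier M" "p \<zero>\<^bsub>M\<^esub> = \<zero>\<^bsub>Q\<^esub>"
    and add: "\<And>x y. x \<in> carrier M \<Longrightarrow> y \<in> carrier M \<Longrightarrow> p x \<oplus>\<^bsub>Q\<^esub> p y = p (x \<oplus>\<^bsub>M\<^esub> y)"
    and smult: "\<And>r x. r \<in> carrier A \<Longrightarrow> x \<in> carrier M \<Longrightarrow> r \<odot>\<^bsub>Q\<^esub> p x = p (r \<odot>\<^bsub>M\<^esub> x)"
  shows "module A Q"
proof -
  interpret M: module A M by fact
  show ?thesis
  proof (rule moduleI)
    show "cring A" by (rule M.R.is_cring)
    show "abelian_group Q"
    proof (rule abelian_groupI)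
      fix x y z assume "x \<in> carrier Q" "y \<in> carrier Q" "z \<in> carrier Q"
      then show "x \<oplus>\<^bsub>Q\<^esub> y \<oplus>\<^bsub>Q\<^esub> z = x \<oplus>\<^bsub>Q\<^esub> (y \<oplus>\<^bsub>Q\<^esub> z)"
        by (auto simp: assms(2) add M.M.a_assoc)
    next
      fix x assume "x \<in> carrier Q"
      then obtain u where u: "x = p u" "u \<in> carrier M" using assms(2) by auto
      then have "p (\<ominus>\<^bsub>M\<^esub> u) \<oplus>\<^bsub>Q\<^esub> x = \<zero>\<^bsub>Q\<^esub>"
        by (simp add: add M.M.l_neg assms(3))
      then show "\<exists>y\<in>carrier Q. y \<oplus>\<^bsub>Q\<^esub> x = \<zero>\<^bsub>Q\<^esub>"
        using u(2) assms(2) by blast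
    qed (auto simp: assms(2) assms(3)[symmetric] add M.M.a_comm)
  qed (auto simp: assms(2) add smult M.smult_l_distr M.smult_r_distr M.smult_assoc1)
qed

lemma free_module_simps [simp]:
  "\<zero>\<^bsub>free_module A E\<^esub> = (\<lambda>_. \<zero>\<^bsub>A\<^esub>)"
  "F \<oplus>\<^bsub>free_module A E\<^esub> G = (\<lambda>x. F x \<oplus>\<^bsub>A\<^esub> G x)"
  "r \<odot>\<^bsub>free_module A E\<^esub> F = (\<lambda>x. r \<otimes>\<^bsub>A\<^esub> F x)"
  by (simp_all add: free_module_def)

lemma free_module_carrier:
  "F \<in> carrier (free_module A E) \<longleftrightarrow> (\<forall>x. F x \<in> carrier A) \<and>
     {x. F x \<noteq> \<zero>\<^bsub>A\<^esub>} \<subseteq> E \<and> finite {x. F x \<noteq> \<zero>\<^bsub>A\<^esub>}"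
  by (simp add: free_module_def)

section \<open>Free modules and linear maps out of them\<close>

locale base_ring = cring R for R :: "'a ring" (structure)
begin

lemma free_add_closed:
  assumes "F \<in> carrier (free_module R E)" "G \<in> carrier (free_module R E)"
  shows "(\<lambda>x. F x \<oplus> G x) \<in> carrier (free_module R E)"
proof -
  have "{x. F x \<oplus> G x \<noteq> \<zero>} \<subseteq> {x. F x \<noteq> \<zero>} \<union> {x. G x \<noteq> \<zero>}" by auto
  moreover from this have "finite {x. F x \<oplus> G x \<noteq> \<zero>}"
    using assms by (auto simp: free_module_carrier intro: finite_subset)
  ultimately show ?thesis using assms by (auto simp: free_module_carrier)
qed

lemma free_smult_closed:
  assumes "F \<in> carrier (free_module R E)" "r \<in> carrier R"
  shows "(\<lambda>x. r \<otimes> F x) \<in> carrier (free_module R E)"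
proof -
  have *: "{x. r \<otimes> F x \<noteq> \<zero>} \<subseteq> {x. F x \<noteq> \<zero>}" using assms(2) by auto
  then have "finite {x. r \<otimes> F x \<noteq> \<zero>}"
    using assms by (auto simp: free_module_carrier intro: finite_subset)
  with * show ?thesis using assms by (auto simp: free_module_carrier)
qed

lemma free_uminus_closed:
  assumes "F \<in> carrier (free_module R E)"
  shows "(\<lambda>x. \<ominus> F x) \<in> carrier (free_module R E)"
proof -
  have *: "{x. \<ominus> F x \<noteq> \<zero>} \<subseteq> {x. F x \<noteq> \<zero>}" by auto
  then have "finite {x. \<ominus> F x \<noteq> \<zero>}"
    using assms by (auto simp: free_module_carrier intro: finite_subset)
  with * show ?thesis using assms by (auto simp: free_module_carrier)
qed

lemma module_free: "module R (free_module R E)"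
proof (rule moduleI)
  show "cring R" by (rule is_cring)
  show "abelian_group (free_module R E)"
  proof (rule abelian_groupI)
    fix F assume F: "F \<in> carrier (free_module R E)"
    show "\<exists>y\<in>carrier (free_module R E). y \<oplus>\<^bsub>free_module R E\<^esub> F = \<zero>\<^bsub>free_module R E\<^esub>"
      using F by (intro bexI[OF _ free_uminus_closed[OF F]])
        (auto simp: free_module_carrier l_neg)
  qed (auto simp: free_add_closed, auto simp: free_module_carrier a_ac)
qed (auto simp: free_smult_closed, auto simp: free_module_carrier l_distr r_distr m_assoc)

lemma basis_closed: "x \<in> E \<Longrightarrow> basis_elem R x \<in> carrier (free_module R E)"
  by (auto simp: free_module_carrier basis_elem_def)

lemma linear_extension_superset:
  assumes "module R N" "\<phi> \<in> E \<rightarrow> carrier N" "F \<in> carrier (free_module R E)"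
    and "finite S" "{x. F x \<noteq> \<zero>} \<subseteq> S" "S \<subseteq> E"
  shows "linear_extension R N \<phi> F = finsum N (\<lambda>x. F x \<odot>\<^bsub>N\<^esub> \<phi> x) S"
proof -
  interpret N: module R N by fact
  show ?thesis unfolding linear_extension_def
    using assms by (intro N.M.add.finprod_mono_neutral_cong_left)
      (auto simp: free_module_carrier Pi_iff)
qed

lemma linear_extension_linear:
  assumes "module R N" "\<phi> \<in> E \<rightarrow> carrier N"
  shows "linear_extension R N \<phi> \<in> linear_maps R (free_module R E) N"
proof -
  interpret N: module R N by fact
  note ext = linear_extension_superset[OF assms]
  show ?thesis
  proof (rule linear_mapsI)
    fix F assume F: "F \<in> carrier (free_module R E)"
    then have c: "(\<lambda>x. F x \<odot>\<^bsub>N\<^esub> \<phi> x) \<in> {x. F x \<noteq> \<zero>} \<rightarrow> carrier N"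
      using assms(2) by (auto simp: free_module_carrier)
    then show "linear_extension R N \<phi> F \<in> carrier N"
      unfolding linear_extension_def by (rule N.M.finsum_closed)
    fix r assume r: "r \<in> carrier R"
    let ?S = "{x. F x \<noteq> \<zero>}"
    have "linear_extension R N \<phi> (r \<odot>\<^bsub>free_module R E\<^esub> F)
        = finsum N (\<lambda>x. (r \<otimes> F x) \<odot>\<^bsub>N\<^esub> \<phi> x) ?S"
      using F r free_smult_closed[OF F r]
      by (subst ext[of _ ?S]) (auto simp: free_module_carrier)
    also have "\<dots> = finsum N (\<lambda>x. r \<odot>\<^bsub>N\<^esub> (F x \<odot>\<^bsub>N\<^esub> \<phi> x)) ?S"
      using F r assms(2)
      by (intro N.M.finsum_cong') (auto simp: free_module_carrier Pi_iff N.smult_assoc1)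
    also have "\<dots> = r \<odot>\<^bsub>N\<^esub> finsum N (\<lambda>x. F x \<odot>\<^bsub>N\<^esub> \<phi> x) ?S"
      using F c r by (subst N.finsum_smult_ldistr) (auto simp: free_module_carrier)
    finally show "linear_extension R N \<phi> (r \<odot>\<^bsub>free_module R E\<^esub> F) = r \<odot>\<^bsub>N\<^esub> linear_extension R N \<phi> F"
      by (simp add: linear_extension_def)
  next
    fix F G assume F: "F \<in> carrier (free_module R E)" and G: "G \<in> carrier (free_module R E)"
    let ?S = "{x. F x \<noteq> \<zero>} \<union> {x. G x \<noteq> \<zero>}"
    have S: "finite ?S" "?S \<subseteq> E" using F G by (auto simp: free_module_carrier)
    have "linear_extension R N \<phi> (F \<oplus>\<^bsub>free_module R E\<^esub> G)
        = finsum N (\<lambda>x. (F x \<oplus> G x) \<odot>\<^bsub>N\<^esub> \<phi> x) ?S"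
      using free_add_closed[OF F G] S by (subst ext[of _ ?S]) auto
    also have "\<dots> = finsum N (\<lambda>x. F x \<odot>\<^bsub>N\<^esub> \<phi> x \<oplus>\<^bsub>N\<^esub> G x \<odot>\<^bsub>N\<^esub> \<phi> x) ?S"
      using F G assms(2)
      by (intro N.M.finsum_cong') (auto simp: free_module_carrier Pi_iff N.smult_l_distr)
    also have "\<dots> = finsum N (\<lambda>x. F x \<odot>\<^bsub>N\<^esub> \<phi> x) ?S \<oplus>\<^bsub>N\<^esub> finsum N (\<lambda>x. G x \<odot>\<^bsub>N\<^esub> \<phi> x) ?S"
      using F G assms(2) by (intro N.M.finsum_addf) (auto simp: free_module_carrier Pi_iff)
    also have "\<dots> = linear_extension R N \<phi> F \<oplus>\<^bsub>N\<^esub> linear_extension R N \<phi> G"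
      using F G S by (subst (1 2) ext[of _ ?S]) auto
    finally show "linear_extension R N \<phi> (F \<oplus>\<^bsub>free_module R E\<^esub> G) =
      linear_extension R N \<phi> F \<oplus>\<^bsub>N\<^esub> linear_extension R N \<phi> G" .
  qed
qed

lemma linear_extension_basis:
  assumes "module R N" "\<phi> \<in> E \<rightarrow> carrier N" "x \<in> E"
  shows "linear_extension R N \<phi> (basis_elem R x) = \<phi> x"
proof -
  interpret N: module R N by fact
  have "\<phi> x \<in> carrier N" using assms(2,3) by auto
  then show ?thesis
    using assms(3) basis_closed[OF assms(3)]
    by (subst linear_extension_superset[OF assms(1,2), of _ "{x}"]) (auto simp: basis_elem_def)
qed

lemma free_induct [consumes 1, case_names zero add]:
  assumes "F \<in> carrier (free_module R E)" "P (\<lambda>_. \<zero>)"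
    and step: "\<And>r x G. r \<in> carrier R \<Longrightarrow> x \<in> E \<Longrightarrow> G \<in> carrier (free_module R E) \<Longrightarrow> P G \<Longrightarrow>
      P (r \<odot>\<^bsub>free_module R E\<^esub> basis_elem R x \<oplus>\<^bsub>free_module R E\<^esub> G)"
  shows "P F"
proof -
  have "finite S \<Longrightarrow> F \<in> carrier (free_module R E) \<Longrightarrow> {x. F x \<noteq> \<zero>} = S \<Longrightarrow> P F" for S
  proof (induction S arbitrary: F rule: finite_induct)
    case empty
    then have "F = (\<lambda>_. \<zero>)" by auto
    with assms(2) show ?case by simp
  next
    case (insert x S)
    let ?G = "F(x := \<zero>)"
    have S: "{y. ?G y \<noteq> \<zero>} = S" using insert.hyps insert.prems by auto
    have G: "?G \<in> carrier (free_module R E)"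
      using insert.prems insert.hyps S by (auto simp: free_module_carrier)
    have x: "x \<in> E" "F x \<in> carrier R" using insert.prems by (auto simp: free_module_carrier)
    have "F = F x \<odot>\<^bsub>free_module R E\<^esub> basis_elem R x \<oplus>\<^bsub>free_module R E\<^esub> ?G"
      using insert.prems by (auto simp: fun_eq_iff basis_elem_def free_module_carrier)
    with step[OF x(2,1) G insert.IH[OF G S]] show ?case by simp
  qed
  with assms(1) show ?thesis by (auto simp: free_module_carrier)
qed

end

section \<open>Quotient modules\<close>

locale quotient_mod = module R M + N: submodule N R M
  for R :: "'a ring" (structure) and M :: "('a, 'm) module" (structure) and N
begin

lemma abelian_subgroup: "abelian_subgroup N M"
  by (rule abelian_subgroupI3)
    (auto intro: additive_subgroup.intro N.subgroup_axioms M.abelian_group_axioms)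

lemma coset_mem: "x \<in> carrier M \<Longrightarrow> y \<in> N +>\<^bsub>M\<^esub> x \<longleftrightarrow> (\<exists>n\<in>N. y = n \<oplus>\<^bsub>M\<^esub> x)"
  by (auto simp: a_r_coset_def')

lemma subset: "N \<subseteq> carrier M"
  using N.subset by simp

lemma coset_eq_iff:
  assumes "x \<in> carrier M" "y \<in> carrier M"
  shows "N +>\<^bsub>M\<^esub> x = N +>\<^bsub>M\<^esub> y \<longleftrightarrow> x \<ominus>\<^bsub>M\<^esub> y \<in> N"
proof -
  have self: "x \<in> N +>\<^bsub>M\<^esub> x"
    using assms(1) abelian_subgroup.a_rcos_self[OF abelian_subgroup] by blast
  have "N +>\<^bsub>M\<^esub> x = N +>\<^bsub>M\<^esub> y \<longleftrightarrow> x \<in> N +>\<^bsub>M\<^esub> y"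
    using self M.a_repr_independence[OF _ assms(2) N.subgroup_axioms, of x] by auto
  also have "\<dots> \<longleftrightarrow> x \<ominus>\<^bsub>M\<^esub> y \<in> N"
  proof
    assume "x \<in> N +>\<^bsub>M\<^esub> y"
    then obtain n where n: "n \<in> N" "x = n \<oplus>\<^bsub>M\<^esub> y" using assms by (auto simp: coset_mem)
    then have "n \<in> carrier M" using subset by auto
    then have "x \<ominus>\<^bsub>M\<^esub> y = n" using n assms by (simp add: M.minus_eq M.a_assoc M.r_neg)
    with n show "x \<ominus>\<^bsub>M\<^esub> y \<in> N" by simp
  next
    assume "x \<ominus>\<^bsub>M\<^esub> y \<in> N"
    moreover have "x = x \<ominus>\<^bsub>M\<^esub> y \<oplus>\<^bsub>M\<^esub> y"
      using assms by (simp add: M.minus_eq M.a_assoc M.l_neg)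
    ultimately show "x \<in> N +>\<^bsub>M\<^esub> y" using assms by (auto simp: coset_mem)
  qed
  finally show ?thesis .
qed

lemma quotient_carrier: "carrier (quotient_module M N) = (\<lambda>x. N +>\<^bsub>M\<^esub> x) ` carrier M"
  by (auto simp: quotient_module_def A_RCOSETS_def')

lemma quotient_zero: "\<zero>\<^bsub>quotient_module M N\<^esub> = N"
  by (simp add: quotient_module_def)

lemma coset_zero: "N +>\<^bsub>M\<^esub> \<zero>\<^bsub>M\<^esub> = N"
  using subset by simp

lemma coset_eq_zero_iff: "x \<in> carrier M \<Longrightarrow> N +>\<^bsub>M\<^esub> x = \<zero>\<^bsub>quotient_module M N\<^esub> \<longleftrightarrow> x \<in> N"
  using coset_eq_iff[of x "\<zero>\<^bsub>M\<^esub>"] M.minus_equality[of "\<zero>\<^bsub>M\<^esub>" "\<zero>\<^bsub>M\<^esub>"]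
  by (simp add: coset_zero quotient_zero M.minus_eq)

lemma coset_add:
  assumes "x \<in> carrier M" "y \<in> carrier M"
  shows "(N +>\<^bsub>M\<^esub> x) \<oplus>\<^bsub>quotient_module M N\<^esub> (N +>\<^bsub>M\<^esub> y) = N +>\<^bsub>M\<^esub> (x \<oplus>\<^bsub>M\<^esub> y)"
  using abelian_subgroup.a_rcos_sum[OF abelian_subgroup assms] by (simp add: quotient_module_def)

lemma coset_smult:
  assumes "r \<in> carrier R" "x \<in> carrier M"
  shows "r \<odot>\<^bsub>quotient_module M N\<^esub> (N +>\<^bsub>M\<^esub> x) = N +>\<^bsub>M\<^esub> (r \<odot>\<^bsub>M\<^esub> x)"
proof -
  have "N +>\<^bsub>M\<^esub> (r \<odot>\<^bsub>M\<^esub> z) = N +>\<^bsub>M\<^esub> (r \<odot>\<^bsub>M\<^esub> x)" if z: "z \<in> N +>\<^bsub>M\<^esub> x" for z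
  proof -
    obtain n where n: "n \<in> N" "z = n \<oplus>\<^bsub>M\<^esub> x" using z assms(2) by (auto simp: coset_mem)
    then have "n \<in> carrier M" using subset by auto
    then have "r \<odot>\<^bsub>M\<^esub> z \<ominus>\<^bsub>M\<^esub> r \<odot>\<^bsub>M\<^esub> x = r \<odot>\<^bsub>M\<^esub> n"
      using n assms by (simp add: smult_r_distr M.minus_eq M.a_assoc M.r_neg)
    then show ?thesis
      using n assms \<open>n \<in> carrier M\<close> N.smult_closed[of r n] by (subst coset_eq_iff) auto
  qed
  moreover have "x \<in> N +>\<^bsub>M\<^esub> x"
    using assms(2) abelian_subgroup.a_rcos_self[OF abelian_subgroup] by blast
  ultimately have "(\<Union>z\<in>N +>\<^bsub>M\<^esub> x. N +>\<^bsub>M\<^esub> (r \<odot>\<^bsub>M\<^esub> z)) = N +>\<^bsub>M\<^esub> (r \<odot>\<^bsub>M\<^esub> x)"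
    using UN_constant_eq[of x "N +>\<^bsub>M\<^esub> x"] by blast
  then show ?thesis by (simp add: quotient_module_def)
qed

lemma module_quotient: "module R (quotient_module M N)"
  by (rule module_image[where p = "\<lambda>x. N +>\<^bsub>M\<^esub> x"])
    (auto simp: quotient_carrier coset_add coset_smult quotient_zero coset_zero module_axioms)

lemma coset_linear: "(\<lambda>x. N +>\<^bsub>M\<^esub> x) \<in> linear_maps R M (quotient_module M N)"
  by (rule linear_mapsI) (auto simp: quotient_carrier coset_add coset_smult)

text \<open>A linear map that kills \<open>N\<close> is constant on each coset. This is what gives
  the \<open>the_elem\<close> in \<open>presented_map\<close> and \<open>cohomology_map\<close> its
  meaning.\<close>

lemma the_elem_coset:
  assumes "module R L" "h \<in> linear_maps R M L" "\<And>n. n \<in> N \<Longrightarrow> h n = \<zero>\<^bsub>L\<^esub>" "x \<in> carrier M"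
  shows "the_elem (h ` (N +>\<^bsub>M\<^esub> x)) = h x"
proof -
  interpret L: module R L by fact
  have "h z = h x" if "z \<in> N +>\<^bsub>M\<^esub> x" for z
    using that assms(4) subset linear_mapsD[OF assms(2)] assms(3)
    by (auto simp: coset_mem subset_iff)
  moreover have "x \<in> N +>\<^bsub>M\<^esub> x"
    using assms(4) abelian_subgroup.a_rcos_self[OF abelian_subgroup] by blast
  ultimately have "h ` (N +>\<^bsub>M\<^esub> x) = {h x}" by blast
  then show ?thesis by simp
qed

end

section \<open>Spans and modules given by generators and relations\<close>

context base_ring begin

lemma span_superset: "S \<subseteq> submodule_span R M S"
  by (auto simp: submodule_span_def)

lemma span_minimal: "submodule N R M \<Longrightarrow> S \<subseteq> N \<Longrightarrow> submodule_span R M S \<subseteq> N"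
  by (auto simp: submodule_span_def)

lemma submodule_span:
  assumes "module R M" "S \<subseteq> carrier M"
  shows "submodule (submodule_span R M S) R M"
proof -
  interpret M: module R M by fact
  have 1: "submodule_span R M S \<subseteq> carrier M"
    using span_minimal[OF M.carrier_is_submodule assms(2)] .
  show ?thesis
  proof (rule M.submoduleI[OF 1])
    show "\<zero>\<^bsub>M\<^esub> \<in> submodule_span R M S"
      using subgroup.one_closed[OF submodule.axioms(1)] by (fastforce simp: submodule_span_def)
  qed (auto simp: submodule_span_def intro: M.submoduleE)
qed

end

locale presentation = base_ring R for R :: "'a ring" (structure) +
  fixes E :: "'x set" and S :: "('x \<Rightarrow> 'a) set"
  assumes rels: "S \<subseteq> carrier (free_module R E)"
begin

sublocale quot: quotient_mod R "free_module R E" "submodule_span R (free_module R E) S"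
  by (intro quotient_mod.intro module_free submodule_span rels)

definition proj :: "('x \<Rightarrow> 'a) \<Rightarrow> ('x \<Rightarrow> 'a) set" where
  "proj F = submodule_span R (free_module R E) S +>\<^bsub>free_module R E\<^esub> F"

lemma module_presented: "module R (presented R E S)"
  unfolding presented_def by (rule quot.module_quotient)

lemma proj_linear: "proj \<in> linear_maps R (free_module R E) (presented R E S)"
  using quot.coset_linear by (simp add: presented_def proj_def[abs_def])

lemma presented_carrier: "carrier (presented R E S) = proj ` carrier (free_module R E)"
  by (simp add: presented_def proj_def[abs_def] quot.quotient_carrier)

lemma proj_basis: "proj (basis_elem R x) = presented_gen R E S x"
  by (simp add: proj_def presented_gen_def)

lemma presented_gen_closed: "x \<in> E \<Longrightarrow> presented_gen R E S x \<in> carrier (presented R E S)"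
  using linear_mapsD(1)[OF proj_linear] basis_closed by (metis proj_basis)

lemma proj_rel_minus:
  assumes "F \<ominus>\<^bsub>free_module R E\<^esub> G \<in> S" "F \<in> carrier (free_module R E)" "G \<in> carrier (free_module R E)"
  shows "proj F = proj G"
  using assms span_superset[of S "free_module R E"]
  unfolding proj_def by (subst quot.coset_eq_iff) auto

context
  fixes N :: "('a, 'n) module" and \<phi> :: "'x \<Rightarrow> 'n"
  assumes N: "module R N" and \<phi>: "\<phi> \<in> E \<rightarrow> carrier N"
    and kill: "\<And>F. F \<in> S \<Longrightarrow> linear_extension R N \<phi> F = \<zero>\<^bsub>N\<^esub>"
begin

lemma presented_map_proj:
  assumes "F \<in> carrier (free_module R E)"
  shows "presented_map R N \<phi> (proj F) = linear_extension R N \<phi> F"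
proof -
  \<comment> \<open>The kernel of the extension is a submodule that contains the relations, so it
    contains their span.\<close>
  have "submodule_span R (free_module R E) S \<subseteq>
    {F \<in> carrier (free_module R E). linear_extension R N \<phi> F = \<zero>\<^bsub>N\<^esub>}"
    using kill rels by (intro span_minimal submodule_kernel module_free N linear_extension_linear \<phi>) auto
  then show ?thesis unfolding presented_map_def proj_def
    by (intro quot.the_elem_coset[OF N linear_extension_linear[OF N \<phi>] _ assms]) auto
qed

lemma presented_map_linear: "presented_map R N \<phi> \<in> linear_maps R (presented R E S) N"
proof -
  note P = linear_mapsD[OF proj_linear] and L = linear_mapsD[OF linear_extension_linear[OF N \<phi>]]
  show ?thesis
  proof (rule linear_mapsI)
    fix u v assume "u \<in> carrier (presented R E S)" "v \<in> carrier (presented R E S)"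
    then obtain F G where "u = proj F" "v = proj G" "F \<in> carrier (free_module R E)"
      "G \<in> carrier (free_module R E)" by (auto simp: presented_carrier)
    then show "presented_map R N \<phi> (u \<oplus>\<^bsub>presented R E S\<^esub> v) =
        presented_map R N \<phi> u \<oplus>\<^bsub>N\<^esub> presented_map R N \<phi> v"
      using quot.M.a_closed[of F G]
      by (simp add: P(2)[symmetric] presented_map_proj L(2)[symmetric] del: free_module_simps)
  next
    fix r u assume r: "r \<in> carrier R" "u \<in> carrier (presented R E S)"
    then obtain F where "u = proj F" "F \<in> carrier (free_module R E)"
      by (auto simp: presented_carrier)
    with r show "presented_map R N \<phi> (r \<odot>\<^bsub>presented R E S\<^esub> u) = r \<odot>\<^bsub>N\<^esub> presented_map R N \<phi> u"
      using quot.smult_closed[of r F]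
      by (simp add: P(3)[symmetric] presented_map_proj L(3)[symmetric] del: free_module_simps)
  qed (auto simp: presented_carrier presented_map_proj L(1))
qed

lemma presented_map_gen: "x \<in> E \<Longrightarrow> presented_map R N \<phi> (presented_gen R E S x) = \<phi> x"
  using presented_map_proj[OF basis_closed] linear_extension_basis[OF N \<phi>] by (simp add: proj_basis)

end

lemma presented_induct [consumes 1, case_names zero add]:
  assumes "u \<in> carrier (presented R E S)" "P \<zero>\<^bsub>presented R E S\<^esub>"
    and step: "\<And>r x v. r \<in> carrier R \<Longrightarrow> x \<in> E \<Longrightarrow> v \<in> carrier (presented R E S) \<Longrightarrow> P v \<Longrightarrow>
      P (r \<odot>\<^bsub>presented R E S\<^esub> presented_gen R E S x \<oplus>\<^bsub>presented R E S\<^esub> v)"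
  shows "P u"
proof -
  note P = linear_mapsD[OF proj_linear]
  obtain F where F: "u = proj F" "F \<in> carrier (free_module R E)"
    using assms(1) by (auto simp: presented_carrier)
  from F(2) have "P (proj F)"
  proof (induction rule: free_induct)
    case zero
    then show ?case
      using assms(2) linear_maps_zero[OF module_free module_presented proj_linear] by simp
  next
    case (add r x G)
    then have "proj (r \<odot>\<^bsub>free_module R E\<^esub> basis_elem R x \<oplus>\<^bsub>free_module R E\<^esub> G)
      = r \<odot>\<^bsub>presented R E S\<^esub> presented_gen R E S x \<oplus>\<^bsub>presented R E S\<^esub> proj G"
      using quot.smult_closed[OF add(1) basis_closed[OF add(2)]]
      by (simp add: P(2,3) basis_closed proj_basis del: free_module_simps)
    then show ?case using step[OF add(1,2) P(1)[OF add(3)] add(4)] by simp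
  qed
  with F(1) show ?thesis by simp
qed

lemma presented_ext:
  assumes "module R N" "h \<in> linear_maps R (presented R E S) N" "k \<in> linear_maps R (presented R E S) N"
    and "\<And>x. x \<in> E \<Longrightarrow> h (presented_gen R E S x) = k (presented_gen R E S x)"
    and "u \<in> carrier (presented R E S)"
  shows "h u = k u"
proof -
  interpret P: module R "presented R E S" by (rule module_presented)
  show ?thesis using assms(5)
  proof (induction rule: presented_induct)
    case zero
    then show ?case
      using linear_maps_zero[OF module_presented assms(1,2)]
        linear_maps_zero[OF module_presented assms(1,3)] by simp
  next
    case (add r x v)
    then show ?case
      by (simp add: linear_mapsD[OF assms(2)] linear_mapsD[OF assms(3)] presented_gen_closed assms(4))
  qed
qed

end

section \<open>Boolean rings and their points\<close>

locale bool_ring = base_ring +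
  assumes idem: "x \<in> carrier R \<Longrightarrow> x \<otimes> x = x"
begin

lemma add_self: 
  assumes "x \<in> carrier R" shows "x \<oplus> x = \<zero>"
proof -
  have "(x \<oplus> x) \<oplus> (x \<oplus> x) = (x \<oplus> x) \<otimes> (x \<oplus> x)"
    unfolding l_distr[OF assms assms a_closed[OF assms assms]] using assms by (simp add: r_distr idem)
  also have "\<dots> = (x \<oplus> x) \<oplus> \<zero>" using assms idem[of "x \<oplus> x"] by simp
  finally show ?thesis using assms add.l_cancel[of "x \<oplus> x" "x \<oplus> x" \<zero>] by simp
qed

lemma uminus_eq: "x \<in> carrier R \<Longrightarrow> \<ominus> x = x"
  by (rule minus_equality) (simp_all add: add_self)

lemma mult_absorb:
  assumes "x \<in> carrier R" "y \<in> carrier R" shows "x \<otimes> y \<otimes> x = x \<otimes> y"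
proof -
  have "x \<otimes> y \<otimes> x = x \<otimes> x \<otimes> y" using assms m_comm[of y x] by (simp add: m_assoc)
  then show ?thesis using assms by (simp add: idem)
qed

lemma module_add_self:
  assumes "module R M" "x \<in> carrier M" shows "x \<oplus>\<^bsub>M\<^esub> x = \<zero>\<^bsub>M\<^esub>"
proof -
  interpret M: module R M by fact
  have "x \<oplus>\<^bsub>M\<^esub> x = (\<one> \<oplus> \<one>) \<odot>\<^bsub>M\<^esub> x" using assms(2) by (simp add: M.smult_l_distr)
  then show ?thesis using assms(2) by (simp add: add_self)
qed

lemma module_uminus:
  assumes "module R M" "x \<in> carrier M" shows "\<ominus>\<^bsub>M\<^esub> x = x"
proof -
  interpret M: module R M by fact
  show ?thesis using assms(2) module_add_self[OF assms] by (intro M.M.minus_equality)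
qed

end

text \<open>These are the ring homomorphisms to the field with two elements, that is, the points of
  the Stone space of \<open>R\<close>.\<close>

definition is_point :: "'a ring \<Rightarrow> ('a \<Rightarrow> bit) \<Rightarrow> bool" where
  "is_point R w \<longleftrightarrow> w \<one>\<^bsub>R\<^esub> = 1 \<and>
     (\<forall>x \<in> carrier R. \<forall>y \<in> carrier R. w (x \<oplus>\<^bsub>R\<^esub> y) = w x + w y \<and> w (x \<otimes>\<^bsub>R\<^esub> y) = w x * w y)"

lemma pointD:
  assumes "is_point R w"
  shows "w \<one>\<^bsub>R\<^esub> = 1"
    and "x \<in> carrier R \<Longrightarrow> y \<in> carrier R \<Longrightarrow> w (x \<oplus>\<^bsub>R\<^esub> y) = w x + w y"
    and "x \<in> carrier R \<Longrightarrow> y \<in> carrier R \<Longrightarrow> w (x \<otimes>\<^bsub>R\<^esub> y) = w x * w y"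
  using assms by (auto simp: is_point_def)

context bool_ring begin

lemma point_zero:
  assumes "is_point R w" shows "w \<zero> = 0"
  using pointD(2)[OF assms, of \<zero> \<zero>, symmetric] by simp

text \<open>Ideals of a Boolean ring: closure under negation is automatic because negation is the
  identity.\<close>

definition bideal :: "'a set \<Rightarrow> bool" where
  "bideal J \<longleftrightarrow> J \<subseteq> carrier R \<and> \<zero> \<in> J \<and> (\<forall>x \<in> J. \<forall>y \<in> J. x \<oplus> y \<in> J) \<and>
     (\<forall>r \<in> carrier R. \<forall>x \<in> J. r \<otimes> x \<in> J)"

lemma bidealD:
  assumes "bideal J"
  shows "J \<subseteq> carrier R" "\<zero> \<in> J" "x \<in> J \<Longrightarrow> x \<in> carrier R"
    "x \<in> J \<Longrightarrow> y \<in> J \<Longrightarrow> x \<oplus> y \<in> J" "r \<in> carrier R \<Longrightarrow> x \<in> J \<Longrightarrow> r \<otimes> x \<in> J"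
  using assms by (auto simp: bideal_def)

lemma maximal_bideal:
  assumes "bideal J" "\<one> \<notin> J"
  obtains P where "bideal P" "J \<subseteq> P" "\<one> \<notin> P" "\<And>Z. bideal Z \<Longrightarrow> P \<subseteq> Z \<Longrightarrow> \<one> \<notin> Z \<Longrightarrow> Z = P"
proof -
  let ?C = "{P. bideal P \<and> J \<subseteq> P \<and> \<one> \<notin> P}"
  have "\<exists>P\<in>?C. \<forall>Z\<in>?C. P \<subseteq> Z \<longrightarrow> Z = P"
  proof (rule subset_Zorn_nonempty)
    show "?C \<noteq> {}" using assms by blast
  next
    fix C assume C: "C \<noteq> {}" "subset.chain ?C C"
    have bi: "P \<in> C \<Longrightarrow> bideal P" for P using C(2) by (auto simp: subset.chain_def)
    have "bideal (\<Union>C)" unfolding bideal_def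
    proof (intro conjI ballI)
      show "\<Union>C \<subseteq> carrier R" using bi bidealD(3) by blast
      show "\<zero> \<in> \<Union>C" using C(1) bi bidealD(2) by blast
    next
      fix x y assume "x \<in> \<Union>C" "y \<in> \<Union>C"
      then obtain P Q where PQ: "P \<in> C" "Q \<in> C" "x \<in> P" "y \<in> Q" by blast
      then have "P \<subseteq> Q \<or> Q \<subseteq> P" using subset.chain_total[OF C(2)] by blast
      then show "x \<oplus> y \<in> \<Union>C" using PQ bi bidealD(4) by blast
    next
      fix r x assume "r \<in> carrier R" "x \<in> \<Union>C"
      then show "r \<otimes> x \<in> \<Union>C" using bi bidealD(5) by blast
    qed
    moreover have "J \<subseteq> \<Union>C"
    proof -
      obtain P where "P \<in> C" using C(1) by blast
      moreover from this have "J \<subseteq> P" using C(2) by (auto simp: subset.chain_def)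
      ultimately show ?thesis by blast
    qed
    moreover have "\<one> \<notin> \<Union>C" using C by (auto simp: subset.chain_def)
    ultimately show "\<Union>C \<in> ?C" by blast
  qed
  then obtain P where P: "P \<in> ?C" and max: "\<forall>Z\<in>?C. P \<subseteq> Z \<longrightarrow> Z = P" by (rule bexE)
  show ?thesis
  proof (rule that[of P])
    fix Z assume "bideal Z" "P \<subseteq> Z" "\<one> \<notin> Z"
    then show "Z = P" using P max by blast
  qed (use P in auto)
qed

text \<open>The quotient by a maximal ideal has only the classes of 0 and 1, so it is a point. The
  lemma is the engine of all local arguments below: if an ideal did not contain 1, some point would
  vanish on it, and a single element of the ideal with value 1 there is a contradiction.\<close>

lemma point_exists:
  assumes "bideal J" "\<one> \<notin> J"
  shows "\<exists>w. is_point R w \<and> (\<forall>x \<in> J. w x = 0)"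
proof -
  obtain P where P: "bideal P" "J \<subseteq> P" "\<one> \<notin> P"
    and max: "\<And>Z. bideal Z \<Longrightarrow> P \<subseteq> Z \<Longrightarrow> \<one> \<notin> Z \<Longrightarrow> Z = P"
    using maximal_bideal[OF assms] by blast
  note D = bidealD[OF P(1)]
  \<comment> \<open>The elements that multiply \<open>\<one> \<oplus> a\<close> into
    \<open>P\<close> form an ideal containing \<open>P\<close> and also \<open>a\<close>. It is
    therefore larger than \<open>P\<close>, and maximality makes it the whole ring.\<close>
  have compl: "\<one> \<oplus> a \<in> P" if a: "a \<in> carrier R" "a \<notin> P" for a
  proof (rule ccontr)
    assume n: "\<one> \<oplus> a \<notin> P"
    let ?Z = "{x \<in> carrier R. x \<otimes> (\<one> \<oplus> a) \<in> P}"
    have "bideal ?Z" unfolding bideal_def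
      using a D by (auto simp: l_distr m_assoc)
    moreover have "P \<subseteq> ?Z" using a D(5)[of "\<one> \<oplus> a"] D(3) by (auto simp: m_comm)
    moreover have "\<one> \<notin> ?Z" using n a by simp
    ultimately have "?Z = P" by (rule max)
    moreover have "a \<in> ?Z" using a D(2) by (simp add: r_distr idem add_self)
    ultimately show False using a by blast
  qed
  have prime: "a \<in> P \<or> b \<in> P" if ab: "a \<in> carrier R" "b \<in> carrier R" "a \<otimes> b \<in> P" for a b
  proof (rule ccontr)
    assume "\<not> (a \<in> P \<or> b \<in> P)"
    then have 1: "\<one> \<oplus> a \<in> P" "\<one> \<oplus> b \<in> P" using compl ab by auto
    have "b \<otimes> (\<one> \<oplus> a) \<oplus> a \<otimes> b \<in> P" using 1 D ab by simp
    moreover have "b \<otimes> (\<one> \<oplus> a) \<oplus> a \<otimes> b = b"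
      using ab add_self[of "a \<otimes> b"] by (simp add: r_distr m_comm a_assoc)
    ultimately show False using \<open>\<not> (a \<in> P \<or> b \<in> P)\<close> by simp
  qed
  let ?w = "\<lambda>a. if a \<in> P then 0 else 1 :: bit"
  have add1: "a \<oplus> b \<in> P" if ab: "a \<in> carrier R" "b \<in> carrier R" "a \<notin> P" "b \<notin> P" for a b
  proof -
    have "(\<one> \<oplus> a) \<oplus> (\<one> \<oplus> b) \<in> P" using compl ab D by simp
    moreover have "(\<one> \<oplus> a) \<oplus> (\<one> \<oplus> b) = (\<one> \<oplus> \<one>) \<oplus> (a \<oplus> b)" using ab by (simp add: a_ac)
    ultimately show ?thesis using ab by (simp add: add_self)
  qed
  have add2: "a \<oplus> b \<notin> P" if ab: "a \<in> carrier R" "b \<in> carrier R" "a \<in> P" "b \<notin> P" for a b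
  proof
    assume "a \<oplus> b \<in> P"
    then have "a \<oplus> (a \<oplus> b) \<in> P" using ab D by blast
    moreover have "a \<oplus> (a \<oplus> b) = b" using ab by (simp add: a_assoc[symmetric] add_self)
    ultimately show False using ab by simp
  qed
  have wp: "is_point R ?w" unfolding is_point_def
  proof (intro conjI ballI)
    show "?w \<one> = 1" using P(3) by simp
  next
    fix x y assume xy: "x \<in> carrier R" "y \<in> carrier R"
    show "?w (x \<oplus> y) = ?w x + ?w y"
      using xy D(4)[of x y] add1[of x y] add2[of x y] add2[of y x] by (auto simp: a_comm)
    show "?w (x \<otimes> y) = ?w x * ?w y"
      using xy D(5)[of x y] D(5)[of y x] prime[of x y] by (auto simp: m_comm)
  qed
  show ?thesis by (rule exI[of _ ?w]) (use wp P(2) in auto)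
qed

text \<open>If \<open>x \<noteq> y\<close>, the annihilator of \<open>x \<oplus> y\<close> is proper
  and some point vanishes on it. It contains \<open>\<one> \<oplus> (x \<oplus> y)\<close>, so that
  point takes the value 1 on \<open>x \<oplus> y\<close> and separates \<open>x\<close> from
  \<open>y\<close>.\<close>

lemma eqI_points:
  assumes "x \<in> carrier R" "y \<in> carrier R" "\<And>w. is_point R w \<Longrightarrow> w x = w y"
  shows "x = y"
proof (rule ccontr)
  assume n: "x \<noteq> y"
  let ?J = "{z \<in> carrier R. z \<otimes> (x \<oplus> y) = \<zero>}"
  have "bideal ?J" unfolding bideal_def using assms(1,2) by (auto simp: l_distr m_assoc)
  moreover have "\<one> \<notin> ?J"
  proof
    assume "\<one> \<in> ?J"
    then have "x \<oplus> y = \<zero>" using assms by simp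
    then have "x = \<ominus> y" using assms(1,2) sum_zero_eq_neg by blast
    with n show False using uminus_eq assms by simp
  qed
  ultimately obtain w where w: "is_point R w" "\<forall>z \<in> ?J. w z = 0" using point_exists by blast
  have "(\<one> \<oplus> (x \<oplus> y)) \<in> ?J" using assms(1,2) idem[of "x \<oplus> y"] add_self[of "x \<oplus> y"] by (simp add: l_distr)
  then have "w (\<one> \<oplus> (x \<oplus> y)) = 0" using w(2) by blast
  then show False using assms(1,2) assms(3)[OF w(1)] by (simp add: pointD[OF w(1)])
qed

end

section \<open>Tensor products\<close>

definition bilinear ::
  "'a ring \<Rightarrow> ('a, 'm) module \<Rightarrow> ('a, 'n) module \<Rightarrow> ('a, 'q) module \<Rightarrow> ('m \<Rightarrow> 'n \<Rightarrow> 'q) \<Rightarrow> bool" where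
  "bilinear A M N Q \<phi> \<longleftrightarrow>
     (\<forall>x \<in> carrier M. \<phi> x \<in> linear_maps A N Q) \<and>
     (\<forall>y \<in> carrier N. (\<lambda>x. \<phi> x y) \<in> linear_maps A M Q)"

lemma bilinearI:
  assumes "\<And>x y. x \<in> carrier M \<Longrightarrow> y \<in> carrier N \<Longrightarrow> \<phi> x y \<in> carrier Q"
    "\<And>x x' y. x \<in> carrier M \<Longrightarrow> x' \<in> carrier M \<Longrightarrow> y \<in> carrier N \<Longrightarrow> \<phi> (x \<oplus>\<^bsub>M\<^esub> x') y = \<phi> x y \<oplus>\<^bsub>Q\<^esub> \<phi> x' y"
    "\<And>x y y'. x \<in> carrier M \<Longrightarrow> y \<in> carrier N \<Longrightarrow> y' \<in> carrier N \<Longrightarrow> \<phi> x (y \<oplus>\<^bsub>N\<^esub> y') = \<phi> x y \<oplus>\<^bsub>Q\<^esub> \<phi> x y'"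
    "\<And>r x y. r \<in> carrier A \<Longrightarrow> x \<in> carrier M \<Longrightarrow> y \<in> carrier N \<Longrightarrow> \<phi> (r \<odot>\<^bsub>M\<^esub> x) y = r \<odot>\<^bsub>Q\<^esub> \<phi> x y"
    "\<And>r x y. r \<in> carrier A \<Longrightarrow> x \<in> carrier M \<Longrightarrow> y \<in> carrier N \<Longrightarrow> \<phi> x (r \<odot>\<^bsub>N\<^esub> y) = r \<odot>\<^bsub>Q\<^esub> \<phi> x y"
  shows "bilinear A M N Q \<phi>"
  unfolding bilinear_def by (intro conjI ballI linear_mapsI; simp add: assms)

lemma bilinearD:
  assumes "bilinear A M N Q \<phi>"
  shows "x \<in> carrier M \<Longrightarrow> y \<in> carrier N \<Longrightarrow> \<phi> x y \<in> carrier Q"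
    "x \<in> carrier M \<Longrightarrow> x' \<in> carrier M \<Longrightarrow> y \<in> carrier N \<Longrightarrow> \<phi> (x \<oplus>\<^bsub>M\<^esub> x') y = \<phi> x y \<oplus>\<^bsub>Q\<^esub> \<phi> x' y"
    "x \<in> carrier M \<Longrightarrow> y \<in> carrier N \<Longrightarrow> y' \<in> carrier N \<Longrightarrow> \<phi> x (y \<oplus>\<^bsub>N\<^esub> y') = \<phi> x y \<oplus>\<^bsub>Q\<^esub> \<phi> x y'"
    "r \<in> carrier A \<Longrightarrow> x \<in> carrier M \<Longrightarrow> y \<in> carrier N \<Longrightarrow> \<phi> (r \<odot>\<^bsub>M\<^esub> x) y = r \<odot>\<^bsub>Q\<^esub> \<phi> x y"
    "r \<in> carrier A \<Longrightarrow> x \<in> carrier M \<Longrightarrow> y \<in> carrier N \<Longrightarrow> \<phi> x (r \<odot>\<^bsub>N\<^esub> y) = r \<odot>\<^bsub>Q\<^esub> \<phi> x y"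
proof -
  have L: "x \<in> carrier M \<Longrightarrow> \<phi> x \<in> linear_maps A N Q"
    and R: "y \<in> carrier N \<Longrightarrow> (\<lambda>x. \<phi> x y) \<in> linear_maps A M Q" for x y
    using assms by (auto simp: bilinear_def)
  show "x \<in> carrier M \<Longrightarrow> y \<in> carrier N \<Longrightarrow> \<phi> x y \<in> carrier Q"
    using linear_mapsD(1)[OF L] .
  show "x \<in> carrier M \<Longrightarrow> x' \<in> carrier M \<Longrightarrow> y \<in> carrier N \<Longrightarrow> \<phi> (x \<oplus>\<^bsub>M\<^esub> x') y = \<phi> x y \<oplus>\<^bsub>Q\<^esub> \<phi> x' y"
    using linear_mapsD(2)[OF R] .
  show "x \<in> carrier M \<Longrightarrow> y \<in> carrier N \<Longrightarrow> y' \<in> carrier N \<Longrightarrow> \<phi> x (y \<oplus>\<^bsub>N\<^esub> y') = \<phi> x y \<oplus>\<^bsub>Q\<^esub> \<phi> x y'"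
    using linear_mapsD(2)[OF L] .
  show "r \<in> carrier A \<Longrightarrow> x \<in> carrier M \<Longrightarrow> y \<in> carrier N \<Longrightarrow> \<phi> (r \<odot>\<^bsub>M\<^esub> x) y = r \<odot>\<^bsub>Q\<^esub> \<phi> x y"
    using linear_mapsD(3)[OF R] .
  show "r \<in> carrier A \<Longrightarrow> x \<in> carrier M \<Longrightarrow> y \<in> carrier N \<Longrightarrow> \<phi> x (r \<odot>\<^bsub>N\<^esub> y) = r \<odot>\<^bsub>Q\<^esub> \<phi> x y"
    using linear_mapsD(3)[OF L] .
qed

lemma linear_maps_minus:
  assumes "module A M" "module A N" "h \<in> linear_maps A M N" "x \<in> carrier M" "y \<in> carrier M"
  shows "h (x \<ominus>\<^bsub>M\<^esub> y) = h x \<ominus>\<^bsub>N\<^esub> h y"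
proof -
  interpret M: module A M by fact
  interpret N: module A N by fact
  show ?thesis using assms(4,5)
    by (simp add: M.M.minus_eq N.M.minus_eq linear_mapsD[OF assms(3)] linear_maps_uminus[OF assms(1-3)])
qed

context base_ring begin

context
  fixes M :: "('a, 'm) module" and N :: "('a, 'n) module"
  assumes M: "module R M" and N: "module R N"
begin

interpretation M: module R M by (rule M)
interpretation N: module R N by (rule N)

abbreviation "F_tensor \<equiv> free_module R (carrier M \<times> carrier N)"
interpretation F: module R F_tensor by (rule module_free)

lemma presentation_tensor: "presentation R (carrier M \<times> carrier N) (tensor_rels R M N)"
proof
  show "tensor_rels R M N \<subseteq> carrier F_tensor"
    unfolding tensor_rels_def Let_def
    by (auto intro!: F.M.minus_closed F.M.a_closed F.smult_closed basis_closed
        simp del: free_module_simps)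
qed

interpretation T: presentation R "carrier M \<times> carrier N" "tensor_rels R M N"
  by (rule presentation_tensor)

lemma module_tensor: "module R (tensor R M N)"
  unfolding tensor_def by (rule T.module_presented)

lemma tensor_elem_closed:
  "x \<in> carrier M \<Longrightarrow> y \<in> carrier N \<Longrightarrow> tensor_elem R M N x y \<in> carrier (tensor R M N)"
  unfolding tensor_def tensor_elem_def by (rule T.presented_gen_closed) simp

lemma tensor_elem_bilinear: "bilinear R M N (tensor R M N) (tensor_elem R M N)"
proof -
  note P = linear_mapsD[OF T.proj_linear]
  have e: "tensor_elem R M N x y = T.proj (basis_elem R (x, y))" for x y
    by (simp add: tensor_elem_def T.proj_basis)
  have c: "basis_elem R (x, y) \<in> carrier F_tensor" if "x \<in> carrier M" "y \<in> carrier N" for x y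
    using that by (intro basis_closed) simp
  show ?thesis
  proof (rule bilinearI)
    fix x x' y assume a: "x \<in> carrier M" "x' \<in> carrier M" "y \<in> carrier N"
    have "T.proj (basis_elem R (x \<oplus>\<^bsub>M\<^esub> x', y)) = T.proj (basis_elem R (x, y) \<oplus>\<^bsub>F_tensor\<^esub> basis_elem R (x', y))"
      using a by (intro T.proj_rel_minus c F.M.a_closed M.M.a_closed)
        (auto simp: tensor_rels_def Let_def simp del: free_module_simps)
    then show "tensor_elem R M N (x \<oplus>\<^bsub>M\<^esub> x') y
      = tensor_elem R M N x y \<oplus>\<^bsub>tensor R M N\<^esub> tensor_elem R M N x' y"
      using a by (simp add: e P c tensor_def del: free_module_simps)
  next
    fix x y y' assume a: "x \<in> carrier M" "y \<in> carrier N" "y' \<in> carrier N"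
    have "T.proj (basis_elem R (x, y \<oplus>\<^bsub>N\<^esub> y')) = T.proj (basis_elem R (x, y) \<oplus>\<^bsub>F_tensor\<^esub> basis_elem R (x, y'))"
      using a by (intro T.proj_rel_minus c F.M.a_closed N.M.a_closed)
        (auto simp: tensor_rels_def Let_def simp del: free_module_simps)
    then show "tensor_elem R M N x (y \<oplus>\<^bsub>N\<^esub> y')
      = tensor_elem R M N x y \<oplus>\<^bsub>tensor R M N\<^esub> tensor_elem R M N x y'"
      using a by (simp add: e P c tensor_def del: free_module_simps)
  next
    fix r x y assume a: "r \<in> carrier R" "x \<in> carrier M" "y \<in> carrier N"
    have "T.proj (basis_elem R (r \<odot>\<^bsub>M\<^esub> x, y)) = T.proj (r \<odot>\<^bsub>F_tensor\<^esub> basis_elem R (x, y))"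
      using a by (intro T.proj_rel_minus c F.smult_closed M.smult_closed)
        (auto simp: tensor_rels_def Let_def simp del: free_module_simps)
    then show "tensor_elem R M N (r \<odot>\<^bsub>M\<^esub> x) y = r \<odot>\<^bsub>tensor R M N\<^esub> tensor_elem R M N x y"
      using a by (simp add: e P c tensor_def del: free_module_simps)
    have "T.proj (basis_elem R (x, r \<odot>\<^bsub>N\<^esub> y)) = T.proj (r \<odot>\<^bsub>F_tensor\<^esub> basis_elem R (x, y))"
      using a by (intro T.proj_rel_minus c F.smult_closed N.smult_closed)
        (auto simp: tensor_rels_def Let_def simp del: free_module_simps)
    then show "tensor_elem R M N x (r \<odot>\<^bsub>N\<^esub> y) = r \<odot>\<^bsub>tensor R M N\<^esub> tensor_elem R M N x y"
      using a by (simp add: e P c tensor_def del: free_module_simps)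
  qed (rule tensor_elem_closed)
qed

text \<open>A coefficient can be moved into the left factor, so sums of pure tensors without
  coefficients exhaust the module.\<close>

lemma tensor_induct [consumes 1, case_names zero add]:
  assumes "u \<in> carrier (tensor R M N)" "P \<zero>\<^bsub>tensor R M N\<^esub>"
    and step: "\<And>x y v. x \<in> carrier M \<Longrightarrow> y \<in> carrier N \<Longrightarrow> v \<in> carrier (tensor R M N) \<Longrightarrow> P v \<Longrightarrow>
      P (tensor_elem R M N x y \<oplus>\<^bsub>tensor R M N\<^esub> v)"
  shows "P u"
  using assms(1) unfolding tensor_def
proof (induction rule: T.presented_induct)
  case zero
  then show ?case using assms(2) by (simp add: tensor_def)
next
  case (add r z v)
  obtain x y where z: "z = (x, y)" "x \<in> carrier M" "y \<in> carrier N" using add(2) by auto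
  have "P (tensor_elem R M N (r \<odot>\<^bsub>M\<^esub> x) y \<oplus>\<^bsub>tensor R M N\<^esub> v)"
    using z add by (intro step) (auto simp: tensor_def)
  then show ?case
    using z add(1) bilinearD(4)[OF tensor_elem_bilinear] by (simp add: tensor_elem_def tensor_def)
qed

lemma tensor_ext:
  assumes "module R Q" "h \<in> linear_maps R (tensor R M N) Q" "k \<in> linear_maps R (tensor R M N) Q"
    and "\<And>x y. x \<in> carrier M \<Longrightarrow> y \<in> carrier N \<Longrightarrow> h (tensor_elem R M N x y) = k (tensor_elem R M N x y)"
    and "u \<in> carrier (tensor R M N)"
  shows "h u = k u"
  by (rule T.presented_ext[OF assms(1), folded tensor_def, OF assms(2,3) _ assms(5)])
    (use assms(4) in \<open>auto simp: tensor_elem_def\<close>)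

context
  fixes Q :: "('a, 'q) module" and \<phi>
  assumes Q: "module R Q" and \<phi>: "bilinear R M N Q \<phi>"
begin

interpretation Q: module R Q by (rule Q)

lemma tensor_lift_kill:
  assumes "G \<in> tensor_rels R M N"
  shows "linear_extension R Q (\<lambda>(x, y). \<phi> x y) G = \<zero>\<^bsub>Q\<^esub>"
proof -
  note D = bilinearD[OF \<phi>]
  have \<phi>': "(\<lambda>(x, y). \<phi> x y) \<in> carrier M \<times> carrier N \<rightarrow> carrier Q" using D(1) by auto
  let ?L = "linear_extension R Q (\<lambda>(x, y). \<phi> x y)"
  note L = linear_extension_linear[OF Q \<phi>']
  have b: "?L (basis_elem R (x, y)) = \<phi> x y" if "x \<in> carrier M" "y \<in> carrier N" for x y
    using linear_extension_basis[OF Q \<phi>', of "(x, y)"] that by simp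
  have c: "basis_elem R (x, y) \<in> carrier F_tensor" if "x \<in> carrier M" "y \<in> carrier N" for x y
    using that by (intro basis_closed) simp
  show ?thesis
    using assms unfolding tensor_rels_def Let_def
    by (elim UnE CollectE exE conjE; simp add: linear_maps_minus[OF module_free Q L] linear_mapsD[OF L] b c D
        Q.M.minus_eq Q.M.r_neg del: free_module_simps)
qed

lemma tensor_lift_linear: "presented_map R Q (\<lambda>(x, y). \<phi> x y) \<in> linear_maps R (tensor R M N) Q"
  unfolding tensor_def using bilinearD(1)[OF \<phi>]
  by (intro T.presented_map_linear[OF Q] tensor_lift_kill) auto

lemma tensor_lift_elem:
  assumes "x \<in> carrier M" "y \<in> carrier N"
  shows "presented_map R Q (\<lambda>(x, y). \<phi> x y) (tensor_elem R M N x y) = \<phi> x y"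
  unfolding tensor_elem_def using bilinearD(1)[OF \<phi>] assms
  by (subst T.presented_map_gen[OF Q _ tensor_lift_kill]) auto

end

end

end

section \<open>Extensions of Boolean rings are faithfully flat\<close>

lemma restrict_scalars_simps [simp]:
  "carrier (restrict_scalars f B) = carrier B"
  "\<zero>\<^bsub>restrict_scalars f B\<^esub> = \<zero>\<^bsub>B\<^esub>"
  "x \<oplus>\<^bsub>restrict_scalars f B\<^esub> y = x \<oplus>\<^bsub>B\<^esub> y"
  "r \<odot>\<^bsub>restrict_scalars f B\<^esub> x = f r \<otimes>\<^bsub>B\<^esub> x"
  by (simp_all add: restrict_scalars_def)

lemma module_restrict_scalars:
  assumes "cring A" "cring B" "f \<in> ring_hom A B"
  shows "module A (restrict_scalars f B)"
proof -
  interpret A: cring A by fact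
  interpret B: cring B by fact
  note h = ring_hom_closed[OF assms(3)] ring_hom_add[OF assms(3)] ring_hom_mult[OF assms(3)]
    ring_hom_one[OF assms(3)]
  show ?thesis
  proof (rule moduleI)
    show "abelian_group (restrict_scalars f B)"
    proof (rule abelian_groupI)
      fix x assume "x \<in> carrier (restrict_scalars f B)"
      then show "\<exists>y\<in>carrier (restrict_scalars f B). y \<oplus>\<^bsub>restrict_scalars f B\<^esub> x = \<zero>\<^bsub>restrict_scalars f B\<^esub>"
        by (intro bexI[of _ "\<ominus>\<^bsub>B\<^esub> x"]) (simp_all add: B.l_neg)
    qed (simp_all add: B.a_ac)
  qed (simp_all add: h B.l_distr B.r_distr B.m_assoc A.is_cring)
qed

locale bool_ext = A: bool_ring A + B: bool_ring B for A :: "'a ring" and B :: "'b ring" +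
  fixes f :: "'a \<Rightarrow> 'b"
  assumes hom: "f \<in> ring_hom A B" and inj: "inj_on f (carrier A)"
begin

lemmas f_closed = ring_hom_closed[OF hom]
lemmas f_add = ring_hom_add[OF hom]
lemmas f_mult = ring_hom_mult[OF hom]
lemmas f_one = ring_hom_one[OF hom]

lemma f_zero: "f \<zero>\<^bsub>A\<^esub> = \<zero>\<^bsub>B\<^esub>"
  by (rule ring_hom_zero[OF hom A.ring_axioms B.ring_axioms])

lemma f_eq: "x \<in> carrier A \<Longrightarrow> y \<in> carrier A \<Longrightarrow> f x = f y \<longleftrightarrow> x = y"
  using inj by (auto simp: inj_on_def)

abbreviation "BA \<equiv> restrict_scalars f B"

lemma module_BA: "module A BA"
  by (rule module_restrict_scalars[OF A.is_cring B.is_cring hom])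

text \<open>In the order of a Boolean ring \<open>b \<otimes> f e = b\<close> means that
  \<open>b\<close> lies below \<open>f e\<close>, and
  \<open>e1 \<oplus> e2 \<oplus> e1 \<otimes> e2\<close> is the join of \<open>e1\<close> and
  \<open>e2\<close>. Sets of elements that lie below some suitable \<open>f e\<close> are closed
  under addition for this reason.\<close>

lemma join_bound:
  assumes "e1 \<in> carrier A" "e2 \<in> carrier A" "b1 \<in> carrier B" "b2 \<in> carrier B"
    "b1 \<otimes>\<^bsub>B\<^esub> f e1 = b1" "b2 \<otimes>\<^bsub>B\<^esub> f e2 = b2"
  shows "(b1 \<oplus>\<^bsub>B\<^esub> b2) \<otimes>\<^bsub>B\<^esub> f (e1 \<oplus>\<^bsub>A\<^esub> e2 \<oplus>\<^bsub>A\<^esub> e1 \<otimes>\<^bsub>A\<^esub> e2) = b1 \<oplus>\<^bsub>B\<^esub> b2"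
proof (rule B.eqI_points)
  fix w assume w: "is_point B w"
  have "w b1 * w (f e1) = w b1" "w b2 * w (f e2) = w b2"
    using assms(5,6)[THEN arg_cong[where f = w]] assms(1-4) by (simp_all add: pointD[OF w] f_closed)
  then show "w ((b1 \<oplus>\<^bsub>B\<^esub> b2) \<otimes>\<^bsub>B\<^esub> f (e1 \<oplus>\<^bsub>A\<^esub> e2 \<oplus>\<^bsub>A\<^esub> e1 \<otimes>\<^bsub>A\<^esub> e2)) = w (b1 \<oplus>\<^bsub>B\<^esub> b2)"
    using assms(1-4) by (cases "w b1"; cases "w b2"; simp add: pointD[OF w] f_closed f_add f_mult)
qed (use assms in \<open>simp_all add: f_closed\<close>)

text \<open>The kernel of the localisation of \<open>N\<close> at the prime of \<open>A\<close> below the point \<open>w\<close>.\<close>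

definition local_kernel :: "('a, 'n) module \<Rightarrow> ('b \<Rightarrow> bit) \<Rightarrow> 'n set" where
  "local_kernel N w = {x \<in> carrier N. \<exists>e \<in> carrier A. w (f e) = 1 \<and> e \<odot>\<^bsub>N\<^esub> x = \<zero>\<^bsub>N\<^esub>}"

context
  fixes N :: "('a, 'n) module"
  assumes N: "module A N"
begin

interpretation N: module A N by (rule N)

lemma submodule_local_kernel:
  assumes w: "is_point B w"
  shows "submodule (local_kernel N w) A N"
proof (rule N.submoduleI)
  show "local_kernel N w \<subseteq> carrier N" by (auto simp: local_kernel_def)
  show "\<zero>\<^bsub>N\<^esub> \<in> local_kernel N w"
    using pointD(1)[OF w] by (auto simp: local_kernel_def f_one intro!: bexI[of _ "\<one>\<^bsub>A\<^esub>"])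
next
  fix x assume "x \<in> local_kernel N w"
  then show "\<ominus>\<^bsub>N\<^esub> x \<in> local_kernel N w"
    by (simp add: local_kernel_def A.module_uminus[OF N])
next
  fix x y assume "x \<in> local_kernel N w" "y \<in> local_kernel N w"
  then obtain d e where de: "d \<in> carrier A" "e \<in> carrier A" "w (f d) = 1" "w (f e) = 1"
    "d \<odot>\<^bsub>N\<^esub> x = \<zero>\<^bsub>N\<^esub>" "e \<odot>\<^bsub>N\<^esub> y = \<zero>\<^bsub>N\<^esub>" and xy: "x \<in> carrier N" "y \<in> carrier N"
    by (auto simp: local_kernel_def)
  have "(d \<otimes>\<^bsub>A\<^esub> e) \<odot>\<^bsub>N\<^esub> x = \<zero>\<^bsub>N\<^esub>"
    using de xy by (subst A.m_comm) (simp_all add: N.smult_assoc1)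
  moreover have "(d \<otimes>\<^bsub>A\<^esub> e) \<odot>\<^bsub>N\<^esub> y = \<zero>\<^bsub>N\<^esub>"
    using de xy by (simp add: N.smult_assoc1)
  ultimately show "x \<oplus>\<^bsub>N\<^esub> y \<in> local_kernel N w"
    using de xy
    by (auto simp: local_kernel_def N.smult_r_distr pointD[OF w] f_closed f_mult intro!: bexI[of _ "d \<otimes>\<^bsub>A\<^esub> e"])
next
  fix r x assume r: "r \<in> carrier A" and "x \<in> local_kernel N w"
  then obtain d where d: "d \<in> carrier A" "w (f d) = 1" "d \<odot>\<^bsub>N\<^esub> x = \<zero>\<^bsub>N\<^esub>" "x \<in> carrier N"
    by (auto simp: local_kernel_def)
  have "d \<odot>\<^bsub>N\<^esub> (r \<odot>\<^bsub>N\<^esub> x) = r \<odot>\<^bsub>N\<^esub> (d \<odot>\<^bsub>N\<^esub> x)"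
    using r d by (metis A.m_comm N.smult_assoc1)
  then show "r \<odot>\<^bsub>N\<^esub> x \<in> local_kernel N w"
    using r d by (auto simp: local_kernel_def intro!: bexI[of _ d])
qed

text \<open>The local ring of \<open>A\<close> at a prime is the field with two elements, so
  \<open>r\<close> acts on the localised module as the scalar \<open>w (f r)\<close>. The map
  \<open>b \<otimes> x \<mapsto> w(b) x\<close> into the localisation is then well defined.\<close>

lemma local_bilinear:
  assumes w: "is_point B w"
  defines "K \<equiv> local_kernel N w"
  shows "bilinear A BA N (quotient_module N K)
    (\<lambda>b x. if w b = 1 then K +>\<^bsub>N\<^esub> x else \<zero>\<^bsub>quotient_module N K\<^esub>)" (is "bilinear A BA N ?Q ?\<phi>")
proof -
  interpret K: quotient_mod A N K
    unfolding K_def by (intro quotient_mod.intro N submodule_local_kernel w)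
  have Q: "module A ?Q" by (rule K.module_quotient)
  interpret Q: module A ?Q by (rule Q)
  note P = linear_mapsD[OF K.coset_linear]
  have smult: "r \<odot>\<^bsub>?Q\<^esub> (K +>\<^bsub>N\<^esub> x) = (if w (f r) = 1 then K +>\<^bsub>N\<^esub> x else \<zero>\<^bsub>?Q\<^esub>)"
    if r: "r \<in> carrier A" and x: "x \<in> carrier N" for r x
  proof (cases "w (f r) = 1")
    case True
    \<comment> \<open>Idempotence gives \<open>r (r x - x) = 0\<close>; as
      \<open>w (f r) = 1\<close>, the difference of \<open>r x\<close> and \<open>x\<close> dies in
      the localisation.\<close>
    have "r \<odot>\<^bsub>N\<^esub> (r \<odot>\<^bsub>N\<^esub> x \<ominus>\<^bsub>N\<^esub> x) = \<zero>\<^bsub>N\<^esub>"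
      using r x N.smult_assoc1[of r r x]
      by (simp add: N.M.minus_eq N.smult_r_distr A.idem N.smult_r_minus N.M.r_neg)
    then have "r \<odot>\<^bsub>N\<^esub> x \<ominus>\<^bsub>N\<^esub> x \<in> K"
      using r x True by (auto simp: K_def local_kernel_def)
    then have "K +>\<^bsub>N\<^esub> (r \<odot>\<^bsub>N\<^esub> x) = K +>\<^bsub>N\<^esub> x"
      using r x by (subst K.coset_eq_iff) auto
    then show ?thesis using True r x by (simp add: P(3)[symmetric])
  next
    case False
    have "(\<one>\<^bsub>A\<^esub> \<oplus>\<^bsub>A\<^esub> r) \<odot>\<^bsub>N\<^esub> (r \<odot>\<^bsub>N\<^esub> x) = ((\<one>\<^bsub>A\<^esub> \<oplus>\<^bsub>A\<^esub> r) \<otimes>\<^bsub>A\<^esub> r) \<odot>\<^bsub>N\<^esub> x"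
      using r x by (simp add: N.smult_assoc1)
    also have "\<dots> = \<zero>\<^bsub>N\<^esub>" using r x by (simp add: A.l_distr A.idem A.add_self)
    finally have "r \<odot>\<^bsub>N\<^esub> x \<in> K"
      using r x False by (auto simp: K_def local_kernel_def pointD[OF w] f_add f_one f_closed
          intro!: bexI[of _ "\<one>\<^bsub>A\<^esub> \<oplus>\<^bsub>A\<^esub> r"])
    then have "K +>\<^bsub>N\<^esub> (r \<odot>\<^bsub>N\<^esub> x) = \<zero>\<^bsub>?Q\<^esub>"
      using r x by (subst K.coset_eq_zero_iff) auto
    then show ?thesis using False r x by (simp add: P(3)[symmetric])
  qed
  have self: "(K +>\<^bsub>N\<^esub> x) \<oplus>\<^bsub>?Q\<^esub> (K +>\<^bsub>N\<^esub> x) = \<zero>\<^bsub>?Q\<^esub>" if "x \<in> carrier N" for x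
    using A.module_add_self[OF Q P(1)[OF that]] .
  show ?thesis
  proof (rule bilinearI)
    fix b b' x assume "b \<in> carrier BA" "b' \<in> carrier BA" "x \<in> carrier N"
    then show "?\<phi> (b \<oplus>\<^bsub>BA\<^esub> b') x = ?\<phi> b x \<oplus>\<^bsub>?Q\<^esub> ?\<phi> b' x"
      by (cases "w b"; cases "w b'") (simp_all add: pointD[OF w] self P(1))
  qed (simp_all add: P pointD[OF w] smult f_closed)
qed

text \<open>Over a Boolean ring a pure tensor vanishes only for an evident reason: \<open>g\<close>
  lies below the image of an \<open>e\<close> that annihilates \<open>n\<close>. Both halves of
  faithful flatness rest on this.\<close>

lemma tensor_elem_eq_zero:
  assumes g: "g \<in> carrier B" and n: "n \<in> carrier N"
    and eq: "tensor_elem A BA N g n = \<zero>\<^bsub>tensor A BA N\<^esub>"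
  shows "\<exists>e \<in> carrier A. g \<otimes>\<^bsub>B\<^esub> f e = g \<and> e \<odot>\<^bsub>N\<^esub> n = \<zero>\<^bsub>N\<^esub>"
proof (rule ccontr)
  assume neg: "\<not> ?thesis"
  \<comment> \<open>The ideal of all \<open>b\<close> for which \<open>b \<otimes> g\<close> has a
    witness. The goal is that it contains 1.\<close>
  let ?J = "{b \<in> carrier B. \<exists>e \<in> carrier A. e \<odot>\<^bsub>N\<^esub> n = \<zero>\<^bsub>N\<^esub> \<and> (b \<otimes>\<^bsub>B\<^esub> g) \<otimes>\<^bsub>B\<^esub> f e = b \<otimes>\<^bsub>B\<^esub> g}"
  have "B.bideal ?J" unfolding B.bideal_def
  proof (intro conjI ballI)
    show "\<zero>\<^bsub>B\<^esub> \<in> ?J" using g n by (auto intro!: bexI[of _ "\<zero>\<^bsub>A\<^esub>"] simp: f_zero)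
  next
    fix b1 b2 assume "b1 \<in> ?J" "b2 \<in> ?J"
    then obtain e1 e2 where e: "e1 \<in> carrier A" "e2 \<in> carrier A" "e1 \<odot>\<^bsub>N\<^esub> n = \<zero>\<^bsub>N\<^esub>" "e2 \<odot>\<^bsub>N\<^esub> n = \<zero>\<^bsub>N\<^esub>"
      "(b1 \<otimes>\<^bsub>B\<^esub> g) \<otimes>\<^bsub>B\<^esub> f e1 = b1 \<otimes>\<^bsub>B\<^esub> g" "(b2 \<otimes>\<^bsub>B\<^esub> g) \<otimes>\<^bsub>B\<^esub> f e2 = b2 \<otimes>\<^bsub>B\<^esub> g"
      and b: "b1 \<in> carrier B" "b2 \<in> carrier B" by auto
    have "(e1 \<oplus>\<^bsub>A\<^esub> e2 \<oplus>\<^bsub>A\<^esub> e1 \<otimes>\<^bsub>A\<^esub> e2) \<odot>\<^bsub>N\<^esub> n = \<zero>\<^bsub>N\<^esub>"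
      using e n by (simp add: N.smult_l_distr N.smult_assoc1)
    then show "b1 \<oplus>\<^bsub>B\<^esub> b2 \<in> ?J"
      using e b g join_bound[OF e(1,2) _ _ e(5,6)]
      by (auto simp: B.l_distr intro!: bexI[of _ "e1 \<oplus>\<^bsub>A\<^esub> e2 \<oplus>\<^bsub>A\<^esub> e1 \<otimes>\<^bsub>A\<^esub> e2"])
  next
    fix r b assume r: "r \<in> carrier B" and "b \<in> ?J"
    then obtain e where e: "e \<in> carrier A" "e \<odot>\<^bsub>N\<^esub> n = \<zero>\<^bsub>N\<^esub>"
      "(b \<otimes>\<^bsub>B\<^esub> g) \<otimes>\<^bsub>B\<^esub> f e = b \<otimes>\<^bsub>B\<^esub> g" "b \<in> carrier B" by auto
    then have "((r \<otimes>\<^bsub>B\<^esub> b) \<otimes>\<^bsub>B\<^esub> g) \<otimes>\<^bsub>B\<^esub> f e = (r \<otimes>\<^bsub>B\<^esub> b) \<otimes>\<^bsub>B\<^esub> g"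
      using r g by (simp add: B.m_assoc f_closed)
    then show "r \<otimes>\<^bsub>B\<^esub> b \<in> ?J" using e r by auto
  qed auto
  moreover have "\<one>\<^bsub>B\<^esub> \<notin> ?J" using neg g by auto
  ultimately obtain w where w: "is_point B w" "\<forall>b \<in> ?J. w b = 0"
    using B.point_exists by blast
  \<comment> \<open>The product of this element with \<open>g\<close> is 0, for which the witness 0
    will do. It follows that the point \<open>w\<close> lies where \<open>g\<close> is 1.\<close>
  have "\<one>\<^bsub>B\<^esub> \<oplus>\<^bsub>B\<^esub> g \<in> ?J"
    using g n by (auto intro!: bexI[of _ "\<zero>\<^bsub>A\<^esub>"] simp: f_zero B.l_distr B.idem B.add_self)
  then have "w (\<one>\<^bsub>B\<^esub> \<oplus>\<^bsub>B\<^esub> g) = 0" using w(2) by blast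
  then have wg: "w g = 1" using g by (cases "w g") (simp_all add: pointD[OF w(1)])
  define K where "K = local_kernel N w"
  interpret K: quotient_mod A N K
    unfolding K_def by (intro quotient_mod.intro N submodule_local_kernel w)
  let ?\<phi> = "\<lambda>b x. if w b = 1 then K +>\<^bsub>N\<^esub> x else \<zero>\<^bsub>quotient_module N K\<^esub>"
  have bil: "bilinear A BA N (quotient_module N K) ?\<phi>"
    unfolding K_def by (rule local_bilinear[OF w(1)])
  note lift = A.tensor_lift_elem[OF module_BA N K.module_quotient bil]
    A.tensor_lift_linear[OF module_BA N K.module_quotient bil]
  have "?\<phi> g n = \<zero>\<^bsub>quotient_module N K\<^esub>"
    using lift(1)[of g n] g n eq
      linear_maps_zero[OF A.module_tensor[OF module_BA N] K.module_quotient lift(2)] by simp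
  then have "n \<in> K" using wg n by (simp add: K.coset_eq_zero_iff)
  then obtain e where e: "e \<in> carrier A" "w (f e) = 1" "e \<odot>\<^bsub>N\<^esub> n = \<zero>\<^bsub>N\<^esub>"
    by (auto simp: K_def local_kernel_def)
  \<comment> \<open>\<open>f e \<otimes> g\<close> lies below \<open>f e\<close>, so
    \<open>e\<close> is a witness that \<open>f e\<close> is in \<open>?J\<close>, although
    \<open>w (f e) = 1\<close>.\<close>
  have "(f e \<otimes>\<^bsub>B\<^esub> g) \<otimes>\<^bsub>B\<^esub> f e = f e \<otimes>\<^bsub>B\<^esub> g"
    using e g by (intro B.mult_absorb f_closed)
  then have "f e \<in> ?J" using e f_closed by auto
  then show False using w(2) e(2) by fastforce
qed

text \<open>\<open>tensor\<close> yields only an \<open>A\<close>-module. Multiplication by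
  \<open>B\<close> on the left factor is restored here, because multiplying by \<open>g\<close> with
  \<open>w g = 1\<close> is how one passes to a neighbourhood of \<open>w\<close>.\<close>

definition mult_left :: "('a, 'n) module \<Rightarrow> 'b \<Rightarrow> ('b \<times> 'n \<Rightarrow> 'a) set \<Rightarrow> ('b \<times> 'n \<Rightarrow> 'a) set" where
  "mult_left L b = presented_map A (tensor A BA L) (\<lambda>(c, x). tensor_elem A BA L (b \<otimes>\<^bsub>B\<^esub> c) x)"

interpretation T: module A "tensor A BA N" by (rule A.module_tensor[OF module_BA N])

lemmas elemD = bilinearD[OF A.tensor_elem_bilinear[OF module_BA N], simplified]

lemma mult_left_bilinear:
  assumes b: "b \<in> carrier B"
  shows "bilinear A BA N (tensor A BA N) (\<lambda>c x. tensor_elem A BA N (b \<otimes>\<^bsub>B\<^esub> c) x)"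
proof (rule bilinearI)
  fix r c x assume "r \<in> carrier A" "c \<in> carrier BA" "x \<in> carrier N"
  then show "tensor_elem A BA N (b \<otimes>\<^bsub>B\<^esub> (r \<odot>\<^bsub>BA\<^esub> c)) x = r \<odot>\<^bsub>tensor A BA N\<^esub> tensor_elem A BA N (b \<otimes>\<^bsub>B\<^esub> c) x"
    using b by (simp add: elemD(4)[symmetric] B.m_lcomm f_closed)
qed (use b in \<open>simp_all add: elemD B.r_distr\<close>)

lemmas mult_left_linear = A.tensor_lift_linear[OF module_BA N A.module_tensor[OF module_BA N] mult_left_bilinear,
    folded mult_left_def]
lemmas mult_left_elem = A.tensor_lift_elem[OF module_BA N A.module_tensor[OF module_BA N] mult_left_bilinear,
    folded mult_left_def, simplified]

lemma mult_left_mult: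
  assumes "a \<in> carrier B" "b \<in> carrier B" "u \<in> carrier (tensor A BA N)"
  shows "mult_left N (a \<otimes>\<^bsub>B\<^esub> b) u = mult_left N a (mult_left N b u)"
  using A.tensor_ext[OF module_BA N A.module_tensor[OF module_BA N] mult_left_linear[OF B.m_closed[OF assms(1,2)]]
      linear_maps_comp[OF mult_left_linear[OF assms(2)] mult_left_linear[OF assms(1)]] _ assms(3)] assms(1,2)
  by (simp add: mult_left_elem B.m_assoc)

lemma mult_left_add:
  assumes "a \<in> carrier B" "b \<in> carrier B" "u \<in> carrier (tensor A BA N)"
  shows "mult_left N (a \<oplus>\<^bsub>B\<^esub> b) u = mult_left N a u \<oplus>\<^bsub>tensor A BA N\<^esub> mult_left N b u"
proof -
  note La = linear_mapsD[OF mult_left_linear[OF assms(1)]]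
  note Lb = linear_mapsD[OF mult_left_linear[OF assms(2)]]
  have "(\<lambda>u. mult_left N a u \<oplus>\<^bsub>tensor A BA N\<^esub> mult_left N b u) \<in> linear_maps A (tensor A BA N) (tensor A BA N)"
    by (intro linear_mapsI) (simp_all add: La Lb T.M.a_ac T.smult_r_distr)
  then show ?thesis
    by (rule A.tensor_ext[OF module_BA N A.module_tensor[OF module_BA N] _ _ _ assms(3), rotated])
     (use assms(1,2) in \<open>auto intro!: mult_left_linear simp: mult_left_elem B.l_distr elemD\<close>)
qed

lemma mult_left_one:
  assumes "u \<in> carrier (tensor A BA N)"
  shows "mult_left N \<one>\<^bsub>B\<^esub> u = u"
proof -
  have "(\<lambda>u. u) \<in> linear_maps A (tensor A BA N) (tensor A BA N)" by (intro linear_mapsI) auto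
  then show ?thesis
    by (rule A.tensor_ext[OF module_BA N A.module_tensor[OF module_BA N] _ _ _ assms, rotated])
     (auto intro!: mult_left_linear simp: mult_left_elem)
qed

lemma tensor_elem_zero_left: "x \<in> carrier N \<Longrightarrow> tensor_elem A BA N \<zero>\<^bsub>B\<^esub> x = \<zero>\<^bsub>tensor A BA N\<^esub>"
  using elemD(4)[of "\<zero>\<^bsub>A\<^esub>" "\<zero>\<^bsub>B\<^esub>" x] T.smult_l_null[OF elemD(1)[of "\<zero>\<^bsub>B\<^esub>" x]]
  by (simp add: f_zero)

lemma tensor_elem_zero_right: "b \<in> carrier B \<Longrightarrow> tensor_elem A BA N b \<zero>\<^bsub>N\<^esub> = \<zero>\<^bsub>tensor A BA N\<^esub>"
  using elemD(5)[of "\<zero>\<^bsub>A\<^esub>" b "\<zero>\<^bsub>N\<^esub>"] T.smult_l_null[OF elemD(1)[of b "\<zero>\<^bsub>N\<^esub>"]]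
  by simp

text \<open>Near a point every tensor is pure. When a summand with left factor \<open>c\<close> is
  added, one multiplies by \<open>c\<close> if \<open>w c = 1\<close>, so that both summands share
  their left factor, and by \<open>\<one> \<oplus> c\<close> otherwise, which kills the new
  summand.\<close>

lemma tensor_local_form:
  assumes w: "is_point B w" and u: "u \<in> carrier (tensor A BA N)"
  obtains g n where "g \<in> carrier B" "n \<in> carrier N" "w g = 1" "mult_left N g u = tensor_elem A BA N g n"
proof -
  have "\<exists>g \<in> carrier B. \<exists>n \<in> carrier N. w g = 1 \<and> mult_left N g u = tensor_elem A BA N g n"
  proof (rule A.tensor_induct[OF module_BA N u])
    show "\<exists>g \<in> carrier B. \<exists>n \<in> carrier N. w g = 1 \<and>
        mult_left N g \<zero>\<^bsub>tensor A BA N\<^esub> = tensor_elem A BA N g n"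
      using pointD(1)[OF w] linear_maps_zero[OF T.module_axioms T.module_axioms mult_left_linear[OF B.one_closed]]
      by (intro bexI[of _ "\<one>\<^bsub>B\<^esub>"] bexI[of _ "\<zero>\<^bsub>N\<^esub>"] conjI) (simp_all add: tensor_elem_zero_right)
  next
    fix c x v
    assume add: "c \<in> carrier BA" "x \<in> carrier N" "v \<in> carrier (tensor A BA N)"
      "\<exists>g \<in> carrier B. \<exists>n \<in> carrier N. w g = 1 \<and> mult_left N g v = tensor_elem A BA N g n"
    then have c: "c \<in> carrier B" by simp
    obtain g n where gn: "g \<in> carrier B" "n \<in> carrier N" "w g = 1" "mult_left N g v = tensor_elem A BA N g n"
      using add by blast
    have step: "mult_left N (h \<otimes>\<^bsub>B\<^esub> g) (tensor_elem A BA N c x \<oplus>\<^bsub>tensor A BA N\<^esub> v) =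
        tensor_elem A BA N (h \<otimes>\<^bsub>B\<^esub> g \<otimes>\<^bsub>B\<^esub> c) x \<oplus>\<^bsub>tensor A BA N\<^esub> tensor_elem A BA N (h \<otimes>\<^bsub>B\<^esub> g) n"
      if h: "h \<in> carrier B" for h
      using c gn h add(2,3)
      by (simp add: linear_mapsD[OF mult_left_linear] elemD(1) mult_left_elem mult_left_mult gn(4))
    show "\<exists>g \<in> carrier B. \<exists>n \<in> carrier N. w g = 1 \<and>
      mult_left N g (tensor_elem A BA N c x \<oplus>\<^bsub>tensor A BA N\<^esub> v) = tensor_elem A BA N g n"
    proof (cases "w c = 1")
      case True
      have "c \<otimes>\<^bsub>B\<^esub> g \<otimes>\<^bsub>B\<^esub> c = c \<otimes>\<^bsub>B\<^esub> g"
        using c gn(1) by (rule B.mult_absorb)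
      then have "mult_left N (c \<otimes>\<^bsub>B\<^esub> g) (tensor_elem A BA N c x \<oplus>\<^bsub>tensor A BA N\<^esub> v)
        = tensor_elem A BA N (c \<otimes>\<^bsub>B\<^esub> g) (x \<oplus>\<^bsub>N\<^esub> n)"
        using step[OF c] c gn add(2) by (simp add: elemD(3))
      moreover have "w (c \<otimes>\<^bsub>B\<^esub> g) = 1" using c gn True by (simp add: pointD[OF w])
      ultimately show ?thesis using c gn add(2) by (meson B.m_closed N.M.a_closed)
    next
      case False
      let ?h = "\<one>\<^bsub>B\<^esub> \<oplus>\<^bsub>B\<^esub> c"
      have h: "?h \<in> carrier B" using c by simp
      have "?h \<otimes>\<^bsub>B\<^esub> g \<otimes>\<^bsub>B\<^esub> c = g \<otimes>\<^bsub>B\<^esub> (?h \<otimes>\<^bsub>B\<^esub> c)"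
        using c gn h by (simp add: B.m_ac)
      also have "\<dots> = \<zero>\<^bsub>B\<^esub>" using c gn by (simp add: B.l_distr B.idem B.add_self)
      finally have "mult_left N (?h \<otimes>\<^bsub>B\<^esub> g) (tensor_elem A BA N c x \<oplus>\<^bsub>tensor A BA N\<^esub> v)
        = tensor_elem A BA N (?h \<otimes>\<^bsub>B\<^esub> g) n"
        using step[OF h] c gn add(2) by (simp add: tensor_elem_zero_left elemD(1))
      moreover have "w (?h \<otimes>\<^bsub>B\<^esub> g) = 1" using c gn False by (simp add: pointD[OF w])
      ultimately show ?thesis using h gn by (meson B.m_closed)
    qed
  qed
  then obtain g n where "g \<in> carrier B" "n \<in> carrier N" "w g = 1" "mult_left N g u = tensor_elem A BA N g n"
    by blast
  then show ?thesis by (rule that)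
qed

end

end

section \<open>Exactness before and after tensoring\<close>

context bool_ext begin

context
  fixes N1 :: "('a, 'n) module" and N2 :: "('a, 'n) module" and u
  assumes N1: "module A N1" and N2: "module A N2" and u: "u \<in> linear_maps A N1 N2"
begin

interpretation N1: module A N1 by (rule N1)
interpretation N2: module A N2 by (rule N2)

lemmas elemD2 = elemD[OF N2]

lemma tensor_map_bilinear: "bilinear A BA N1 (tensor A BA N2) (\<lambda>x y. tensor_elem A BA N2 x (u y))"
  by (rule bilinearI) (simp_all add: linear_mapsD[OF u] elemD2)

lemmas tensor_map_linear = A.tensor_lift_linear[OF module_BA N1 A.module_tensor[OF module_BA N2]
    tensor_map_bilinear, folded tensor_map_def]
lemmas tensor_map_elem = A.tensor_lift_elem[OF module_BA N1 A.module_tensor[OF module_BA N2]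
    tensor_map_bilinear, folded tensor_map_def, simplified]

lemma tensor_map_mult_left:
  assumes "b \<in> carrier B" "t \<in> carrier (tensor A BA N1)"
  shows "tensor_map A BA N2 u (mult_left N1 b t) = mult_left N2 b (tensor_map A BA N2 u t)"
  using A.tensor_ext[OF module_BA N1 A.module_tensor[OF module_BA N2]
      linear_maps_comp[OF mult_left_linear[OF N1 assms(1)] tensor_map_linear]
      linear_maps_comp[OF tensor_map_linear mult_left_linear[OF N2 assms(1)]] _ assms(2)] assms(1)
  by (simp add: tensor_map_elem mult_left_elem[OF N1] mult_left_elem[OF N2] linear_mapsD[OF u])

text \<open>Whether \<open>t\<close> lies in the image is the question whether this ideal contains
  1, and that can be settled at points.\<close>

lemma image_bideal:
  assumes "t \<in> carrier (tensor A BA N2)"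
  shows "B.bideal {b \<in> carrier B. mult_left N2 b t \<in> tensor_map A BA N2 u ` carrier (tensor A BA N1)}" (is "B.bideal ?J")
proof -
  interpret T1: module A "tensor A BA N1" by (rule A.module_tensor[OF module_BA N1])
  interpret T2: module A "tensor A BA N2" by (rule A.module_tensor[OF module_BA N2])
  note D = linear_mapsD[OF tensor_map_linear]
  show ?thesis unfolding B.bideal_def
  proof (intro conjI ballI)
    have "mult_left N2 \<zero>\<^bsub>B\<^esub> t = \<zero>\<^bsub>tensor A BA N2\<^esub>"
      using mult_left_add[OF N2 B.zero_closed B.zero_closed assms]
        linear_mapsD(1)[OF mult_left_linear[OF N2 B.zero_closed] assms]
      by (simp add: T2.M.add.l_cancel_one)
    also have "\<dots> = tensor_map A BA N2 u \<zero>\<^bsub>tensor A BA N1\<^esub>"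
      by (rule linear_maps_zero[OF T1.module_axioms T2.module_axioms tensor_map_linear, symmetric])
    finally show "\<zero>\<^bsub>B\<^esub> \<in> ?J"
      by simp
  next
    fix b c assume "b \<in> ?J"
      "c \<in> ?J"
    then obtain x y where "b \<in> carrier B" "c \<in> carrier B" "mult_left N2 b t = tensor_map A BA N2 u x"
      "mult_left N2 c t = tensor_map A BA N2 u y" "x \<in> carrier (tensor A BA N1)" "y \<in> carrier (tensor A BA N1)"
      by blast
    then show "b \<oplus>\<^bsub>B\<^esub> c \<in> ?J"
      using assms by (simp add: mult_left_add[OF N2] D(2)[symmetric])
  next
    fix r b assume r: "r \<in> carrier B"
      and "b \<in> ?J"
    then obtain x where "b \<in> carrier B" "mult_left N2 b t = tensor_map A BA N2 u x"
      "x \<in> carrier (tensor A BA N1)" by blast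
    then show "r \<otimes>\<^bsub>B\<^esub> b \<in> ?J"
      using assms r linear_mapsD(1)[OF mult_left_linear[OF N1 r]]
      by (simp add: mult_left_mult[OF N2] tensor_map_mult_left[symmetric])
  qed auto
qed

end

context
  fixes N1 :: "('a, 'n) module" and N2 :: "('a, 'n) module" and N3 :: "('a, 'n) module" and u v
  assumes N1: "module A N1" and N2: "module A N2" and N3: "module A N3"
    and u: "u \<in> linear_maps A N1 N2" and v: "v \<in> linear_maps A N2 N3"
begin

interpretation N1: module A N1 by (rule N1)
interpretation N2: module A N2 by (rule N2)
interpretation N3: module A N3 by (rule N3)
interpretation T1: module A "tensor A BA N1" by (rule A.module_tensor[OF module_BA N1])
interpretation T2: module A "tensor A BA N2" by (rule A.module_tensor[OF module_BA N2])
interpretation T3: module A "tensor A BA N3" by (rule A.module_tensor[OF module_BA N3])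

lemmas uD = linear_mapsD[OF u]
lemmas vD = linear_mapsD[OF v]
lemmas tu = tensor_map_linear[OF N1 N2 u]
lemmas tv = tensor_map_linear[OF N2 N3 v]
lemmas tu_elem = tensor_map_elem[OF N1 N2 u]
lemmas tv_elem = tensor_map_elem[OF N2 N3 v]

text \<open>Flatness. Near a point a tensor in the kernel is some \<open>g \<otimes> n\<close>, and
  the vanishing of \<open>g \<otimes> v n\<close> yields \<open>e\<close> with \<open>g\<close>
  below \<open>f e\<close> and \<open>v (e n) = 0\<close>. Then \<open>e n = u l\<close> for some
  \<open>l\<close>, and \<open>g \<otimes> n = g \<otimes> e n\<close> is the image of
  \<open>g \<otimes> l\<close>.\<close>

lemma exact_tensor:
  assumes "exact_at N1 N2 N3 u v"
  shows "exact_at (tensor A BA N1) (tensor A BA N2) (tensor A BA N3)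
    (tensor_map A BA N2 u) (tensor_map A BA N3 v)"
proof -
  have vu: "v (u x) = \<zero>\<^bsub>N3\<^esub>" if "x \<in> carrier N1" for x
    using assms that unfolding exact_at_def by blast
  have ker: "\<exists>x\<in>carrier N1. y = u x" if "y \<in> carrier N2" "v y = \<zero>\<^bsub>N3\<^esub>" for y
    using assms that unfolding exact_at_def by blast
  have zero: "(\<lambda>_. \<zero>\<^bsub>tensor A BA N3\<^esub>) \<in> linear_maps A (tensor A BA N1) (tensor A BA N3)"
    by (rule linear_mapsI) simp_all
  have comp: "tensor_map A BA N3 v (tensor_map A BA N2 u t) = \<zero>\<^bsub>tensor A BA N3\<^esub>"
    if "t \<in> carrier (tensor A BA N1)" for t
    using A.tensor_ext[OF module_BA N1 T3.module_axioms linear_maps_comp[OF tu tv] zero _ that]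
    by (simp add: tu_elem tv_elem uD vu tensor_elem_zero_right[OF N3])
  have "t \<in> tensor_map A BA N2 u ` carrier (tensor A BA N1)"
    if t: "t \<in> carrier (tensor A BA N2)" "tensor_map A BA N3 v t = \<zero>\<^bsub>tensor A BA N3\<^esub>" for t
  proof -
    let ?J = "{b \<in> carrier B. mult_left N2 b t \<in> tensor_map A BA N2 u ` carrier (tensor A BA N1)}"
    have "\<one>\<^bsub>B\<^esub> \<in> ?J"
    proof (rule ccontr)
      assume "\<one>\<^bsub>B\<^esub> \<notin> ?J"
      then obtain w where w: "is_point B w" "\<forall>b \<in> ?J. w b = 0"
        using B.point_exists[OF image_bideal[OF N1 N2 u t(1)]] by blast
      obtain g n where g: "g \<in> carrier B" "n \<in> carrier N2" "w g = 1"
        "mult_left N2 g t = tensor_elem A BA N2 g n"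
        by (rule tensor_local_form[OF N2 w(1) t(1)])
      have "tensor_elem A BA N3 g (v n) = tensor_map A BA N3 v (mult_left N2 g t)"
        using g by (simp add: tv_elem)
      also have "\<dots> = \<zero>\<^bsub>tensor A BA N3\<^esub>"
        using tensor_map_mult_left[OF N2 N3 v g(1) t(1)] t(2)
          linear_maps_zero[OF T3.module_axioms T3.module_axioms mult_left_linear[OF N3 g(1)]] by simp
      finally obtain e where e: "e \<in> carrier A" "g \<otimes>\<^bsub>B\<^esub> f e = g" "e \<odot>\<^bsub>N3\<^esub> v n = \<zero>\<^bsub>N3\<^esub>"
        using tensor_elem_eq_zero[OF N3 g(1) vD(1)[OF g(2)]] by blast
      then have "v (e \<odot>\<^bsub>N2\<^esub> n) = \<zero>\<^bsub>N3\<^esub>" using g by (simp add: vD)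
      then obtain l where l: "l \<in> carrier N1" "e \<odot>\<^bsub>N2\<^esub> n = u l"
        using ker e(1) g(2) by blast
      have "tensor_elem A BA N2 g n = tensor_elem A BA N2 (f e \<otimes>\<^bsub>B\<^esub> g) n"
        using e(2) g(1) f_closed[OF e(1)] by (simp add: B.m_comm)
      also have "\<dots> = tensor_elem A BA N2 g (u l)"
        using e(1) g l(2)[symmetric] elemD(4,5)[OF N2] by simp
      also have "\<dots> = tensor_map A BA N2 u (tensor_elem A BA N1 g l)"
        using g l by (simp add: tu_elem)
      finally have "g \<in> ?J" using g l elemD(1)[OF N1] by auto
      then show False using w(2) g(3) by fastforce
    qed
    then show ?thesis using mult_left_one[OF N2 t(1)] by simp
  qed
  then show ?thesis unfolding exact_at_def
    using linear_mapsD(1)[OF tu] comp by blast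
qed

text \<open>Faithfulness, and the place where injectivity of \<open>f\<close> matters: a witness
  \<open>e\<close> for the left factor 1 satisfies \<open>f e = 1\<close>, which forces
  \<open>e = 1\<close>.\<close>

lemma exact_of_tensor:
  assumes "exact_at (tensor A BA N1) (tensor A BA N2) (tensor A BA N3)
    (tensor_map A BA N2 u) (tensor_map A BA N3 v)"
  shows "exact_at N1 N2 N3 u v"
proof -
  have comp: "v (u x) = \<zero>\<^bsub>N3\<^esub>" if x: "x \<in> carrier N1" for x
  proof -
    have "tensor_elem A BA N3 \<one>\<^bsub>B\<^esub> (v (u x)) =
        tensor_map A BA N3 v (tensor_map A BA N2 u (tensor_elem A BA N1 \<one>\<^bsub>B\<^esub> x))"
      using x by (simp add: tu_elem tv_elem uD)
    also have "\<dots> = \<zero>\<^bsub>tensor A BA N3\<^esub>"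
      using assms x elemD(1)[OF N1, of "\<one>\<^bsub>B\<^esub>" x] unfolding exact_at_def by blast
    finally obtain e where e: "e \<in> carrier A" "\<one>\<^bsub>B\<^esub> \<otimes>\<^bsub>B\<^esub> f e = \<one>\<^bsub>B\<^esub>" "e \<odot>\<^bsub>N3\<^esub> v (u x) = \<zero>\<^bsub>N3\<^esub>"
      using tensor_elem_eq_zero[OF N3 B.one_closed vD(1)[OF uD(1)[OF x]]] by blast
    then have "f e = f \<one>\<^bsub>A\<^esub>" by (simp add: f_one f_closed)
    then have "e = \<one>\<^bsub>A\<^esub>" using e(1) by (simp add: f_eq)
    then show ?thesis using e(3) x by (simp add: uD vD)
  qed
  have "y \<in> u ` carrier N1" if y: "y \<in> carrier N2" "v y = \<zero>\<^bsub>N3\<^esub>" for y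
  proof -
    let ?I = "u ` carrier N1"
    have I_add: "a \<oplus>\<^bsub>N2\<^esub> b \<in> ?I" if "a \<in> ?I" "b \<in> ?I" for a b
      using that by (auto simp: uD(2)[symmetric])
    have I_smult: "r \<odot>\<^bsub>N2\<^esub> a \<in> ?I" if "r \<in> carrier A" "a \<in> ?I" for r a
      using that by (auto simp: uD(3)[symmetric])
    have "tensor_map A BA N3 v (tensor_elem A BA N2 \<one>\<^bsub>B\<^esub> y) = \<zero>\<^bsub>tensor A BA N3\<^esub>"
      using y by (simp add: tv_elem tensor_elem_zero_right[OF N3])
    then obtain s where s: "s \<in> carrier (tensor A BA N1)"
      "tensor_elem A BA N2 \<one>\<^bsub>B\<^esub> y = tensor_map A BA N2 u s"
      using assms y elemD(1)[OF N2, of "\<one>\<^bsub>B\<^esub>" y] unfolding exact_at_def by blast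
    \<comment> \<open>This ideal measures where \<open>y\<close> comes from \<open>N1\<close>. Near
      each point the preimage \<open>s\<close> of \<open>1 \<otimes> y\<close> is some
      \<open>g \<otimes> l\<close>, and the vanishing of \<open>g \<otimes> (y + u l)\<close> puts
      \<open>g\<close> into the ideal.\<close>
    let ?J = "{b \<in> carrier B. \<exists>e\<in>carrier A. e \<odot>\<^bsub>N2\<^esub> y \<in> ?I \<and> b \<otimes>\<^bsub>B\<^esub> f e = b}"
    have "B.bideal ?J" unfolding B.bideal_def
    proof (intro conjI ballI)
      have "\<zero>\<^bsub>A\<^esub> \<odot>\<^bsub>N2\<^esub> y = u \<zero>\<^bsub>N1\<^esub>"
        using y linear_maps_zero[OF N1 N2 u] by simp
      then have "\<zero>\<^bsub>A\<^esub> \<odot>\<^bsub>N2\<^esub> y \<in> ?I" using N1.M.zero_closed by blast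
      moreover have "\<zero>\<^bsub>B\<^esub> \<otimes>\<^bsub>B\<^esub> f \<zero>\<^bsub>A\<^esub> = \<zero>\<^bsub>B\<^esub>" by (simp add: f_zero)
      ultimately show "\<zero>\<^bsub>B\<^esub> \<in> ?J" using A.zero_closed B.zero_closed by blast
    next
      fix b1 b2 assume "b1 \<in> ?J" "b2 \<in> ?J"
      then obtain e1 e2 where e: "e1 \<in> carrier A" "e2 \<in> carrier A" "e1 \<odot>\<^bsub>N2\<^esub> y \<in> ?I" "e2 \<odot>\<^bsub>N2\<^esub> y \<in> ?I"
        "b1 \<otimes>\<^bsub>B\<^esub> f e1 = b1" "b2 \<otimes>\<^bsub>B\<^esub> f e2 = b2" and b: "b1 \<in> carrier B" "b2 \<in> carrier B" by blast
      have "(e1 \<oplus>\<^bsub>A\<^esub> e2 \<oplus>\<^bsub>A\<^esub> e1 \<otimes>\<^bsub>A\<^esub> e2) \<odot>\<^bsub>N2\<^esub> y =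
          e1 \<odot>\<^bsub>N2\<^esub> y \<oplus>\<^bsub>N2\<^esub> e2 \<odot>\<^bsub>N2\<^esub> y \<oplus>\<^bsub>N2\<^esub> e1 \<odot>\<^bsub>N2\<^esub> (e2 \<odot>\<^bsub>N2\<^esub> y)"
        using e(1,2) y by (simp add: N2.smult_l_distr N2.smult_assoc1)
      also have "\<dots> \<in> ?I" by (rule I_add[OF I_add[OF e(3,4)] I_smult[OF e(1,4)]])
      finally show "b1 \<oplus>\<^bsub>B\<^esub> b2 \<in> ?J"
        using join_bound[OF e(1,2) b e(5,6)] b e(1,2) by blast
    next
      fix r b assume r: "r \<in> carrier B" and "b \<in> ?J"
      then obtain e where e: "e \<in> carrier A" "e \<odot>\<^bsub>N2\<^esub> y \<in> ?I" "b \<otimes>\<^bsub>B\<^esub> f e = b" "b \<in> carrier B" by blast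
      then have "(r \<otimes>\<^bsub>B\<^esub> b) \<otimes>\<^bsub>B\<^esub> f e = r \<otimes>\<^bsub>B\<^esub> b" using r by (simp add: B.m_assoc f_closed)
      then show "r \<otimes>\<^bsub>B\<^esub> b \<in> ?J" using e r by blast
    qed auto
    have "\<one>\<^bsub>B\<^esub> \<in> ?J"
    proof (rule ccontr)
      assume "\<one>\<^bsub>B\<^esub> \<notin> ?J"
      then obtain w where w: "is_point B w" "\<forall>b \<in> ?J. w b = 0"
        using B.point_exists[OF \<open>B.bideal ?J\<close>] by blast
      obtain g l where g: "g \<in> carrier B" "l \<in> carrier N1" "w g = 1"
        "mult_left N1 g s = tensor_elem A BA N1 g l"
        by (rule tensor_local_form[OF N1 w(1) s(1)])
      have "tensor_elem A BA N2 g y = mult_left N2 g (tensor_elem A BA N2 \<one>\<^bsub>B\<^esub> y)"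
        using g y by (simp add: mult_left_elem[OF N2])
      also have "\<dots> = tensor_elem A BA N2 g (u l)"
        using g s by (simp add: tensor_map_mult_left[OF N1 N2 u, symmetric] tu_elem)
      finally have eq: "tensor_elem A BA N2 g y = tensor_elem A BA N2 g (u l)" .
      have "tensor_elem A BA N2 g (y \<oplus>\<^bsub>N2\<^esub> u l) = tensor_elem A BA N2 g y \<oplus>\<^bsub>tensor A BA N2\<^esub> tensor_elem A BA N2 g (u l)"
        using g y by (simp add: elemD(3)[OF N2] uD)
      also have "\<dots> = \<zero>\<^bsub>tensor A BA N2\<^esub>"
        unfolding eq using A.module_add_self[OF T2.module_axioms elemD(1)[OF N2 g(1) uD(1)[OF g(2)]]] .
      finally obtain e where e: "e \<in> carrier A" "g \<otimes>\<^bsub>B\<^esub> f e = g" "e \<odot>\<^bsub>N2\<^esub> (y \<oplus>\<^bsub>N2\<^esub> u l) = \<zero>\<^bsub>N2\<^esub>"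
        using tensor_elem_eq_zero[OF N2 g(1) N2.M.a_closed[OF y(1) uD(1)[OF g(2)]]] by blast
      have "e \<odot>\<^bsub>N2\<^esub> y \<oplus>\<^bsub>N2\<^esub> e \<odot>\<^bsub>N2\<^esub> u l = \<zero>\<^bsub>N2\<^esub>"
        using e y uD(1)[OF g(2)] by (simp add: N2.smult_r_distr)
      then have "e \<odot>\<^bsub>N2\<^esub> y = \<ominus>\<^bsub>N2\<^esub> (e \<odot>\<^bsub>N2\<^esub> u l)"
        using e(1) y uD(1)[OF g(2)] by (intro N2.M.minus_equality[symmetric]) simp_all
      also have "\<dots> = u (e \<odot>\<^bsub>N1\<^esub> l)"
        using e(1) g(2) A.module_uminus[OF N2, of "e \<odot>\<^bsub>N2\<^esub> u l"] by (simp add: uD)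
      finally have "e \<odot>\<^bsub>N2\<^esub> y \<in> ?I" using e(1) g(2) by blast
      then have "g \<in> ?J" using e g(1) by blast
      then show False using w(2) g(3) by fastforce
    qed
    then obtain e where e: "e \<in> carrier A" "e \<odot>\<^bsub>N2\<^esub> y \<in> ?I" "\<one>\<^bsub>B\<^esub> \<otimes>\<^bsub>B\<^esub> f e = \<one>\<^bsub>B\<^esub>" by blast
    then have "f e = f \<one>\<^bsub>A\<^esub>" by (simp add: f_one f_closed)
    then have "e = \<one>\<^bsub>A\<^esub>" using e(1) by (simp add: f_eq)
    then show ?thesis using e(2) y by simp
  qed
  then show ?thesis unfolding exact_at_def using comp uD(1) by blast
qed

end

theorem faithfully_flat_extension: "faithfully_flat A B f"
  unfolding faithfully_flat_def faithfully_flat_module_def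
  using hom module_BA exact_tensor exact_of_tensor by blast

end

section \<open>A free resolution of the fiber\<close>

lemma submodule_image:
  assumes "module A M" "module A N" "h \<in> linear_maps A M N"
  shows "submodule (h ` carrier M) A N"
proof -
  interpret M: module A M by fact
  interpret N: module A N by fact
  note D = linear_mapsD[OF assms(3)]
  show ?thesis
  proof (rule N.submoduleI)
    show "\<zero>\<^bsub>N\<^esub> \<in> h ` carrier M"
      using linear_maps_zero[OF assms, symmetric] M.M.zero_closed by blast
  next
    fix a assume "a \<in> h ` carrier M"
    then obtain x where "x \<in> carrier M" "a = h x" by blast
    then show "\<ominus>\<^bsub>N\<^esub> a \<in> h ` carrier M"
      using linear_maps_uminus[OF assms, symmetric] M.M.a_inv_closed by blast
  next
    fix a b assume "a \<in> h ` carrier M" "b \<in> h ` carrier M"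
    then obtain x y where "x \<in> carrier M" "a = h x" "y \<in> carrier M" "b = h y" by blast
    then show "a \<oplus>\<^bsub>N\<^esub> b \<in> h ` carrier M"
      using D(2)[symmetric] M.M.a_closed by blast
  next
    fix r a assume "r \<in> carrier A" "a \<in> h ` carrier M"
    then obtain x where "r \<in> carrier A" "x \<in> carrier M" "a = h x" by blast
    then show "r \<odot>\<^bsub>N\<^esub> a \<in> h ` carrier M"
      using D(3)[symmetric] M.smult_closed by blast
  qed (use D(1) in blast)
qed

lemma (in base_ring) free_ext:
  assumes "module R N" "h \<in> linear_maps R (free_module R E) N" "k \<in> linear_maps R (free_module R E) N"
    and "\<And>x. x \<in> E \<Longrightarrow> h (basis_elem R x) = k (basis_elem R x)"
    and "F \<in> carrier (free_module R E)"
  shows "h F = k F"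
proof -
  interpret F: module R "free_module R E" by (rule module_free)
  note H = linear_mapsD[OF assms(2)] and K = linear_mapsD[OF assms(3)]
  show ?thesis using assms(5)
  proof (induction rule: free_induct)
    case zero
    show ?case
      using linear_maps_zero[OF module_free assms(1,2)] linear_maps_zero[OF module_free assms(1,3)] by simp
  next
    case (add r x G)
    then show ?case
      using F.smult_closed[OF add(1) basis_closed[OF add(2)]]
      by (simp add: H(2,3) K(2,3) basis_closed assms(4) del: free_module_simps)
  qed
qed

lemma quasi_isomorphismI:
  fixes C :: "int \<Rightarrow> ('a, 'm) module" and C' :: "int \<Rightarrow> ('a, 'n) module"
  assumes C: "cochain_complex A C d"
    and C': "\<And>i. module A (C' i)" "\<And>i. d' i \<in> linear_maps A (C' i) (C' (i + 1))"
    and q: "cochain_map A C d C' d' q"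
    and surj: "\<And>i z'. z' \<in> cocycles C' d' i \<Longrightarrow>
      \<exists>z \<in> cocycles C d i. \<exists>y \<in> carrier (C' (i - 1)). z' = q i z \<oplus>\<^bsub>C' i\<^esub> d' (i - 1) y"
    and inj: "\<And>i z. z \<in> cocycles C d i \<Longrightarrow> q i z \<in> coboundaries C' d' i \<Longrightarrow> z \<in> coboundaries C d i"
    and q_cocycle: "\<And>i z. z \<in> cocycles C d i \<Longrightarrow> q i z \<in> cocycles C' d' i"
  shows "quasi_isomorphism A C d C' d' q"
  unfolding quasi_isomorphism_def
proof (intro conjI allI)
  fix i
  have C1: "module A (C j)" "d j \<in> linear_maps A (C j) (C (j + 1))" for j
    using C by (auto simp: cochain_complex_def)
  have dl: "d (i - 1) \<in> linear_maps A (C (i - 1)) (C i)" using C1(2)[of "i - 1"] by simp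
  have dl': "d' (i - 1) \<in> linear_maps A (C' (i - 1)) (C' i)" using C'(2)[of "i - 1"] by simp
  have ql: "q j \<in> linear_maps A (C j) (C' j)" and qd: "x \<in> carrier (C j) \<Longrightarrow> q (j + 1) (d j x) = d' j (q j x)" for j x
    using q by (auto simp: cochain_map_def)
  interpret Ci: module A "C i" by (rule C1)
  interpret base_ring A by unfold_locales
  let ?b = "coboundaries C d i" and ?b' = "coboundaries C' d' i"
  interpret S: quotient_mod A "C i" ?b
    unfolding coboundaries_def by (intro quotient_mod.intro C1 submodule_image[OF _ _ dl])
  interpret S': quotient_mod A "C' i" ?b'
    unfolding coboundaries_def by (intro quotient_mod.intro C' submodule_image[OF _ _ dl'])
  note Q = linear_mapsD[OF ql[of i]]
  have map: "cohomology_map C' d' q i (?b +>\<^bsub>C i\<^esub> z) = ?b' +>\<^bsub>C' i\<^esub> q i z" if z: "z \<in> carrier (C i)" for z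
    unfolding cohomology_map_def
  proof (rule S.the_elem_coset[OF S'.module_quotient linear_maps_comp[OF ql S'.coset_linear] _ z])
    fix x assume "x \<in> ?b"
    then obtain y where y: "y \<in> carrier (C (i - 1))" "x = d (i - 1) y" by (auto simp: coboundaries_def)
    then have "q i x = d' (i - 1) (q (i - 1) y)" using qd[of y "i - 1"] by simp
    then have "q i x \<in> ?b'"
      using linear_mapsD(1)[OF ql y(1)] by (auto simp: coboundaries_def)
    then show "?b' +>\<^bsub>C' i\<^esub> q i x = \<zero>\<^bsub>quotient_module (C' i) ?b'\<^esub>"
      using S'.subset by (subst S'.coset_eq_zero_iff) auto
  qed
  show "bij_betw (cohomology_map C' d' q i) (cohomology C d i) (cohomology C' d' i)"
    unfolding bij_betw_def
  proof
    show "inj_on (cohomology_map C' d' q i) (cohomology C d i)"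
    proof (rule inj_onI)
      fix s t assume "s \<in> cohomology C d i" "t \<in> cohomology C d i"
        and eq: "cohomology_map C' d' q i s = cohomology_map C' d' q i t"
      then obtain x y where x: "x \<in> cocycles C d i" "s = ?b +>\<^bsub>C i\<^esub> x"
        and y: "y \<in> cocycles C d i" "t = ?b +>\<^bsub>C i\<^esub> y" by (auto simp: cohomology_def)
      then have c: "x \<in> carrier (C i)" "y \<in> carrier (C i)" by (auto simp: cocycles_def)
      have "q i x \<ominus>\<^bsub>C' i\<^esub> q i y \<in> ?b'"
        using eq c unfolding x(2) y(2) by (simp add: map S'.coset_eq_iff Q)
      then have "q i (x \<ominus>\<^bsub>C i\<^esub> y) \<in> ?b'"
        using c by (simp add: linear_maps_minus[OF C1(1) C'(1) ql])
      moreover have "x \<ominus>\<^bsub>C i\<^esub> y \<in> cocycles C d i"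
      proof -
        interpret Cj: module A "C (i + 1)" by (rule C1)
        show ?thesis using x y c
          by (auto simp: cocycles_def linear_maps_minus[OF C1(1) C1(1) C1(2)] Cj.M.minus_eq Cj.M.r_neg)
      qed
      ultimately have "x \<ominus>\<^bsub>C i\<^esub> y \<in> ?b" using inj by blast
      then show "s = t" using c unfolding x(2) y(2) by (simp add: S.coset_eq_iff)
    qed
    show "cohomology_map C' d' q i ` cohomology C d i = cohomology C' d' i"
    proof (intro equalityI subsetI)
      fix s assume "s \<in> cohomology_map C' d' q i ` cohomology C d i"
      then obtain z where "z \<in> cocycles C d i" "s = cohomology_map C' d' q i (?b +>\<^bsub>C i\<^esub> z)"
        by (auto simp: cohomology_def)
      then show "s \<in> cohomology C' d' i"
        using q_cocycle[of z i] by (auto simp: cohomology_def cocycles_def map)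
    next
      fix s assume "s \<in> cohomology C' d' i"
      then obtain z' where z': "z' \<in> cocycles C' d' i" "s = ?b' +>\<^bsub>C' i\<^esub> z'" by (auto simp: cohomology_def)
      obtain z y where zy: "z \<in> cocycles C d i" "y \<in> carrier (C' (i - 1))" "z' = q i z \<oplus>\<^bsub>C' i\<^esub> d' (i - 1) y"
        using surj[OF z'(1)] by blast
      have c: "z \<in> carrier (C i)" "q i z \<in> carrier (C' i)" "z' \<in> carrier (C' i)"
        "d' (i - 1) y \<in> carrier (C' i)"
        using zy(1,2) z'(1) linear_mapsD(1)[OF dl'] by (auto simp: cocycles_def Q)
      have "z' \<ominus>\<^bsub>C' i\<^esub> q i z = d' (i - 1) y"
        unfolding zy(3) S'.M.a_comm[OF c(2,4)] using c by (simp add: S'.M.minus_eq S'.M.a_assoc S'.M.r_neg)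
      then have "s = ?b' +>\<^bsub>C' i\<^esub> q i z"
        unfolding z'(2) using c zy(2) by (subst S'.coset_eq_iff) (auto simp: coboundaries_def)
      then have "s = cohomology_map C' d' q i (?b +>\<^bsub>C i\<^esub> z)" using c map by simp
      then show "s \<in> cohomology_map C' d' q i ` cohomology C d i"
        using zy(1) by (auto simp: cohomology_def)
    qed
  qed
qed (rule q)

lemma direct_sum_simps [simp]:
  "carrier (direct_sum M N) = carrier M \<times> carrier N"
  "\<zero>\<^bsub>direct_sum M N\<^esub> = (\<zero>\<^bsub>M\<^esub>, \<zero>\<^bsub>N\<^esub>)"
  "(x, y) \<oplus>\<^bsub>direct_sum M N\<^esub> (x', y') = (x \<oplus>\<^bsub>M\<^esub> x', y \<oplus>\<^bsub>N\<^esub> y')"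
  "r \<odot>\<^bsub>direct_sum M N\<^esub> (x, y) = (r \<odot>\<^bsub>M\<^esub> x, r \<odot>\<^bsub>N\<^esub> y)"
  by (simp_all add: direct_sum_def)

lemma module_direct_sum:
  assumes "module A M" "module A N" shows "module A (direct_sum M N)"
proof -
  interpret M: module A M by fact
  interpret N: module A N by fact
  show ?thesis
  proof (rule moduleI)
    show "abelian_group (direct_sum M N)"
    proof (rule abelian_groupI)
      fix z assume "z \<in> carrier (direct_sum M N)"
      then obtain x y where "z = (x, y)" "x \<in> carrier M" "y \<in> carrier N" by auto
      then show "\<exists>w\<in>carrier (direct_sum M N). w \<oplus>\<^bsub>direct_sum M N\<^esub> z = \<zero>\<^bsub>direct_sum M N\<^esub>"
        by (intro bexI[of _ "(\<ominus>\<^bsub>M\<^esub> x, \<ominus>\<^bsub>N\<^esub> y)"]) (simp_all add: M.M.l_neg N.M.l_neg)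
    qed (auto simp: M.M.a_ac N.M.a_ac)
  qed (auto simp: M.smult_l_distr M.smult_r_distr M.smult_assoc1 N.smult_l_distr N.smult_r_distr
        N.smult_assoc1 M.R.is_cring)
qed

lemma stalk_simps [simp]:
  "\<zero>\<^bsub>stalk M i\<^esub> = \<zero>\<^bsub>M\<^esub>" "x \<oplus>\<^bsub>stalk M i\<^esub> y = x \<oplus>\<^bsub>M\<^esub> y" "r \<odot>\<^bsub>stalk M i\<^esub> x = r \<odot>\<^bsub>M\<^esub> x"
  "carrier (stalk M i) = (if i = 0 then carrier M else {\<zero>\<^bsub>M\<^esub>})"
  by (simp_all add: stalk_def)

lemma module_stalk:
  assumes "module A M" shows "module A (stalk M i)"
proof -
  interpret M: module A M by fact
  have "\<ominus>\<^bsub>M\<^esub> \<zero>\<^bsub>M\<^esub> = \<zero>\<^bsub>M\<^esub>" by (rule M.M.minus_equality) simp_all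
  then have "submodule {\<zero>\<^bsub>M\<^esub>} A M" by (intro M.submoduleI) auto
  then show ?thesis using assms submodule.submodule_is_module by (auto simp: stalk_def)
qed

text \<open>The generators of each stage of the resolution are to be all cycles of the previous
  stage, named by elements of one fixed type. This works because an infinite type has no more finite
  subsets than elements, and a finitely supported function is determined by its finite
  graph.\<close>

lemma finite_support_encoding:
  "\<exists>enc :: (('a \<times> 'b) list \<Rightarrow> 'a) \<Rightarrow> ('a \<times> 'b) list. inj_on enc {F. finite {x. F x \<noteq> z}}"
proof -
  let ?U = "UNIV :: (('a \<times> 'b) list \<times> 'a) set"
  have "infinite ?U" by (simp add: finite_prod infinite_UNIV_listI)
  then obtain g where g: "bij_betw g (Fpow ?U) ?U"
    using eqpoll_Fpow eqpoll_def by blast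
  define graph where "graph F = {(x, F x) | x. F x \<noteq> z}" for F :: "('a \<times> 'b) list \<Rightarrow> 'a"
  \<comment> \<open>Injects pairs into the list type by prepending one entry;
    \<open>undefined\<close> merely fills the component of type \<open>'b\<close>.\<close>
  define c where "c = (\<lambda>(l, a). (a, undefined) # l :: ('a \<times> 'b) list)"
  have fin: "graph F \<in> Fpow ?U" if "finite {x. F x \<noteq> z}" for F
    using that by (auto simp: graph_def Fpow_def)
  have "F = G" if "graph F = graph G" for F G
  proof
    fix x
    have "(x, F x) \<in> graph F \<longleftrightarrow> F x \<noteq> z" "(x, G x) \<in> graph G \<longleftrightarrow> G x \<noteq> z" by (auto simp: graph_def)
    moreover have "y = F x" if "(x, y) \<in> graph F" for y using that by (auto simp: graph_def)
    moreover have "y = G x" if "(x, y) \<in> graph G" for y using that by (auto simp: graph_def)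
    ultimately show "F x = G x" using \<open>graph F = graph G\<close> by metis
  qed
  then have "inj_on (\<lambda>F. c (g (graph F))) {F. finite {x. F x \<noteq> z}}"
    using fin g by (intro inj_onI) (auto simp: c_def bij_betw_def inj_on_def split: prod.splits)
  then show ?thesis by blast
qed

section \<open>The resolution generated by all cycles\<close>

context bool_ext begin

abbreviation "free \<equiv> free_module A"
abbreviation "reg \<equiv> regular_module A"

lemma regular_module_eq: "reg = restrict_scalars (\<lambda>x. x) A"
  by (simp add: regular_module_def)

lemma module_reg: "module A reg"
  unfolding regular_module_def
  by (rule module_restrict_scalars[OF A.is_cring A.is_cring]) (simp add: ring_hom_def)

definition enc :: "(('a \<times> 'b) list \<Rightarrow> 'a) \<Rightarrow> ('a \<times> 'b) list" where
  "enc = (SOME e. inj_on e {F. finite {x. F x \<noteq> \<zero>\<^bsub>A\<^esub>}})"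

definition dec :: "('a \<times> 'b) list \<Rightarrow> ('a \<times> 'b) list \<Rightarrow> 'a" where
  "dec = inv_into {F. finite {x. F x \<noteq> \<zero>\<^bsub>A\<^esub>}} enc"

lemma dec_enc: "F \<in> carrier (free E) \<Longrightarrow> dec (enc F) = F"
  unfolding dec_def enc_def
  by (rule inv_into_f_f[OF someI_ex[OF finite_support_encoding]]) (simp add: free_module_carrier)

definition res_map1 :: "(('a \<times> 'b) list \<Rightarrow> 'a) \<Rightarrow> 'b" where
  "res_map1 = linear_extension A BA (\<lambda>l. snd (hd l))"

text \<open>Stage \<open>k\<close> sits in degree \<open>1 - k\<close>. Its generators are first all
  elements of \<open>B\<close>, then all chains whose value in \<open>B\<close> lies in the image of
  \<open>f\<close>, then all cycles of the preceding stage. The generator \<open>enc z\<close> has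
  differential \<open>z\<close>, which makes exactness immediate.\<close>

fun res_basis :: "nat \<Rightarrow> ('a \<times> 'b) list set" where
  "res_basis 0 = (\<lambda>b. [(\<zero>\<^bsub>A\<^esub>, b)]) ` carrier B"
| "res_basis (Suc 0) = enc ` {z \<in> carrier (free (res_basis 0)). res_map1 z \<in> f ` carrier A}"
| "res_basis (Suc (Suc k)) =
     enc ` {z \<in> carrier (free (res_basis (Suc k))). linear_extension A (free (res_basis k)) dec z = (\<lambda>_. \<zero>\<^bsub>A\<^esub>)}"

definition res_diff :: "nat \<Rightarrow> (('a \<times> 'b) list \<Rightarrow> 'a) \<Rightarrow> ('a \<times> 'b) list \<Rightarrow> 'a" where
  "res_diff k = linear_extension A (free (res_basis k)) dec"

text \<open>The only choice that commutes with the differential of the fiber, since \<open>f\<close>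
  is injective.\<close>

definition res_map0 :: "(('a \<times> 'b) list \<Rightarrow> 'a) \<Rightarrow> 'a" where
  "res_map0 = linear_extension A reg (\<lambda>l. inv_into (carrier A) f (res_map1 (dec l)))"

lemma dec_closed: "dec \<in> res_basis (Suc k) \<rightarrow> carrier (free (res_basis k))"
  by (cases k) (auto simp: dec_enc)

lemma res_diff_linear: "res_diff k \<in> linear_maps A (free (res_basis (Suc k))) (free (res_basis k))"
  unfolding res_diff_def by (rule A.linear_extension_linear[OF A.module_free dec_closed])

lemma res_diff_basis: "x \<in> res_basis (Suc k) \<Longrightarrow> res_diff k (basis_elem A x) = dec x"
  unfolding res_diff_def by (rule A.linear_extension_basis[OF A.module_free dec_closed])

lemma zero_linear: "(\<lambda>_. \<lambda>_. \<zero>\<^bsub>A\<^esub>) \<in> linear_maps A (free E) (free E')"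
  by (rule linear_mapsI) (auto simp: free_module_carrier)

lemma res_diff_diff:
  assumes "F \<in> carrier (free (res_basis (Suc (Suc k))))"
  shows "res_diff k (res_diff (Suc k) F) = (\<lambda>_. \<zero>\<^bsub>A\<^esub>)"
  by (rule A.free_ext[OF A.module_free linear_maps_comp[OF res_diff_linear res_diff_linear] zero_linear _ assms])
    (auto simp: res_diff_basis dec_enc res_diff_def[of k, symmetric])

lemma res_diff_exact:
  assumes "z \<in> carrier (free (res_basis (Suc k)))" "res_diff k z = (\<lambda>_. \<zero>\<^bsub>A\<^esub>)"
  shows "\<exists>F \<in> carrier (free (res_basis (Suc (Suc k)))). res_diff (Suc k) F = z"
proof -
  have "enc z \<in> res_basis (Suc (Suc k))" using assms by (auto simp: res_diff_def)
  then show ?thesis using res_diff_basis dec_enc[OF assms(1)] A.basis_closed by metis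
qed

lemma res_map1_closed: "(\<lambda>l. snd (hd l)) \<in> res_basis 0 \<rightarrow> carrier BA"
  by auto

lemma res_map1_linear: "res_map1 \<in> linear_maps A (free (res_basis 0)) BA"
  unfolding res_map1_def by (rule A.linear_extension_linear[OF module_BA res_map1_closed])

lemma res_map1_surj:
  assumes "b \<in> carrier B"
  shows "\<exists>F \<in> carrier (free (res_basis 0)). res_map1 F = b"
proof -
  have b: "[(\<zero>\<^bsub>A\<^esub>, b)] \<in> res_basis 0" using assms by simp
  have "res_map1 (basis_elem A [(\<zero>\<^bsub>A\<^esub>, b)]) = b"
    unfolding res_map1_def A.linear_extension_basis[OF module_BA res_map1_closed b] by simp
  then show ?thesis using A.basis_closed[OF b] by blast
qed

lemma res_map0_closed:
  "(\<lambda>l. inv_into (carrier A) f (res_map1 (dec l))) \<in> res_basis (Suc 0) \<rightarrow> carrier reg"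
  by (auto simp: dec_enc regular_module_eq inv_into_into)

lemma res_map0_linear: "res_map0 \<in> linear_maps A (free (res_basis (Suc 0))) reg"
  unfolding res_map0_def by (rule A.linear_extension_linear[OF module_reg res_map0_closed])

lemma f_linear: "f \<in> linear_maps A reg BA"
  by (rule linear_mapsI) (simp_all add: regular_module_eq f_closed f_add f_mult)

lemma f_res_map0:
  assumes "F \<in> carrier (free (res_basis (Suc 0)))"
  shows "f (res_map0 F) = res_map1 (res_diff 0 F)"
proof (rule A.free_ext[OF module_BA linear_maps_comp[OF res_map0_linear f_linear]
      linear_maps_comp[OF res_diff_linear res_map1_linear] _ assms])
  fix x assume x: "x \<in> res_basis (Suc 0)"
  then have "res_map1 (dec x) \<in> f ` carrier A" by (auto simp: dec_enc)
  then show "f (res_map0 (basis_elem A x)) = res_map1 (res_diff 0 (basis_elem A x))"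
    unfolding res_map0_def A.linear_extension_basis[OF module_reg res_map0_closed x] res_diff_basis[OF x]
    by (rule f_inv_into_f)
qed

lemma res_diff_exact0:
  assumes "z \<in> carrier (free (res_basis 0))" "res_map1 z \<in> f ` carrier A"
  shows "\<exists>F \<in> carrier (free (res_basis (Suc 0))). res_diff 0 F = z"
proof -
  have "enc z \<in> res_basis (Suc 0)" using assms by auto
  then show ?thesis using res_diff_basis dec_enc[OF assms(1)] A.basis_closed by metis
qed

definition res_E :: "int \<Rightarrow> ('a \<times> 'b) list set" where
  "res_E i = (if i > 1 then {} else res_basis (nat (1 - i)))"

definition res_d :: "int \<Rightarrow> (('a \<times> 'b) list \<Rightarrow> 'a) \<Rightarrow> ('a \<times> 'b) list \<Rightarrow> 'a" where
  "res_d i = (if i \<le> 0 then res_diff (nat (- i)) else (\<lambda>_ _. \<zero>\<^bsub>A\<^esub>))"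

definition res_q :: "int \<Rightarrow> (('a \<times> 'b) list \<Rightarrow> 'a) \<Rightarrow> 'a \<times> 'b" where
  "res_q i F = (if i = 0 then res_map0 F else \<zero>\<^bsub>A\<^esub>, if i = 1 then res_map1 F else \<zero>\<^bsub>B\<^esub>)"

lemma res_E_simps:
  "i \<le> 0 \<Longrightarrow> res_E i = res_basis (Suc (nat (- i)))" "i \<le> 0 \<Longrightarrow> res_E (i + 1) = res_basis (nat (- i))"
  "res_E 1 = res_basis 0" "i > 1 \<Longrightarrow> res_E i = {}"
  by (auto simp: res_E_def nat_add_distrib nat_diff_distrib Suc_nat_eq_nat_zadd1 algebra_simps)

lemma res_complex: "cochain_complex A (\<lambda>i. free (res_E i)) res_d"
  unfolding cochain_complex_def
proof (intro allI conjI ballI A.module_free)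
  fix i :: int
  show "res_d i \<in> linear_maps A (free (res_E i)) (free (res_E (i + 1)))"
    using res_diff_linear zero_linear by (auto simp: res_d_def res_E_simps)
  fix F assume F: "F \<in> carrier (free (res_E i))"
  consider "i \<le> -1" | "i = 0" | "i > 0" by linarith
  then show "res_d (i + 1) (res_d i F) = \<zero>\<^bsub>free (res_E (i + 2))\<^esub>"
  proof cases
    case 1
    then have "nat (- i) = Suc (nat (- (i + 1)))" by simp
    then show ?thesis
      using 1 F res_diff_diff[of F "nat (- (i + 1))"] by (simp add: res_d_def res_E_simps)
  qed (simp_all add: res_d_def)
qed

lemma module_ring_fiber: "module A (ring_fiber A B f i)"
  unfolding ring_fiber_def fiber_def
  by (intro module_direct_sum module_stalk module_reg module_BA)

lemma ring_fiber_carrier: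
  "carrier (ring_fiber A B f i) = (if i = 0 then carrier A else {\<zero>\<^bsub>A\<^esub>}) \<times> (if i = 1 then carrier B else {\<zero>\<^bsub>B\<^esub>})"
  by (auto simp: ring_fiber_def fiber_def regular_module_eq)

lemma ring_fiber_simps:
  "\<zero>\<^bsub>ring_fiber A B f i\<^esub> = (\<zero>\<^bsub>A\<^esub>, \<zero>\<^bsub>B\<^esub>)"
  "(x, y) \<oplus>\<^bsub>ring_fiber A B f i\<^esub> (x', y') = (x \<oplus>\<^bsub>A\<^esub> x', y \<oplus>\<^bsub>B\<^esub> y')"
  "r \<odot>\<^bsub>ring_fiber A B f i\<^esub> (x, y) = (r \<otimes>\<^bsub>A\<^esub> x, f r \<otimes>\<^bsub>B\<^esub> y)"
  by (simp_all add: ring_fiber_def fiber_def regular_module_eq)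

lemma ring_fiber_diff_eq:
  assumes "(x, y) \<in> carrier (ring_fiber A B f i)"
  shows "ring_fiber_diff A B f i (x, y) = (\<zero>\<^bsub>A\<^esub>, f x)"
proof -
  interpret S: module A "stalk BA i" by (rule module_stalk[OF module_BA])
  have "\<ominus>\<^bsub>stalk BA i\<^esub> \<zero>\<^bsub>B\<^esub> = \<zero>\<^bsub>B\<^esub>"
    using S.M.minus_equality[of "\<zero>\<^bsub>B\<^esub>" "\<zero>\<^bsub>B\<^esub>"] by simp
  moreover have "f x \<in> carrier B" using assms f_closed by (auto simp: ring_fiber_carrier split: if_splits)
  ultimately show ?thesis
    by (simp add: ring_fiber_diff_def fiber_diff_def stalk_diff_def a_minus_def regular_module_eq)
qed

lemma ring_fiber_diff_linear:
  "ring_fiber_diff A B f i \<in> linear_maps A (ring_fiber A B f i) (ring_fiber A B f (i + 1))"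
proof -
  interpret F: module A "ring_fiber A B f i" by (rule module_ring_fiber)
  show ?thesis
  proof (rule linear_mapsI)
    fix z assume z: "z \<in> carrier (ring_fiber A B f i)"
    then show "ring_fiber_diff A B f i z \<in> carrier (ring_fiber A B f (i + 1))"
      by (cases z) (auto simp: ring_fiber_diff_eq, auto simp: ring_fiber_carrier f_zero f_closed split: if_splits)
    fix r assume "r \<in> carrier A"
    then show "ring_fiber_diff A B f i (r \<odot>\<^bsub>ring_fiber A B f i\<^esub> z) =
        r \<odot>\<^bsub>ring_fiber A B f (i + 1)\<^esub> ring_fiber_diff A B f i z"
      using z F.smult_closed[of r z]
      by (cases z) (auto simp: ring_fiber_diff_eq ring_fiber_simps, auto simp: ring_fiber_carrier f_mult f_zero f_closed split: if_splits)
  next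
    fix z z' assume z: "z \<in> carrier (ring_fiber A B f i)" "z' \<in> carrier (ring_fiber A B f i)"
    then show "ring_fiber_diff A B f i (z \<oplus>\<^bsub>ring_fiber A B f i\<^esub> z') =
        ring_fiber_diff A B f i z \<oplus>\<^bsub>ring_fiber A B f (i + 1)\<^esub> ring_fiber_diff A B f i z'"
      using F.M.a_closed[of z z']
      by (cases z; cases z') (auto simp: ring_fiber_diff_eq ring_fiber_simps, auto simp: ring_fiber_carrier f_add f_zero split: if_splits)
  qed
qed

lemma res_q_map: "cochain_map A (\<lambda>i. free (res_E i)) res_d (ring_fiber A B f) (ring_fiber_diff A B f) res_q"
  unfolding cochain_map_def
proof (intro allI conjI ballI)
  fix i
  have 0: "res_map0 \<in> linear_maps A (free (res_E 0)) reg" using res_map0_linear by (simp add: res_E_simps)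
  have 1: "res_map1 \<in> linear_maps A (free (res_E 1)) BA" using res_map1_linear by (simp add: res_E_simps)
  show ql: "res_q i \<in> linear_maps A (free (res_E i)) (ring_fiber A B f i)"
    by (rule linear_mapsI)
      (auto simp: res_q_def ring_fiber_carrier ring_fiber_simps f_closed
        linear_mapsD[OF 0, unfolded regular_module_eq restrict_scalars_simps]
        linear_mapsD[OF 1, unfolded restrict_scalars_simps] simp del: free_module_simps)
  fix F assume F: "F \<in> carrier (free (res_E i))"
  have "ring_fiber_diff A B f i (res_q i F) = (\<zero>\<^bsub>A\<^esub>, f (if i = 0 then res_map0 F else \<zero>\<^bsub>A\<^esub>))"
    using linear_mapsD(1)[OF ql F] by (simp add: res_q_def ring_fiber_diff_eq)
  moreover have "res_q (i + 1) (res_d i F) = (\<zero>\<^bsub>A\<^esub>, f (if i = 0 then res_map0 F else \<zero>\<^bsub>A\<^esub>))"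
  proof -
    \<comment> \<open>Tested after applying the injective \<open>f\<close>, which turns
      \<open>res_map0\<close> into \<open>res_map1\<close> of a differential, here of a double
      differential.\<close>
    have "res_map0 (res_d (- 1) F) = \<zero>\<^bsub>A\<^esub>" if "i = -1"
    proof -
      have F': "F \<in> carrier (free (res_basis (Suc (Suc 0))))" using F that by (simp add: res_E_simps)
      then have F'': "res_diff (Suc 0) F \<in> carrier (free (res_basis (Suc 0)))"
        by (rule linear_mapsD(1)[OF res_diff_linear])
      have "f (res_map0 (res_diff (Suc 0) F)) = res_map1 (\<lambda>_. \<zero>\<^bsub>A\<^esub>)"
        using f_res_map0[OF F''] res_diff_diff[OF F'] by simp
      also have "\<dots> = f \<zero>\<^bsub>A\<^esub>"
        using linear_maps_zero[OF A.module_free module_BA res_map1_linear] by (simp add: f_zero)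
      finally show ?thesis
        using linear_mapsD(1)[OF res_map0_linear F''] f_eq by (simp add: res_d_def regular_module_eq)
    qed
    moreover have "f (res_map0 F) = res_map1 (res_d 0 F)" if "i = 0"
      using F that f_res_map0[of F] by (simp add: res_d_def res_E_simps del: res_basis.simps)
    ultimately show ?thesis
      by (cases "i = -1"; cases "i = 0") (simp_all add: res_q_def f_zero)
  qed
  ultimately show "res_q (i + 1) (res_d i F) = ring_fiber_diff A B f i (res_q i F)" by simp
qed

lemma res_exact:
  assumes "i \<le> 0" "z \<in> carrier (free (res_E i))" "res_d i z = (\<lambda>_. \<zero>\<^bsub>A\<^esub>)"
  shows "\<exists>F \<in> carrier (free (res_E (i - 1))). res_d (i - 1) F = z"
proof -
  have "nat (- (i - 1)) = Suc (nat (- i))" using assms(1) by simp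
  then show ?thesis
    using assms res_diff_exact[of z "nat (- i)"] by (simp add: res_E_simps res_d_def)
qed

lemma res_exact1:
  assumes "z \<in> carrier (free (res_E 1))" "res_map1 z \<in> f ` carrier A"
  shows "\<exists>F \<in> carrier (free (res_E 0)). res_d 0 F = z"
  using res_diff_exact0 assms by (simp add: res_E_simps res_d_def del: res_basis.simps)

lemma zero_in_free: "(\<lambda>_. \<zero>\<^bsub>A\<^esub>) \<in> carrier (free E)"
  by (simp add: free_module_carrier)

text \<open>As \<open>f\<close> is injective, the fiber has cohomology only in degree 1, namely
  \<open>B\<close> modulo the image of \<open>f\<close>. In lower degrees exactness of the
  resolution is all that is required, and in degree 1 the boundaries are exactly the chains whose
  value lies in that image.\<close>

lemma res_resolution: "free_resolution A res_E res_d (ring_fiber A B f) (ring_fiber_diff A B f) res_q"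
  unfolding free_resolution_def
proof (intro conjI res_complex quasi_isomorphismI module_ring_fiber ring_fiber_diff_linear res_q_map)
  show "\<exists>N. \<forall>i>N. res_E i = {}" by (auto simp: res_E_def)
next
  fix i z assume z: "z \<in> cocycles (\<lambda>i. free (res_E i)) res_d i"
  let ?F = "ring_fiber A B f" and ?d = "ring_fiber_diff A B f"
  have c: "z \<in> carrier (free (res_E i))" "res_d i z = (\<lambda>_. \<zero>\<^bsub>A\<^esub>)" using z by (auto simp: cocycles_def)
  have q: "res_q i \<in> linear_maps A (free (res_E i)) (?F i)" "res_q (i + 1) (res_d i z) = ?d i (res_q i z)"
    and ql: "res_q (i + 1) \<in> linear_maps A (free (res_E (i + 1))) (?F (i + 1))"
    using res_q_map c(1) by (auto simp: cochain_map_def)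
  show "res_q i z \<in> cocycles ?F ?d i"
    using linear_mapsD(1)[OF q(1) c(1)] q(2) linear_maps_zero[OF A.module_free module_ring_fiber ql] c(2)
    by (simp add: cocycles_def)
  assume b: "res_q i z \<in> coboundaries ?F ?d i"
  consider "i \<le> 0" | "i = 1" | "i > 1" by linarith
  then have "\<exists>F \<in> carrier (free (res_E (i - 1))). res_d (i - 1) F = z"
  proof cases
    case 1
    then show ?thesis by (rule res_exact[OF _ c])
  next
    case 2
    then obtain y where y: "y \<in> carrier (?F 0)" "res_q 1 z = ?d 0 y" using b by (auto simp: coboundaries_def)
    then obtain a where a: "y = (a, \<zero>\<^bsub>B\<^esub>)" "a \<in> carrier A" by (auto simp: ring_fiber_carrier)
    then have "res_map1 z = f a" using y by (simp add: ring_fiber_diff_eq res_q_def)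
    then show ?thesis using res_exact1[of z] c(1) a(2) 2 by simp
  next
    case 3
    then have "z = (\<lambda>_. \<zero>\<^bsub>A\<^esub>)" using c(1) by (auto simp: res_E_simps free_module_carrier)
    moreover have "res_d (i - 1) (\<lambda>_. \<zero>\<^bsub>A\<^esub>) = (\<lambda>_. \<zero>\<^bsub>A\<^esub>)" using 3 by (simp add: res_d_def)
    ultimately show ?thesis using zero_in_free by blast
  qed
  then show "z \<in> coboundaries (\<lambda>i. free (res_E i)) res_d i" by (auto simp: coboundaries_def)
next
  fix i z' assume z': "z' \<in> cocycles (ring_fiber A B f) (ring_fiber_diff A B f) i"
  let ?F = "ring_fiber A B f" and ?d = "ring_fiber_diff A B f"
  obtain a b where ab: "z' = (a, b)" "(a, b) \<in> carrier (?F i)" "f a = \<zero>\<^bsub>B\<^esub>"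
    using z' by (cases z') (auto simp: cocycles_def ring_fiber_diff_eq ring_fiber_simps)
  have "a \<in> carrier A" "b \<in> carrier B" using ab(2) by (auto simp: ring_fiber_carrier split: if_splits)
  \<comment> \<open>Injectivity of \<open>f\<close> leaves no cocycles in degree 0 other than
    0.\<close>
  then have a: "a = \<zero>\<^bsub>A\<^esub>" using ab(3) f_eq[of a "\<zero>\<^bsub>A\<^esub>"] by (simp add: f_zero)
  have y: "(\<zero>\<^bsub>A\<^esub>, \<zero>\<^bsub>B\<^esub>) \<in> carrier (?F (i - 1))" by (auto simp: ring_fiber_carrier)
  have "\<exists>z \<in> cocycles (\<lambda>i. free (res_E i)) res_d i. z' = res_q i z"
  proof (cases "i = 1")
    case True
    obtain F where "F \<in> carrier (free (res_E 1))" "res_map1 F = b"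
      using res_map1_surj[OF \<open>b \<in> carrier B\<close>] by (auto simp: res_E_simps)
    then show ?thesis using True ab a by (auto simp: cocycles_def res_d_def res_q_def intro!: bexI[of _ F])
  next
    case False
    have d: "res_d i \<in> linear_maps A (free (res_E i)) (free (res_E (i + 1)))"
      using res_complex by (auto simp: cochain_complex_def)
    have q: "res_q i \<in> linear_maps A (free (res_E i)) (?F i)"
      using res_q_map by (auto simp: cochain_map_def)
    have "(\<lambda>_. \<zero>\<^bsub>A\<^esub>) \<in> cocycles (\<lambda>i. free (res_E i)) res_d i"
      using linear_maps_zero[OF A.module_free A.module_free d] zero_in_free by (simp add: cocycles_def)
    moreover have "z' = res_q i (\<lambda>_. \<zero>\<^bsub>A\<^esub>)"
      using linear_maps_zero[OF A.module_free module_ring_fiber q] ab a False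
      by (simp add: ring_fiber_simps ring_fiber_carrier)
    ultimately show ?thesis by blast
  qed
  moreover have "?d (i - 1) (\<zero>\<^bsub>A\<^esub>, \<zero>\<^bsub>B\<^esub>) = (\<zero>\<^bsub>A\<^esub>, \<zero>\<^bsub>B\<^esub>)"
    using y by (simp add: ring_fiber_diff_eq f_zero)
  moreover have "z' = z' \<oplus>\<^bsub>?F i\<^esub> (\<zero>\<^bsub>A\<^esub>, \<zero>\<^bsub>B\<^esub>)"
    using ab(1) \<open>a \<in> carrier A\<close> \<open>b \<in> carrier B\<close> by (simp add: ring_fiber_simps)
  ultimately show "\<exists>z \<in> cocycles (\<lambda>i. free (res_E i)) res_d i. \<exists>y \<in> carrier (?F (i - 1)).
      z' = res_q i z \<oplus>\<^bsub>?F i\<^esub> ?d (i - 1) y"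
    using y by metis
qed

end

section \<open>Tensor powers of complexes\<close>

definition (in base_ring) tensor_value :: "(int \<Rightarrow> 'm \<Rightarrow> 'a) \<Rightarrow> (int \<times> 'm) list \<Rightarrow> 'a" where
  "tensor_value \<epsilon> t = foldr (\<lambda>(i, x) r. \<epsilon> i x \<otimes> r) t \<one>"

definition tensor_step :: "(int \<Rightarrow> 'm \<Rightarrow> 'm) \<Rightarrow> (int \<times> 'm) list \<Rightarrow> nat \<Rightarrow> (int \<times> 'm) list" where
  "tensor_step d t j = t[j := (fst (t ! j) + 1, d (fst (t ! j)) (snd (t ! j)))]"

lemma tensor_step_middle:
  "tensor_step d (us @ (i, x) # vs) (length us) = us @ (i + 1, d i x) # vs"
  by (simp add: tensor_step_def)

text \<open>A step at another position does not touch the entry \<open>z\<close>, so the term stays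
  additive and homogeneous in \<open>z\<close>.\<close>

lemma tensor_step_other:
  assumes "j \<noteq> length us" "j < Suc (length us + length vs)"
  shows "\<exists>us' vs'. \<forall>z. tensor_step d (us @ z # vs) j = us' @ z # vs'"
proof (cases "j < length us")
  case True
  then show ?thesis
    by (intro exI[of _ "tensor_step d us j"] exI[of _ vs])
      (simp add: tensor_step_def nth_append list_update_append)
next
  case False
  then obtain l where "j = length us + Suc l" using assms(1) by (metis less_imp_Suc_add linorder_neqE_nat add_Suc_right)
  then show ?thesis
    by (intro exI[of _ us] exI[of _ "tensor_step d vs l"])
      (simp add: tensor_step_def nth_append list_update_append)
qed

lemma tensor_power_gens_iff:
  "us @ (i, x) # vs \<in> tensor_power_gens C n k \<longleftrightarrow>
     Suc (length us + length vs) = n \<and> x \<in> carrier (C i) \<and>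
     (\<forall>(j, y) \<in> set us \<union> set vs. y \<in> carrier (C j)) \<and>
     sum_list (map fst us) + i + sum_list (map fst vs) = k"
  by (auto simp: tensor_power_gens_def)

locale bool_complex = bool_ring R for R :: "'a ring" (structure) +
  fixes C :: "int \<Rightarrow> ('a, 'm) module" and d :: "int \<Rightarrow> 'm \<Rightarrow> 'm"
  assumes complex: "cochain_complex R C d"
begin

lemma C_module: "module R (C i)"
  using complex by (auto simp: cochain_complex_def)

lemma d_linear: "d i \<in> linear_maps R (C i) (C (i + 1))"
  using complex by (auto simp: cochain_complex_def)

abbreviation "G \<equiv> tensor_power_gens C"
abbreviation "T \<equiv> tensor_power R C"
abbreviation "tel \<equiv> tensor_power_elem R C"

lemma gens_step:
  assumes "t \<in> G n k" "j < n"
  shows "tensor_step d t j \<in> G n (k + 1)"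
proof -
  obtain us i x vs where t: "t = us @ (i, x) # vs" "length us = j"
    using assms id_take_nth_drop[of j t] by (cases "t ! j") (auto simp: tensor_power_gens_def)
  then show ?thesis
    using assms(1) linear_mapsD(1)[OF d_linear]
    by (auto simp: tensor_step_middle[of d us, unfolded t(2)] tensor_power_gens_iff)
qed

lemma gens_add:
  assumes "us @ (i, x) # vs \<in> G n k" "us @ (i, y) # vs \<in> G n k"
  shows "us @ (i, x \<oplus>\<^bsub>C i\<^esub> y) # vs \<in> G n k"
proof -
  interpret M: module R "C i" by (rule C_module)
  show ?thesis using assms by (auto simp: tensor_power_gens_iff)
qed

lemma gens_smult:
  assumes "us @ (i, x) # vs \<in> G n k" "r \<in> carrier R"
  shows "us @ (i, r \<odot>\<^bsub>C i\<^esub> x) # vs \<in> G n k"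
proof -
  interpret M: module R "C i" by (rule C_module)
  show ?thesis using assms by (auto simp: tensor_power_gens_iff)
qed

lemma presentation_tensor_power: "presentation R (G n k) (tensor_power_rels R C n k)"
proof
  interpret F: module R "free_module R (G n k)" by (rule module_free)
  show "tensor_power_rels R C n k \<subseteq> carrier (free_module R (G n k))"
    unfolding tensor_power_rels_def Let_def
    by (auto intro!: F.M.minus_closed F.M.a_closed F.smult_closed basis_closed gens_add gens_smult
        simp del: free_module_simps)
qed

context
  fixes n :: nat and k :: int
begin

interpretation P: presentation R "G n k" "tensor_power_rels R C n k"
  by (rule presentation_tensor_power)

lemma module_tensor_power: "module R (T n k)"
  unfolding tensor_power_def by (rule P.module_presented)

lemma tel_closed: "t \<in> G n k \<Longrightarrow> tel n k t \<in> carrier (T n k)"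
  unfolding tensor_power_def tensor_power_elem_def by (rule P.presented_gen_closed)

lemma tel_proj: "tel n k t = P.proj (basis_elem R t)"
  by (simp add: tensor_power_elem_def P.proj_basis)

lemmas PD = linear_mapsD[OF P.proj_linear, folded tensor_power_def]

lemma tel_add:
  assumes "us @ (i, x) # vs \<in> G n k" "us @ (i, y) # vs \<in> G n k"
  shows "tel n k (us @ (i, x \<oplus>\<^bsub>C i\<^esub> y) # vs) = tel n k (us @ (i, x) # vs) \<oplus>\<^bsub>T n k\<^esub> tel n k (us @ (i, y) # vs)"
proof -
  have "P.proj (basis_elem R (us @ (i, x \<oplus>\<^bsub>C i\<^esub> y) # vs)) =
      P.proj (basis_elem R (us @ (i, x) # vs) \<oplus>\<^bsub>free_module R (G n k)\<^esub> basis_elem R (us @ (i, y) # vs))"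
  proof (rule P.proj_rel_minus)
    show "basis_elem R (us @ (i, x \<oplus>\<^bsub>C i\<^esub> y) # vs) \<ominus>\<^bsub>free_module R (G n k)\<^esub>
      (basis_elem R (us @ (i, x) # vs) \<oplus>\<^bsub>free_module R (G n k)\<^esub> basis_elem R (us @ (i, y) # vs))
      \<in> tensor_power_rels R C n k"
      using assms unfolding tensor_power_rels_def Let_def by blast
  qed (intro P.quot.M.a_closed basis_closed assms gens_add)+
  then show ?thesis
    using assms by (simp add: tel_proj PD basis_closed del: free_module_simps)
qed

lemma tel_smult:
  assumes "us @ (i, x) # vs \<in> G n k" "r \<in> carrier R"
  shows "tel n k (us @ (i, r \<odot>\<^bsub>C i\<^esub> x) # vs) = r \<odot>\<^bsub>T n k\<^esub> tel n k (us @ (i, x) # vs)"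
proof -
  have "P.proj (basis_elem R (us @ (i, r \<odot>\<^bsub>C i\<^esub> x) # vs)) =
      P.proj (r \<odot>\<^bsub>free_module R (G n k)\<^esub> basis_elem R (us @ (i, x) # vs))"
  proof (rule P.proj_rel_minus)
    show "basis_elem R (us @ (i, r \<odot>\<^bsub>C i\<^esub> x) # vs) \<ominus>\<^bsub>free_module R (G n k)\<^esub>
      (r \<odot>\<^bsub>free_module R (G n k)\<^esub> basis_elem R (us @ (i, x) # vs)) \<in> tensor_power_rels R C n k"
      using assms unfolding tensor_power_rels_def Let_def by blast
  qed (intro P.quot.smult_closed basis_closed assms gens_smult)+
  then show ?thesis
    using assms by (simp add: tel_proj PD basis_closed del: free_module_simps)
qed

context
  fixes N :: "('a, 'n) module" and \<phi> :: "(int \<times> 'm) list \<Rightarrow> 'n"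
  assumes N: "module R N" and closed: "\<And>t. t \<in> G n k \<Longrightarrow> \<phi> t \<in> carrier N"
    and add: "\<And>us i x y vs. us @ (i, x) # vs \<in> G n k \<Longrightarrow> us @ (i, y) # vs \<in> G n k \<Longrightarrow>
      \<phi> (us @ (i, x \<oplus>\<^bsub>C i\<^esub> y) # vs) = \<phi> (us @ (i, x) # vs) \<oplus>\<^bsub>N\<^esub> \<phi> (us @ (i, y) # vs)"
    and smult: "\<And>us i x vs r. us @ (i, x) # vs \<in> G n k \<Longrightarrow> r \<in> carrier R \<Longrightarrow>
      \<phi> (us @ (i, r \<odot>\<^bsub>C i\<^esub> x) # vs) = r \<odot>\<^bsub>N\<^esub> \<phi> (us @ (i, x) # vs)"
begin

interpretation N: module R N by (rule N)

lemma multilinear_map_gen: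
  assumes "t \<in> G n k"
  shows "presented_map R N \<phi> (tel n k t) = \<phi> t"
  unfolding tensor_power_elem_def
proof (rule P.presented_map_gen[OF N _ _ assms])
  show cl: "\<phi> \<in> G n k \<rightarrow> carrier N" using closed by blast
  note L = linear_extension_linear[OF N cl]
  note b = linear_extension_basis[OF N cl]
  fix F assume "F \<in> tensor_power_rels R C n k"
  then show "linear_extension R N \<phi> F = \<zero>\<^bsub>N\<^esub>"
    unfolding tensor_power_rels_def Let_def
    by (elim UnE CollectE exE conjE; simp add: linear_maps_minus[OF module_free N L] linear_mapsD[OF L] b
        basis_closed gens_add gens_smult closed add smult N.M.minus_eq N.M.r_neg del: free_module_simps)
qed

end

end

text \<open>The Koszul signs disappear because negation is the identity on modules over a Boolean
  ring. What has to be checked is that the unsigned sum respects the relations of the tensor power,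
  term by term.\<close>

lemma tensor_power_diff_elem:
  assumes "t \<in> G n k"
  shows "tensor_power_diff R C d n k (tel n k t) =
    finsum (T n (k + 1)) (\<lambda>j. tel n (k + 1) (tensor_step d t j)) {..<n}"
proof -
  interpret T: module R "T n (k + 1)" by (rule module_tensor_power)
  let ?c = "\<lambda>t j. tel n (k + 1) (tensor_step d t j)"
  let ?\<psi> = "\<lambda>t. finsum (T n (k + 1)) (\<lambda>j. let (i, x) = t ! j;
             c = tensor_power_elem R C n (k + 1) (t[j := (i + 1, d i x)])
         in if even (sum_list (map fst (take j t))) then c else \<ominus>\<^bsub>T n (k + 1)\<^esub> c) {..<n}"
  have cc: "t \<in> G n k \<Longrightarrow> j < n \<Longrightarrow> ?c t j \<in> carrier (T n (k + 1))" for t j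
    by (intro tel_closed gens_step)
  have sign: "?\<psi> t = finsum (T n (k + 1)) (?c t) {..<n}" if "t \<in> G n k" for t
    using cc[OF that] module_uminus[OF T.module_axioms cc[OF that]]
    by (intro T.M.finsum_cong') (auto simp: Let_def case_prod_beta tensor_step_def)
  have sc: "?\<psi> t \<in> carrier (T n (k + 1))" if "t \<in> G n k" for t
    unfolding sign[OF that] using cc[OF that] by (intro T.M.finsum_closed) auto
  have "presented_map R (T n (k + 1)) ?\<psi> (tel n k t) = ?\<psi> t"
  proof (rule multilinear_map_gen[OF T.module_axioms sc _ _ assms])
    fix us i x y vs
    assume x: "us @ (i, x) # vs \<in> G n k" and y: "us @ (i, y) # vs \<in> G n k"
    note xy = gens_add[OF x y]
    have n: "Suc (length us + length vs) = n" and xi: "x \<in> carrier (C i)" "y \<in> carrier (C i)"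
      using x y by (auto simp: tensor_power_gens_iff)
    have "?c (us @ (i, x \<oplus>\<^bsub>C i\<^esub> y) # vs) j = ?c (us @ (i, x) # vs) j \<oplus>\<^bsub>T n (k + 1)\<^esub> ?c (us @ (i, y) # vs) j"
      if j: "j < n" for j
    \<comment> \<open>Either the differential hits the varied entry and its own linearity is used,
      or it hits another entry and the varied one is left as it is.\<close>
    proof (cases "j = length us")
      case True
      then show ?thesis
        using tel_add[of us "i + 1" "d i x" vs n "k + 1" "d i y"] gens_step[OF x j] gens_step[OF y j] xi
        by (simp add: tensor_step_middle linear_mapsD[OF d_linear])
    next
      case False
      then obtain us' vs' where "\<And>z. tensor_step d (us @ z # vs) j = us' @ z # vs'"
        using tensor_step_other[of j us vs d] j n by blast
      then show ?thesis
        using gens_step[OF x j] gens_step[OF y j] tel_add[of us' i x vs' n "k + 1" y] by simp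
    qed
    then have "finsum (T n (k + 1)) (?c (us @ (i, x \<oplus>\<^bsub>C i\<^esub> y) # vs)) {..<n} =
      finsum (T n (k + 1)) (\<lambda>j. ?c (us @ (i, x) # vs) j \<oplus>\<^bsub>T n (k + 1)\<^esub> ?c (us @ (i, y) # vs) j) {..<n}"
      using cc[OF x] cc[OF y] by (intro T.M.finsum_cong') auto
    also have "\<dots> = finsum (T n (k + 1)) (?c (us @ (i, x) # vs)) {..<n} \<oplus>\<^bsub>T n (k + 1)\<^esub>
        finsum (T n (k + 1)) (?c (us @ (i, y) # vs)) {..<n}"
      using cc[OF x] cc[OF y] by (intro T.M.finsum_addf) auto
    finally show "?\<psi> (us @ (i, x \<oplus>\<^bsub>C i\<^esub> y) # vs) = ?\<psi> (us @ (i, x) # vs) \<oplus>\<^bsub>T n (k + 1)\<^esub> ?\<psi> (us @ (i, y) # vs)"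
      unfolding sign[OF x] sign[OF y] sign[OF xy] .
  next
    fix us i x vs r
    assume x: "us @ (i, x) # vs \<in> G n k" and r: "r \<in> carrier R"
    note rx = gens_smult[OF x r]
    have n: "Suc (length us + length vs) = n" and xi: "x \<in> carrier (C i)"
      using x by (auto simp: tensor_power_gens_iff)
    have "?c (us @ (i, r \<odot>\<^bsub>C i\<^esub> x) # vs) j = r \<odot>\<^bsub>T n (k + 1)\<^esub> ?c (us @ (i, x) # vs) j"
      if j: "j < n" for j
    proof (cases "j = length us")
      case True
      then show ?thesis
        using tel_smult[of us "i + 1" "d i x" vs n "k + 1" r] gens_step[OF x j] xi r
        by (simp add: tensor_step_middle linear_mapsD[OF d_linear])
    next
      case False
      then obtain us' vs' where "\<And>z. tensor_step d (us @ z # vs) j = us' @ z # vs'"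
        using tensor_step_other[of j us vs d] j n by blast
      then show ?thesis
        using gens_step[OF x j] tel_smult[of us' i x vs' n "k + 1" r] r by simp
    qed
    then have "finsum (T n (k + 1)) (?c (us @ (i, r \<odot>\<^bsub>C i\<^esub> x) # vs)) {..<n} =
      finsum (T n (k + 1)) (\<lambda>j. r \<odot>\<^bsub>T n (k + 1)\<^esub> ?c (us @ (i, x) # vs) j) {..<n}"
      using cc[OF x] r by (intro T.M.finsum_cong') auto
    also have "\<dots> = r \<odot>\<^bsub>T n (k + 1)\<^esub> finsum (T n (k + 1)) (?c (us @ (i, x) # vs)) {..<n}"
      using cc[OF x] r by (intro T.finsum_smult_ldistr[symmetric]) auto
    finally show "?\<psi> (us @ (i, r \<odot>\<^bsub>C i\<^esub> x) # vs) = r \<odot>\<^bsub>T n (k + 1)\<^esub> ?\<psi> (us @ (i, x) # vs)"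
      unfolding sign[OF x] sign[OF rx] .
  qed
  from trans[OF this sign[OF assms]] show ?thesis
    unfolding tensor_power_diff_def Let_def .
qed

lemma tensor_power_to_base_elem:
  assumes \<epsilon>: "\<And>i. \<epsilon> i \<in> linear_maps R (C i) (regular_module R)" and t: "t \<in> G n k"
  shows "tensor_power_to_base R \<epsilon> (tel n k t) = tensor_value \<epsilon> t"
proof -
  have reg: "regular_module R = restrict_scalars (\<lambda>x. x) R" by (simp add: regular_module_def)
  note e = linear_mapsD[OF \<epsilon>, unfolded reg restrict_scalars_simps]
  have cl: "\<forall>(j, y) \<in> set t. y \<in> carrier (C j) \<Longrightarrow> tensor_value \<epsilon> t \<in> carrier R" for t
    by (induction t) (auto simp: tensor_value_def e)
  have app: "tensor_value \<epsilon> (us @ (i, x) # vs) = tensor_value \<epsilon> us \<otimes> (\<epsilon> i x \<otimes> tensor_value \<epsilon> vs)"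
    if "us @ (i, x) # vs \<in> G n k" for us i x vs
  proof -
    have c: "x \<in> carrier (C i)" "tensor_value \<epsilon> vs \<in> carrier R" and us: "\<forall>(j, y) \<in> set us. y \<in> carrier (C j)"
      using that cl[of vs] by (auto simp: tensor_power_gens_iff)
    show ?thesis using us
    proof (induction us)
      case Nil
      then show ?case using c e by (simp add: tensor_value_def)
    next
      case (Cons z us)
      then show ?case using c e cl[of us] by (auto simp: tensor_value_def m_assoc)
    qed
  qed
  have c: "x \<in> carrier (C i) \<and> tensor_value \<epsilon> us \<in> carrier R \<and> tensor_value \<epsilon> vs \<in> carrier R"
    if "us @ (i, x) # vs \<in> G n k" for us i x vs
    using that cl[of us] cl[of vs] by (auto simp: tensor_power_gens_iff)
  have "module R (regular_module R)"
    unfolding reg by (rule module_restrict_scalars[OF is_cring is_cring]) (simp add: ring_hom_def)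
  then have "presented_map R (regular_module R) (tensor_value \<epsilon>) (tel n k t) = tensor_value \<epsilon> t"
  proof (rule multilinear_map_gen[OF _ _ _ _ t])
    show "t \<in> G n k \<Longrightarrow> tensor_value \<epsilon> t \<in> carrier (regular_module R)" for t
      using cl[of t] by (auto simp: tensor_power_gens_def reg)
  next
    fix us i x y vs
    assume x: "us @ (i, x) # vs \<in> G n k" and y: "us @ (i, y) # vs \<in> G n k"
    show "tensor_value \<epsilon> (us @ (i, x \<oplus>\<^bsub>C i\<^esub> y) # vs) =
      tensor_value \<epsilon> (us @ (i, x) # vs) \<oplus>\<^bsub>regular_module R\<^esub> tensor_value \<epsilon> (us @ (i, y) # vs)"
      using c[OF x] c[OF y] app[OF x] app[OF y] app[OF gens_add[OF x y]] by (simp add: reg e l_distr r_distr)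
  next
    fix us i x vs r
    assume x: "us @ (i, x) # vs \<in> G n k" and r: "r \<in> carrier R"
    show "tensor_value \<epsilon> (us @ (i, r \<odot>\<^bsub>C i\<^esub> x) # vs) =
      r \<odot>\<^bsub>regular_module R\<^esub> tensor_value \<epsilon> (us @ (i, x) # vs)"
      using c[OF x] r app[OF x] app[OF gens_smult[OF x r]] by (simp add: reg e m_ac)
  qed
  then show ?thesis
    by (simp add: tensor_power_to_base_def tensor_value_def[abs_def])
qed

end

section \<open>The null homotopy as a functional on pure tensors\<close>

context bool_ext begin

abbreviation "P \<equiv> \<lambda>i. free (res_E i)"

sublocale res: bool_complex A P res_d
  by unfold_locales (rule res_complex)

definition res_eps :: "int \<Rightarrow> (('a \<times> 'b) list \<Rightarrow> 'a) \<Rightarrow> 'a" where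
  "res_eps i x = fst (res_q i x)"

lemma res_eps_linear: "res_eps i \<in> linear_maps A (P i) reg"
proof -
  have q: "res_q i \<in> linear_maps A (P i) (ring_fiber A B f i)"
    using res_q_map by (auto simp: cochain_map_def)
  show ?thesis
  proof (rule linear_mapsI)
    fix x assume x: "x \<in> carrier (P i)"
    then show "res_eps i x \<in> carrier reg"
      using linear_mapsD(1)[OF q x]
      by (cases "res_q i x") (auto simp: res_eps_def ring_fiber_carrier regular_module_eq split: if_splits)
    fix r assume "r \<in> carrier A"
    then show "res_eps i (r \<odot>\<^bsub>P i\<^esub> x) = r \<odot>\<^bsub>reg\<^esub> res_eps i x"
      using linear_mapsD(3)[OF q _ x]
      by (cases "res_q i x") (simp add: res_eps_def ring_fiber_simps regular_module_eq)
  next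
    fix x y assume "x \<in> carrier (P i)" "y \<in> carrier (P i)"
    then show "res_eps i (x \<oplus>\<^bsub>P i\<^esub> y) = res_eps i x \<oplus>\<^bsub>reg\<^esub> res_eps i y"
      using linear_mapsD(2)[OF q]
      by (cases "res_q i x"; cases "res_q i y") (simp add: res_eps_def ring_fiber_simps regular_module_eq)
  qed
qed

text \<open>\<open>H\<close> is the component of the homotopy that leaves degree 1. The target is
  concentrated in degree 0, so the other term of the homotopy equation is 0 and the equation says
  that \<open>H\<close> of the differential is the map to the base.\<close>

lemma descendable_functional:
  assumes "descendable_index_le A B f n"
  obtains H where
    "\<And>t. t \<in> res.G n 1 \<Longrightarrow> H t \<in> carrier A"
    "\<And>us i x y vs. us @ (i, x) # vs \<in> res.G n 1 \<Longrightarrow> us @ (i, y) # vs \<in> res.G n 1 \<Longrightarrow>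
       H (us @ (i, x \<oplus>\<^bsub>P i\<^esub> y) # vs) = H (us @ (i, x) # vs) \<oplus>\<^bsub>A\<^esub> H (us @ (i, y) # vs)"
    "\<And>us i x vs r. us @ (i, x) # vs \<in> res.G n 1 \<Longrightarrow> r \<in> carrier A \<Longrightarrow>
       H (us @ (i, r \<odot>\<^bsub>P i\<^esub> x) # vs) = r \<otimes>\<^bsub>A\<^esub> H (us @ (i, x) # vs)"
    "\<And>t. t \<in> res.G n 0 \<Longrightarrow>
       finsum A (\<lambda>j. H (tensor_step res_d t j)) {..<n} = A.tensor_value res_eps t"
proof -
  have "null_homotopic A (tensor_power A P n) (tensor_power_diff A P res_d n) (stalk reg) (stalk_diff reg)
      (\<lambda>_. tensor_power_to_base A res_eps)"
    using assms res_resolution unfolding descendable_index_le_def Let_def res_eps_def[abs_def] by blast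
  then obtain h where h: "\<And>i. h i \<in> linear_maps A (tensor_power A P n i) (stalk reg (i - 1))"
    and eq: "\<And>i x. x \<in> carrier (tensor_power A P n i) \<Longrightarrow> tensor_power_to_base A res_eps x =
      stalk_diff reg (i - 1) (h i x) \<oplus>\<^bsub>stalk reg i\<^esub> h (i + 1) (tensor_power_diff A P res_d n i x)"
    unfolding null_homotopic_def by blast
  have h1: "h 1 \<in> linear_maps A (tensor_power A P n 1) (stalk reg 0)" using h[of 1] by simp
  note D = linear_mapsD[OF h1, unfolded stalk_simps regular_module_eq restrict_scalars_simps, simplified]
  let ?H = "\<lambda>t. h 1 (res.tel n 1 t)"
  interpret T: module A "tensor_power A P n 1" by (rule res.module_tensor_power)
  show ?thesis
  proof (rule that[of ?H])
    show "\<And>t. t \<in> res.G n 1 \<Longrightarrow> ?H t \<in> carrier A" by (intro D(1) res.tel_closed)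
  next
    fix us i x y vs assume "us @ (i, x) # vs \<in> res.G n 1" "us @ (i, y) # vs \<in> res.G n 1"
    then show "?H (us @ (i, x \<oplus>\<^bsub>P i\<^esub> y) # vs) = ?H (us @ (i, x) # vs) \<oplus>\<^bsub>A\<^esub> ?H (us @ (i, y) # vs)"
      by (simp only: res.tel_add D(2) res.tel_closed)
  next
    fix us i x vs r assume "us @ (i, x) # vs \<in> res.G n 1" "r \<in> carrier A"
    then show "?H (us @ (i, r \<odot>\<^bsub>P i\<^esub> x) # vs) = r \<otimes>\<^bsub>A\<^esub> ?H (us @ (i, x) # vs)"
      by (simp only: res.tel_smult D(3) res.tel_closed)
  next
    fix t assume t: "t \<in> res.G n 0"
    have c: "res.tel n 1 (tensor_step res_d t j) \<in> carrier (tensor_power A P n 1)" if "j < n" for j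
      using res.gens_step[OF t that] by (intro res.tel_closed) simp
    have "A.tensor_value res_eps t = tensor_power_to_base A res_eps (res.tel n 0 t)"
      by (rule res.tensor_power_to_base_elem[OF res_eps_linear t, symmetric])
    also have "\<dots> = \<zero>\<^bsub>A\<^esub> \<oplus>\<^bsub>A\<^esub> h 1 (tensor_power_diff A P res_d n 0 (res.tel n 0 t))"
      using eq[OF res.tel_closed[OF t]] by (simp add: stalk_diff_def regular_module_eq)
    also have "tensor_power_diff A P res_d n 0 (res.tel n 0 t) =
        finsum (tensor_power A P n 1) (\<lambda>j. res.tel n 1 (tensor_step res_d t j)) {..<n}"
      using res.tensor_power_diff_elem[OF t] by simp
    also have "h 1 \<dots> = finsum (stalk reg 0) (\<lambda>j. ?H (tensor_step res_d t j)) {..<n}"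
      using c by (intro linear_maps_finsum[OF T.module_axioms module_stalk[OF module_reg] h1]) auto
    \<comment> \<open>Both structures have the same carrier, addition and zero, and
      \<open>finsum\<close> sees nothing else.\<close>
    also have "\<dots> = finsum A (\<lambda>j. ?H (tensor_step res_d t j)) {..<n}"
      by (simp add: finsum_def finprod_def stalk_def regular_module_def restrict_scalars_def)
    finally show "finsum A (\<lambda>j. ?H (tensor_step res_d t j)) {..<n} = A.tensor_value res_eps t"
      using D(1)[OF c] by (simp add: Pi_iff)
  qed
qed

end

section \<open>Faces of lists and the Alexander-Whitney map modulo two\<close>

lemma bit_add_self [simp]: "(x :: bit) + x = 0"
  by (cases x) simp_all

declare add_bit_eq_xor [simp del] mult_bit_eq_and [simp del]

text \<open>Terms exchanged by a fixed-point-free involution cancel in pairs. This yields the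
  vanishing of the double boundary and, later, of the sums over injective maps.\<close>

lemma sum_bit_involution:
  fixes h :: "'s \<Rightarrow> bit"
  assumes "finite S" "\<And>s. s \<in> S \<Longrightarrow> \<sigma> s \<in> S \<and> \<sigma> s \<noteq> s \<and> \<sigma> (\<sigma> s) = s \<and> h (\<sigma> s) = h s"
  shows "sum h S = 0"
  using assms
proof (induction "card S" arbitrary: S rule: less_induct)
  case less
  show ?case
  proof (cases "S = {}")
    case False
    then obtain s where s: "s \<in> S" by blast
    let ?S = "S - {s, \<sigma> s}"
    have "sum h ?S = 0"
    proof (rule less.hyps)
      show "card ?S < card S" using s less.prems(1) by (intro psubset_card_mono) auto
    next
      fix t assume "t \<in> ?S"
      then show "\<sigma> t \<in> ?S \<and> \<sigma> t \<noteq> t \<and> \<sigma> (\<sigma> t) = t \<and> h (\<sigma> t) = h t"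
        using less.prems(2)[of t] less.prems(2)[OF s] by auto
    qed (use less.prems(1) in simp)
    moreover have "sum h S = sum h {s, \<sigma> s} + sum h ?S"
      using s less.prems by (metis Diff_partition add.commute empty_subsetI insert_subset sum.subset_diff)
    moreover have "sum h {s, \<sigma> s} = 0"
    proof -
      have "\<sigma> s \<noteq> s" "h (\<sigma> s) = h s" using less.prems(2)[OF s] by auto
      then show ?thesis by simp
    qed
    ultimately show ?thesis by simp
  qed simp
qed

definition del :: "nat \<Rightarrow> 'i list \<Rightarrow> 'i list" where
  "del i as = take i as @ drop (Suc i) as"

lemma length_del: "i < length as \<Longrightarrow> length (del i as) = length as - 1"
  by (simp add: del_def)

lemma nth_del:
  "i < length as \<Longrightarrow> j < length as - 1 \<Longrightarrow> del i as ! j = as ! (if j < i then j else Suc j)"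
  by (auto simp: del_def nth_append min_def)

lemma del_del:
  assumes "j < i" "i < length as"
  shows "del j (del i as) = del (i - 1) (del j as)"
proof (rule nth_equalityI)
  show "length (del j (del i as)) = length (del (i - 1) (del j as))"
    using assms by (simp add: length_del)
next
  fix l assume "l < length (del j (del i as))"
  then have "l < length as - 2" using assms by (simp add: length_del)
  then show "del j (del i as) ! l = del (i - 1) (del j as) ! l"
    using assms by (auto simp: nth_del length_del)
qed

text \<open>Deleting two entries can be done in two orders, which yield the same list and the same
  two weights. The involution exchanges the orders; the index shift in it accounts for positions
  moving down after the first deletion.\<close>

lemma face_face_zero:
  fixes w :: "'i \<Rightarrow> bit" and g :: "'i list \<Rightarrow> bit"
  assumes "length as = Suc m"
  shows "(\<Sum>i<Suc m. \<Sum>j<m. w (as ! i) * (w (del i as ! j) * g (del j (del i as)))) = 0"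
proof -
  let ?h = "\<lambda>(i, j). w (as ! i) * (w (del i as ! j) * g (del j (del i as)))"
  let ?\<sigma> = "\<lambda>(i, j). if j < i then (j, i - 1) else (Suc j, i)"
  have "sum ?h ({..<Suc m} \<times> {..<m}) = 0"
  proof (rule sum_bit_involution[where \<sigma> = ?\<sigma>])
    fix s assume "s \<in> {..<Suc m} \<times> {..<m}"
    then obtain i j where s: "s = (i, j)" "i < Suc m" "j < m" by auto
    show "?\<sigma> s \<in> {..<Suc m} \<times> {..<m} \<and> ?\<sigma> s \<noteq> s \<and> ?\<sigma> (?\<sigma> s) = s \<and> ?h (?\<sigma> s) = ?h s"
    proof (cases "j < i")
      case True
      then show ?thesis using s assms del_del[of j i as] by (auto simp: nth_del mult.left_commute)
    next
      case False
      then show ?thesis using s assms del_del[of i "Suc j" as] by (auto simp: nth_del mult.left_commute)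
    qed
  qed simp
  then show ?thesis by (simp add: sum.cartesian_product)
qed

text \<open>All ways to cut a list into \<open>n\<close> nonempty consecutive blocks such that
  neighbours share one entry, as in the Alexander-Whitney diagonal. After the last cut exactly one
  entry must remain, the end of the last block.\<close>

primrec aw_terms :: "nat \<Rightarrow> 'i list \<Rightarrow> 'i list list list" where
  "aw_terms 0 as = (if length as = 1 then [[]] else [])"
| "aw_terms (Suc n) as = concat (map (\<lambda>k. map ((#) (take (Suc k) as)) (aw_terms n (drop k as))) [0..<length as])"

lemma aw_terms_props:
  "t \<in> set (aw_terms n as) \<Longrightarrow> length t = n \<and> (\<forall>b \<in> set t. b \<noteq> [] \<and> set b \<subseteq> set as) \<and>
     sum_list (map length t) + 1 = length as + n"
proof (induction n arbitrary: as t)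
  case 0
  then show ?case by (auto split: if_splits)
next
  case (Suc n)
  then obtain k t' where k: "k < length as" "t' \<in> set (aw_terms n (drop k as))" "t = take (Suc k) as # t'" by auto
  then show ?case
    using Suc.IH[OF k(2)] set_take_subset[of "Suc k" as] set_drop_subset[of k as] by fastforce
qed

definition aw_sum :: "nat \<Rightarrow> 'i list \<Rightarrow> ('i list list \<Rightarrow> bit) \<Rightarrow> bit" where
  "aw_sum n as Q = (\<Sum>t\<leftarrow>aw_terms n as. Q t)"

lemma aw_sum_0: "aw_sum 0 as Q = (if length as = 1 then Q [] else 0)"
  by (simp add: aw_sum_def)

lemma aw_sum_Suc: "aw_sum (Suc n) as Q = (\<Sum>k<length as. aw_sum n (drop k as) (\<lambda>t. Q (take (Suc k) as # t)))"
proof -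
  have "(\<Sum>t\<leftarrow>concat (map (\<lambda>k. map ((#) (take (Suc k) as)) (aw_terms n (drop k as))) ks). Q t) =
    (\<Sum>k\<leftarrow>ks. aw_sum n (drop k as) (\<lambda>t. Q (take (Suc k) as # t)))" for ks
    by (induction ks) (simp_all add: aw_sum_def comp_def)
  then show ?thesis
    by (simp add: aw_sum_def[of "Suc n"] interv_sum_list_conv_sum_set_nat atLeast0LessThan)
qed

lemma aw_sum_add: "aw_sum n as (\<lambda>t. Q t + Q' t) = aw_sum n as Q + aw_sum n as Q'"
  by (simp add: aw_sum_def sum_list_addf)

lemma aw_sum_zero: "aw_sum n as (\<lambda>t. 0) = 0"
  by (simp add: aw_sum_def)

lemma aw_sum_sum: "finite I \<Longrightarrow> aw_sum n as (\<lambda>t. \<Sum>i\<in>I. Q i t) = (\<Sum>i\<in>I. aw_sum n as (Q i))"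
  by (induction rule: finite_induct) (simp_all add: aw_sum_add aw_sum_zero)

lemma aw_sum_mult: "aw_sum n as (\<lambda>t. c * Q t) = c * aw_sum n as Q"
  by (simp add: aw_sum_def sum_list_const_mult)

text \<open>The functional \<open>Q\<close> evaluated on the boundary of a tensor product of
  simplices, modulo 2. A block of length 1 is a vertex and has no boundary.\<close>

primrec bdry :: "'i list list \<Rightarrow> ('i list list \<Rightarrow> bit) \<Rightarrow> bit" where
  "bdry [] Q = 0"
| "bdry (b # t) Q = (if 2 \<le> length b then \<Sum>i<length b. Q (del i b # t) else 0) + bdry t (\<lambda>t'. Q (b # t'))"

lemma take_del: 
  "i \<le> k \<Longrightarrow> Suc k < length as \<Longrightarrow> take (Suc k) (del i as) = del i (take (Suc (Suc k)) as)"
  "k < i \<Longrightarrow> take (Suc k) (del i as) = take (Suc k) as"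
  by (auto simp: del_def min_def take_drop)

lemma drop_del:
  "i \<le> k \<Longrightarrow> Suc k \<le> length as \<Longrightarrow> drop k (del i as) = drop (Suc k) as"
  "k \<le> i \<Longrightarrow> i < length as \<Longrightarrow> drop k (del i as) = del (i - k) (drop k as)"
  by (auto simp: del_def min_def drop_take)

text \<open>
  The Alexander-Whitney map is a chain map: faces at interior cut points occur twice, once as the last face
  of a front part and once as the first face of the following part.
\<close>

lemma alexander_whitney:
  "aw_sum n as (\<lambda>t. bdry t Q) = (if 2 \<le> length as then \<Sum>i<length as. aw_sum n (del i as) Q else 0)"
proof (induction n arbitrary: as Q)
  case 0
  show ?case
  proof (cases "length as = 2")
    case True
    then show ?thesis by (simp add: aw_sum_0 length_del numeral_2_eq_2 lessThan_Suc)
  next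
    case False
    then have "2 \<le> length as \<Longrightarrow> (\<Sum>i<length as. aw_sum 0 (del i as) Q) = 0"
      by (intro sum.neutral) (auto simp: aw_sum_0 length_del)
    then show ?thesis by (auto simp: aw_sum_0)
  qed
next
  case (Suc n)
  let ?L = "length as"
  let ?T = "\<lambda>b as'. aw_sum n as' (\<lambda>t. Q (b # t))"
  have "aw_sum (Suc n) as (\<lambda>t. bdry t Q) = (\<Sum>k<?L.
      aw_sum n (drop k as) (\<lambda>t. (if 1 \<le> k then \<Sum>i<Suc k. Q (del i (take (Suc k) as) # t) else 0)) +
      aw_sum n (drop k as) (\<lambda>t. bdry t (\<lambda>t'. Q (take (Suc k) as # t'))))"
    unfolding aw_sum_Suc
  proof (rule sum.cong[OF refl])
    fix k assume "k \<in> {..<?L}"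
    then have l: "length (take (Suc k) as) = Suc k" by simp
    show "aw_sum n (drop k as) (\<lambda>t. bdry (take (Suc k) as # t) Q) =
      aw_sum n (drop k as) (\<lambda>t. (if 1 \<le> k then \<Sum>i<Suc k. Q (del i (take (Suc k) as) # t) else 0)) +
      aw_sum n (drop k as) (\<lambda>t. bdry t (\<lambda>t'. Q (take (Suc k) as # t')))"
      unfolding bdry.simps l aw_sum_add[symmetric] by (simp add: numeral_2_eq_2)
  qed
  also have "\<dots> = (\<Sum>k<?L. (if 1 \<le> k then \<Sum>i<Suc k. ?T (del i (take (Suc k) as)) (drop k as) else 0)) +
      (\<Sum>k<?L. if 2 \<le> ?L - k then \<Sum>i<?L - k. ?T (take (Suc k) as) (del i (drop k as)) else 0)"
    unfolding sum.distrib Suc.IH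
    by (intro arg_cong2[where f = "(+)"] sum.cong refl) (auto simp: aw_sum_sum aw_sum_zero simp del: sum.lessThan_Suc)
  finally have lhs: "aw_sum (Suc n) as (\<lambda>t. bdry t Q) = \<dots>" .
  show ?case
  proof (cases "2 \<le> ?L")
    case False
    then have "?L = 0 \<or> ?L = 1" by linarith
    then show ?thesis unfolding lhs by auto
  next
    case True
    then obtain m where m: "?L = Suc (Suc m)" by (metis Suc_le_D numeral_2_eq_2 le_Suc_ex add_2_eq_Suc)
    \<comment> \<open>The faces of the front block. Those with \<open>i \<le> k\<close> come from
      cutting the list without its entry \<open>i\<close>; the last face deletes the shared entry
      and gives the second sum.\<close>
    have A: "(\<Sum>k<?L. (if 1 \<le> k then \<Sum>i<Suc k. ?T (del i (take (Suc k) as)) (drop k as) else 0)) =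
      (\<Sum>k<Suc m. \<Sum>i<Suc k. ?T (take (Suc k) (del i as)) (drop k (del i as))) +
      (\<Sum>k<Suc m. ?T (take (Suc k) as) (drop (Suc k) as))"
    proof -
      have "(\<Sum>k<?L. (if 1 \<le> k then \<Sum>i<Suc k. ?T (del i (take (Suc k) as)) (drop k as) else 0)) =
        (\<Sum>k<Suc m. \<Sum>i<Suc (Suc k). ?T (del i (take (Suc (Suc k)) as)) (drop (Suc k) as))"
        unfolding m by (subst sum.lessThan_Suc_shift) simp
      also have "\<dots> = (\<Sum>k<Suc m. (\<Sum>i<Suc k. ?T (del i (take (Suc (Suc k)) as)) (drop (Suc k) as)) +
          ?T (del (Suc k) (take (Suc (Suc k)) as)) (drop (Suc k) as))"
        by (intro sum.cong refl) (rule sum.lessThan_Suc)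
      also have "\<dots> = (\<Sum>k<Suc m. (\<Sum>i<Suc k. ?T (take (Suc k) (del i as)) (drop k (del i as))) +
          ?T (take (Suc k) as) (drop (Suc k) as))"
      proof (intro sum.cong refl arg_cong2[where f = "(+)"])
        fix k i assume "k \<in> {..<Suc m}" "i \<in> {..<Suc k}"
        then show "?T (del i (take (Suc (Suc k)) as)) (drop (Suc k) as) =
            ?T (take (Suc k) (del i as)) (drop k (del i as))"
          using m by (simp add: take_del(1) drop_del(1))
      next
        fix k assume "k \<in> {..<Suc m}"
        then show "?T (del (Suc k) (take (Suc (Suc k)) as)) (drop (Suc k) as) =
            ?T (take (Suc k) as) (drop (Suc k) as)"
          using m by (simp add: del_def min_def)
      qed
      finally show ?thesis unfolding sum.distrib .
    qed
    \<comment> \<open>The faces of the remaining list. The first of them deletes the shared entry,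
      which reproduces the second sum of \<open>A\<close>, so the two copies cancel modulo
      2.\<close>
    have B: "(\<Sum>k<?L. if 2 \<le> ?L - k then \<Sum>i<?L - k. ?T (take (Suc k) as) (del i (drop k as)) else 0) =
      (\<Sum>k<Suc m. ?T (take (Suc k) as) (drop (Suc k) as)) +
      (\<Sum>k<Suc m. \<Sum>i\<in>{Suc k..<?L}. ?T (take (Suc k) (del i as)) (drop k (del i as)))"
    proof -
      have "(\<Sum>k<?L. if 2 \<le> ?L - k then \<Sum>i<?L - k. ?T (take (Suc k) as) (del i (drop k as)) else 0) =
        (\<Sum>k<Suc m. \<Sum>i<?L - k. ?T (take (Suc k) as) (del i (drop k as)))"
        unfolding m by (subst sum.lessThan_Suc) (simp add: Suc_diff_le)
      also have "\<dots> = (\<Sum>k<Suc m. ?T (take (Suc k) as) (drop (Suc k) as) +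
        (\<Sum>i\<in>{Suc k..<?L}. ?T (take (Suc k) (del i as)) (drop k (del i as))))"
      proof (rule sum.cong[OF refl])
        fix k assume k: "k \<in> {..<Suc m}"
        have "(\<Sum>i<?L - k. ?T (take (Suc k) as) (del i (drop k as))) =
          (\<Sum>i\<in>{k..<?L}. ?T (take (Suc k) as) (del (i - k) (drop k as)))"
          using k m by (intro sum.reindex_bij_witness[of _ "\<lambda>i. i - k" "\<lambda>i. i + k"]) auto
        also have "\<dots> = ?T (take (Suc k) as) (del 0 (drop k as)) +
          (\<Sum>i\<in>{Suc k..<?L}. ?T (take (Suc k) as) (del (i - k) (drop k as)))"
          using k m by (subst sum.atLeast_Suc_lessThan) auto
        also have "\<dots> = ?T (take (Suc k) as) (drop (Suc k) as) +
          (\<Sum>i\<in>{Suc k..<?L}. ?T (take (Suc k) (del i as)) (drop k (del i as)))"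
          by (intro arg_cong2[where f = "(+)"] sum.cong refl)
            (auto simp: take_del(2) drop_del(2), simp add: del_def)
        finally show "(\<Sum>i<?L - k. ?T (take (Suc k) as) (del i (drop k as))) =
          ?T (take (Suc k) as) (drop (Suc k) as) +
          (\<Sum>i\<in>{Suc k..<?L}. ?T (take (Suc k) (del i as)) (drop k (del i as)))" .
      qed
      finally show ?thesis unfolding sum.distrib .
    qed
    have "(\<Sum>i<?L. aw_sum (Suc n) (del i as) Q) =
      (\<Sum>i<?L. \<Sum>k<Suc m. ?T (take (Suc k) (del i as)) (drop k (del i as)))"
      unfolding aw_sum_Suc using m by (intro sum.cong refl) (simp add: length_del)
    also have "\<dots> = (\<Sum>k<Suc m. \<Sum>i<?L. ?T (take (Suc k) (del i as)) (drop k (del i as)))"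
      by (rule sum.swap)
    also have "\<dots> = (\<Sum>k<Suc m. (\<Sum>i<Suc k. ?T (take (Suc k) (del i as)) (drop k (del i as))) +
        (\<Sum>i\<in>{Suc k..<?L}. ?T (take (Suc k) (del i as)) (drop k (del i as))))"
      using m by (intro sum.cong refl) (subst sum.union_disjoint[symmetric], auto simp: ivl_disj_un)
    finally show ?thesis using True unfolding lhs A B sum.distrib by (simp add: add.assoc)
  qed
qed

primrec tprod :: "(nat \<Rightarrow> 'i list \<Rightarrow> bit) \<Rightarrow> nat \<Rightarrow> 'i list list \<Rightarrow> bit" where
  "tprod e j [] = 1"
| "tprod e j (b # t) = e j b * tprod e (Suc j) t"

text \<open>If each factor sees only edges, then of all cuts of \<open>n + 1\<close> entries only
  the one into \<open>n\<close> edges counts. This is the usual formula for a cup product of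
  1-cochains.\<close>

lemma aw_sum_tprod:
  assumes "\<And>j b. length b \<noteq> 2 \<Longrightarrow> e j b = 0" "length as = Suc n"
  shows "aw_sum n as (tprod e j) = (\<Prod>i<n. e (j + i) [as ! i, as ! Suc i])"
  using assms(2)
proof (induction n arbitrary: as j)
  case 0
  then show ?case by (simp add: aw_sum_0)
next
  case (Suc n)
  have "aw_sum (Suc n) as (tprod e j) = (\<Sum>k<length as. e j (take (Suc k) as) * aw_sum n (drop k as) (tprod e (Suc j)))"
    by (simp add: aw_sum_Suc aw_sum_mult)
  \<comment> \<open>The first block has length \<open>k + 1\<close>, which is 2 only for
    \<open>k = 1\<close>.\<close>
  also have "\<dots> = (\<Sum>k\<in>{1}. e j (take (Suc k) as) * aw_sum n (drop k as) (tprod e (Suc j)))"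
    using Suc.prems assms(1) by (intro sum.mono_neutral_right) auto
  also have "\<dots> = e j [as ! 0, as ! 1] * (\<Prod>i<n. e (Suc j + i) [as ! Suc i, as ! Suc (Suc i)])"
    using Suc.IH[of "drop 1 as" "Suc j"] Suc.prems by (simp add: take_Suc_conv_app_nth numeral_2_eq_2)
  also have "\<dots> = (\<Prod>i<Suc n. e (j + i) [as ! i, as ! Suc i])"
    by (subst prod.lessThan_Suc_shift) simp
  finally show ?case .
qed

section \<open>The cochain attached to a null homotopy\<close>

text \<open>The assumption \<open>cocycle\<close> says that over \<open>B\<close> the family
  \<open>y j\<close> makes \<open>c j\<close> a coboundary; it is the difference
  \<open>y j a + y j b\<close> that descends to \<open>A\<close> once it is restricted to where
  \<open>x a\<close> and \<open>x b\<close> are 1.\<close>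

locale bool_cocycle = bool_ext A B f for A :: "'a ring" and B :: "'b ring" and f +
  fixes x :: "'i \<Rightarrow> 'a" and y :: "nat \<Rightarrow> 'i \<Rightarrow> 'b" and c :: "nat \<Rightarrow> 'i \<Rightarrow> 'i \<Rightarrow> 'a"
  assumes x_closed: "x a \<in> carrier A" and y_closed: "y j a \<in> carrier B" and c_closed: "c j a b \<in> carrier A"
    and cocycle: "f (c j a b) = f (x a) \<otimes>\<^bsub>B\<^esub> f (x b) \<otimes>\<^bsub>B\<^esub> (y j a \<oplus>\<^bsub>B\<^esub> y j b)"
begin

text \<open>
  A chain map from the Cech resolution of the ideal generated by the \<open>x a\<close> to the resolution of the fiber,
  lifting the class of \<open>c j\<close>; a list of length \<open>k + 1\<close> is sent to degree \<open>1 - k\<close>.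
\<close>

primrec phi :: "nat \<Rightarrow> nat \<Rightarrow> 'i list \<Rightarrow> ('a \<times> 'b) list \<Rightarrow> 'a" where
  "phi j 0 = (\<lambda>as. SOME p. p \<in> carrier (P 1) \<and> res_map1 p = f (x (hd as)) \<otimes>\<^bsub>B\<^esub> y j (hd as))"
| "phi j (Suc k) = (\<lambda>as. SOME z. z \<in> carrier (P (- int k)) \<and> res_d (- int k) z =
     finsum (P (1 - int k)) (\<lambda>i. x (as ! i) \<odot>\<^bsub>P (1 - int k)\<^esub> phi j k (del i as)) {..<length as})"

declare phi.simps [simp del]

text \<open>The boundary of the Cech complex after \<open>phi\<close>: the face without entry
  \<open>i\<close> carries the coefficient \<open>x (as ! i)\<close>.\<close>

definition faces :: "nat \<Rightarrow> nat \<Rightarrow> 'i list \<Rightarrow> ('a \<times> 'b) list \<Rightarrow> 'a" where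
  "faces j k as = finsum (P (1 - int k)) (\<lambda>i. x (as ! i) \<odot>\<^bsub>P (1 - int k)\<^esub> phi j k (del i as)) {..<length as}"

lemma phi_0:
  "phi j 0 as \<in> carrier (P 1)" "res_map1 (phi j 0 as) = f (x (hd as)) \<otimes>\<^bsub>B\<^esub> y j (hd as)"
proof -
  have "\<exists>p. p \<in> carrier (P 1) \<and> res_map1 p = f (x (hd as)) \<otimes>\<^bsub>B\<^esub> y j (hd as)"
    using res_map1_surj[of "f (x (hd as)) \<otimes>\<^bsub>B\<^esub> y j (hd as)"] x_closed y_closed f_closed
    by (auto simp: res_E_simps simp del: res_basis.simps)
  from someI_ex[OF this] show "phi j 0 as \<in> carrier (P 1)"
    "res_map1 (phi j 0 as) = f (x (hd as)) \<otimes>\<^bsub>B\<^esub> y j (hd as)" by (simp_all add: phi.simps)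
qed

lemma free_finsum_point:
  assumes w: "is_point A w" and h: "h \<in> S \<rightarrow> carrier (free E)"
  shows "w (finsum (free E) h S e) = (\<Sum>s\<in>S. w (h s e))"
proof -
  interpret F: module A "free E" by (rule A.module_free)
  show ?thesis using h
  proof (induction S rule: infinite_finite_induct)
    case (insert s S)
    then have "h s \<in> carrier (free E)" "finsum (free E) h S \<in> carrier (free E)" "h \<in> S \<rightarrow> carrier (free E)"
      by (auto intro!: F.M.finsum_closed)
    then show ?case
      using insert by (simp add: pointD[OF w] free_module_carrier)
  qed (simp_all add: A.point_zero[OF w])
qed

lemma faces_closed:
  assumes "\<And>i. i < length as \<Longrightarrow> phi j k (del i as) \<in> carrier (P (1 - int k))"
  shows "faces j k as \<in> carrier (P (1 - int k))"
proof -
  interpret F: module A "P (1 - int k)" by (rule A.module_free)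
  show ?thesis unfolding faces_def
    using assms x_closed by (intro F.M.finsum_closed) (auto simp del: free_module_simps)
qed

text \<open>The two faces contribute \<open>x a x b y(b)\<close> and \<open>x a x b y(a)\<close>.
  Their sum lies in the image of \<open>f\<close> by the cocycle assumption, which is the condition
  for a lift to degree 0.\<close>

lemma res_map1_faces:
  assumes "length as = 2"
  shows "res_map1 (faces j 0 as) = f (c j (as ! 0) (as ! 1))"
proof -
  obtain a b where as: "as = [a, b]"
    using assms by (auto simp: length_Suc_conv numeral_2_eq_2)
  have lin: "res_map1 \<in> linear_maps A (P 1) BA"
    using res_map1_linear by (simp add: res_E_simps del: res_basis.simps)
  interpret F: module A "P 1" by (rule A.module_free)
  interpret BA: module A BA by (rule module_BA)
  have "{..<length as} = {0, 1}" using as by auto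
  then have "faces j 0 as = x a \<odot>\<^bsub>P 1\<^esub> phi j 0 [b] \<oplus>\<^bsub>P 1\<^esub> x b \<odot>\<^bsub>P 1\<^esub> phi j 0 [a]"
    using phi_0(1) x_closed as by (simp add: faces_def del_def F.M.a_comm del: free_module_simps)
  then have "res_map1 (faces j 0 as) = f (x a) \<otimes>\<^bsub>B\<^esub> (f (x b) \<otimes>\<^bsub>B\<^esub> y j b) \<oplus>\<^bsub>B\<^esub> f (x b) \<otimes>\<^bsub>B\<^esub> (f (x a) \<otimes>\<^bsub>B\<^esub> y j a)"
    using phi_0 x_closed by (simp add: linear_mapsD[OF lin] del: free_module_simps)
  also have "\<dots> = f (c j a b)"
    using x_closed y_closed f_closed by (simp add: cocycle B.r_distr B.m_ac B.a_comm)
  finally show ?thesis using as by simp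
qed

text \<open>Justifies the choices in \<open>phi\<close>: the prescribed boundary is a cycle, so
  exactness of the resolution supplies a lift.\<close>

lemma phi_props:
  "length as = Suc k \<Longrightarrow> phi j k as \<in> carrier (P (1 - int k)) \<and>
     (\<forall>l. k = Suc l \<longrightarrow> res_d (- int l) (phi j k as) = faces j l as)"
proof (induction k arbitrary: as rule: less_induct)
  case (less k)
  show ?case
  proof (cases k)
    case 0
    then show ?thesis using phi_0(1) by simp
  next
    case k: (Suc k')
    have len: "length (del i as) = Suc k'" if "i < length as" for i
      using that less.prems k by (simp add: length_del)
    have cl: "faces j k' as \<in> carrier (P (1 - int k'))"
      using less.IH[of k'] len k by (intro faces_closed) auto
    \<comment> \<open>The first lift needs a value in the image of \<open>f\<close>, which is
      \<open>c j\<close>; all later lifts need a vanishing differential.\<close>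
    have "\<exists>z. z \<in> carrier (P (- int k')) \<and> res_d (- int k') z = faces j k' as"
    proof (cases k')
      case 0
      then show ?thesis
        using res_exact1[of "faces j 0 as"] cl res_map1_faces[of as] less.prems k c_closed by auto
    next
      case k': (Suc l)
      let ?Q = "P (1 - int l)"
      interpret Q: module A ?Q by (rule A.module_free)
      have dl: "res_d (- int l) \<in> linear_maps A (P (- int l)) ?Q"
        using res.d_linear[of "- int l"] by (simp add: add.commute)
      have ph: "phi j (Suc l) (del i as) \<in> carrier (P (- int l))"
        "res_d (- int l) (phi j (Suc l) (del i as)) = faces j l (del i as)" if "i < length as" for i
        using less.IH[of "Suc l" "del i as"] len[OF that] k k' by auto
      have ph2: "phi j l (del m (del i as)) \<in> carrier ?Q" if "i < length as" "m < length (del i as)" for i m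
        using less.IH[of l "del m (del i as)"] len[OF that(1)] that(2) k k' by (simp add: length_del)
      have fc: "faces j l (del i as) \<in> carrier ?Q" if "i < length as" for i
        using ph2[OF that] by (rule faces_closed)
      have "res_d (- int l) (faces j k' as) =
          finsum ?Q (\<lambda>i. res_d (- int l) (x (as ! i) \<odot>\<^bsub>P (- int l)\<^esub> phi j (Suc l) (del i as))) {..<length as}"
      proof -
        interpret Pl: module A "P (- int l)" by (rule A.module_free)
        show ?thesis unfolding faces_def k'
          using linear_maps_finsum[OF A.module_free A.module_free dl,
              of "\<lambda>i. x (as ! i) \<odot>\<^bsub>P (- int l)\<^esub> phi j (Suc l) (del i as)" "{..<length as}"] ph x_closed
          by (simp add: Pi_iff del: free_module_simps)
      qed
      also have "\<dots> = finsum ?Q (\<lambda>i. x (as ! i) \<odot>\<^bsub>?Q\<^esub> faces j l (del i as)) {..<length as}"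
        using ph x_closed fc
        by (intro Q.M.finsum_cong') (auto simp: linear_mapsD[OF dl] simp del: free_module_simps)
      \<comment> \<open>Checked coordinate by coordinate and point by point, where it becomes the
        cancellation of double faces for bits.\<close>
      also have "\<dots> = (\<lambda>_. \<zero>\<^bsub>A\<^esub>)"
      proof
        fix e
        have outer: "(\<lambda>i. x (as ! i) \<odot>\<^bsub>?Q\<^esub> faces j l (del i as)) \<in> {..<length as} \<rightarrow> carrier ?Q"
          using fc x_closed by (auto simp del: free_module_simps)
        have inner: "(\<lambda>m. x (del i as ! m) \<odot>\<^bsub>?Q\<^esub> phi j l (del m (del i as))) \<in> {..<length (del i as)} \<rightarrow> carrier ?Q"
          if "i < length as" for i
          using ph2[OF that] x_closed by (auto simp del: free_module_simps)
        have val: "phi j l (del m (del i as)) e \<in> carrier A" if "i < length as" "m < length (del i as)" for i m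
          using ph2[OF that] by (simp add: free_module_carrier)
        have val': "faces j l (del i as) e \<in> carrier A" if "i < length as" for i
          using fc[OF that] by (simp add: free_module_carrier)
        show "finsum ?Q (\<lambda>i. x (as ! i) \<odot>\<^bsub>?Q\<^esub> faces j l (del i as)) {..<length as} e = \<zero>\<^bsub>A\<^esub>"
        proof (rule A.eqI_points)
          show "finsum ?Q (\<lambda>i. x (as ! i) \<odot>\<^bsub>?Q\<^esub> faces j l (del i as)) {..<length as} e \<in> carrier A"
            using Q.M.finsum_closed[OF outer] by (simp add: free_module_carrier)
          fix w assume w: "is_point A w"
          have "w (finsum ?Q (\<lambda>i. x (as ! i) \<odot>\<^bsub>?Q\<^esub> faces j l (del i as)) {..<length as} e) =
              (\<Sum>i<length as. w (x (as ! i)) * w (faces j l (del i as) e))"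
            using free_finsum_point[OF w outer] val' x_closed by (simp add: pointD[OF w])
          also have "\<dots> = (\<Sum>i<length as. \<Sum>m<length (del i as).
              w (x (as ! i)) * (w (x (del i as ! m)) * w (phi j l (del m (del i as)) e)))"
          proof (rule sum.cong[OF refl])
            fix i assume "i \<in> {..<length as}"
            then have i: "i < length as" by simp
            show "w (x (as ! i)) * w (faces j l (del i as) e) = (\<Sum>m<length (del i as).
              w (x (as ! i)) * (w (x (del i as ! m)) * w (phi j l (del m (del i as)) e)))"
              unfolding faces_def free_finsum_point[OF w inner[OF i]] sum_distrib_left
              using val[OF i] x_closed by (simp add: pointD[OF w])
          qed
          also have "\<dots> = (\<Sum>i<Suc k. \<Sum>m<k.
              w (x (as ! i)) * (w (x (del i as ! m)) * w (phi j l (del m (del i as)) e)))"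
            using less.prems by (intro sum.cong) (simp_all add: length_del)
          also have "\<dots> = 0"
            by (rule face_face_zero[of as k "\<lambda>a. w (x a)" "\<lambda>bs. w (phi j l bs e)", OF less.prems])
          finally show "w (finsum ?Q (\<lambda>i. x (as ! i) \<odot>\<^bsub>?Q\<^esub> faces j l (del i as)) {..<length as} e) = w \<zero>\<^bsub>A\<^esub>"
            by (simp add: A.point_zero[OF w])
        qed simp
      qed
      finally have "res_d (- int l) (faces j k' as) = (\<lambda>_. \<zero>\<^bsub>A\<^esub>)" .
      moreover have e: "- int k' = - int l - 1" using k' by simp
      ultimately show ?thesis
        unfolding e using res_exact[of "- int l" "faces j k' as"] cl k' by auto
    qed
    from someI_ex[OF this] show ?thesis unfolding k by (simp add: faces_def phi.simps del: free_module_simps)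
  qed
qed

lemma phi_closed: "length as = Suc k \<Longrightarrow> phi j k as \<in> carrier (P (1 - int k))"
  using phi_props by blast

lemma phi_diff: "length as = Suc (Suc k) \<Longrightarrow> res_d (- int k) (phi j (Suc k) as) = faces j k as"
  using phi_props by blast

text \<open>Here the map from the fiber to the base recovers the cocycle from its lift; injectivity
  of \<open>f\<close> allows the comparison in \<open>B\<close>.\<close>

lemma res_map0_phi:
  assumes "length as = 2"
  shows "res_map0 (phi j 1 as) = c j (as ! 0) (as ! 1)"
proof -
  have cl: "phi j 1 as \<in> carrier (free (res_basis (Suc 0)))"
    using phi_closed[of as 1 j] assms by (simp add: res_E_simps del: res_basis.simps)
  have "f (res_map0 (phi j 1 as)) = res_map1 (res_d (- int 0) (phi j (Suc 0) as))"
    using f_res_map0[OF cl] by (simp add: res_d_def)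
  also have "\<dots> = f (c j (as ! 0) (as ! 1))"
    using phi_diff[of as 0 j] assms res_map1_faces by (simp add: numeral_2_eq_2)
  finally show ?thesis
    using linear_mapsD(1)[OF res_map0_linear cl] c_closed f_eq by (simp add: regular_module_eq)
qed

text \<open>The pure tensor of the lifted blocks; \<open>j\<close> advances because each block is
  lifted with its own cocycle. A block of length \<open>k + 1\<close> has degree
  \<open>1 - k\<close>, hence the \<open>2 - length\<close>.\<close>

primrec Phi :: "nat \<Rightarrow> 'i list list \<Rightarrow> (int \<times> (('a \<times> 'b) list \<Rightarrow> 'a)) list" where
  "Phi j [] = []"
| "Phi j (b # t) = (2 - int (length b), phi j (length b - 1) b) # Phi (Suc j) t"

lemma length_Phi: "length (Phi j t) = length t"
  by (induction t arbitrary: j) auto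

lemma Phi_closed:
  assumes "\<forall>b \<in> set t. b \<noteq> []" shows "\<forall>(i, z) \<in> set (Phi j t). z \<in> carrier (P i)"
  using assms
proof (induction t arbitrary: j)
  case (Cons b t)
  then obtain k where "length b = Suc k" by (cases b) auto
  then show ?case using Cons phi_closed[of b k j] by auto
qed simp

lemma degree_Phi: "sum_list (map fst (Phi j t)) = 2 * int (length t) - int (sum_list (map length t))"
  by (induction t arbitrary: j) (auto simp: algebra_simps)

text \<open>Each block contributes 2 minus its length, and the \<open>n - 1\<close> shared entries
  are counted twice. So lists of length \<open>n + 1\<close> land in degree 0, where the homotopy
  equation is used, and lists of length \<open>n\<close> in degree 1, where \<open>H\<close> is
  defined.\<close>

lemma Phi_gens:
  assumes "t \<in> set (aw_terms n as)"
  shows "Phi j t \<in> res.G n (int n + 1 - int (length as))"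
proof -
  note p = aw_terms_props[OF assms]
  then have "int (sum_list (map length t)) + 1 = int (length as) + int n" by (metis of_nat_1 of_nat_add)
  then show ?thesis
    using p Phi_closed[of t j] by (auto simp: tensor_power_gens_def length_Phi degree_Phi)
qed

text \<open>Only blocks of length 2 have degree 0; on all others the map to the base is 0.\<close>

lemma point_tensor_value:
  assumes w: "is_point A w" and t: "\<forall>b \<in> set t. b \<noteq> []"
  shows "A.tensor_value res_eps (Phi j t) \<in> carrier A \<and>
    w (A.tensor_value res_eps (Phi j t)) = tprod (\<lambda>j b. if length b = 2 then w (c j (b ! 0) (b ! 1)) else 0) j t"
  using t
proof (induction t arbitrary: j)
  case Nil
  then show ?case by (simp add: A.tensor_value_def pointD[OF w])
next
  case (Cons b t)
  have e: "res_eps (2 - int (length b)) (phi j (length b - 1) b) =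
      (if length b = 2 then c j (b ! 0) (b ! 1) else \<zero>\<^bsub>A\<^esub>)"
    using res_map0_phi[of b j] by (auto simp: res_eps_def res_q_def)
  have "A.tensor_value res_eps (Phi j (b # t)) =
      (if length b = 2 then c j (b ! 0) (b ! 1) else \<zero>\<^bsub>A\<^esub>) \<otimes>\<^bsub>A\<^esub> A.tensor_value res_eps (Phi (Suc j) t)"
    unfolding e[symmetric] by (simp add: A.tensor_value_def)
  then show ?case
    using Cons.IH[of "Suc j"] Cons.prems c_closed A.point_zero[OF w] by (simp add: pointD[OF w] del: Phi.simps)
qed

context
  fixes n :: nat and H
  assumes H_closed: "\<And>t. t \<in> res.G n 1 \<Longrightarrow> H t \<in> carrier A"
    and H_add: "\<And>us i z z' vs. us @ (i, z) # vs \<in> res.G n 1 \<Longrightarrow> us @ (i, z') # vs \<in> res.G n 1 \<Longrightarrow>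
       H (us @ (i, z \<oplus>\<^bsub>P i\<^esub> z') # vs) = H (us @ (i, z) # vs) \<oplus>\<^bsub>A\<^esub> H (us @ (i, z') # vs)"
    and H_smult: "\<And>us i z vs r. us @ (i, z) # vs \<in> res.G n 1 \<Longrightarrow> r \<in> carrier A \<Longrightarrow>
       H (us @ (i, r \<odot>\<^bsub>P i\<^esub> z) # vs) = r \<otimes>\<^bsub>A\<^esub> H (us @ (i, z) # vs)"
  fixes w
  assumes w: "is_point A w"
begin

lemma H_slot_zero:
  assumes g: "\<And>z. z \<in> carrier (P i) \<Longrightarrow> us @ (i, z) # vs \<in> res.G n 1"
  shows "w (H (us @ (i, (\<lambda>_. \<zero>\<^bsub>A\<^esub>)) # vs)) = 0"
  using H_smult[OF g[OF zero_in_free] A.zero_closed] H_closed[OF g[OF zero_in_free]]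
  by (simp add: A.point_zero[OF w])

lemma H_slot_finsum:
  assumes g: "\<And>z. z \<in> carrier (P i) \<Longrightarrow> us @ (i, z) # vs \<in> res.G n 1"
    and h: "h \<in> S \<rightarrow> carrier (P i)"
  shows "w (H (us @ (i, finsum (P i) h S) # vs)) = (\<Sum>s\<in>S. w (H (us @ (i, h s) # vs)))"
proof -
  interpret F: module A "P i" by (rule A.module_free)
  show ?thesis using h
  proof (induction S rule: infinite_finite_induct)
    case (insert s S)
    then have "h s \<in> carrier (P i)" "finsum (P i) h S \<in> carrier (P i)" "h \<in> S \<rightarrow> carrier (P i)"
      by (auto intro!: F.M.finsum_closed)
    then show ?case
      using insert H_add[OF g g] H_closed[OF g] by (simp add: pointD[OF w] del: free_module_simps)
  qed (simp_all add: H_slot_zero[OF g])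
qed

text \<open>At points where all \<open>x a\<close> of the block are 1 the coefficients of the faces
  disappear, and the differential of a lifted block becomes the plain sum of its lifted
  faces.\<close>

lemma H_slot_step:
  assumes b: "b \<noteq> []" "\<And>a. a \<in> set b \<Longrightarrow> w (x a) = 1"
    and m: "us @ (2 - int (length b), phi j (length b - 1) b) # vs \<in> res.G n 0"
  shows "w (H (us @ (3 - int (length b), res_d (2 - int (length b)) (phi j (length b - 1) b)) # vs)) =
    (if 2 \<le> length b then \<Sum>i<length b. w (H (us @ (2 - int (length (del i b)), phi j (length (del i b) - 1) (del i b)) # vs))
     else 0)"
proof -
  have g: "us @ (3 - int (length b), z) # vs \<in> res.G n 1" if "z \<in> carrier (P (3 - int (length b)))" for z
    using m that by (auto simp: tensor_power_gens_iff)
  obtain l where l: "length b = Suc l" using b(1) by (cases b) auto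
  show ?thesis
  proof (cases l)
    \<comment> \<open>A block of length 1 sits in degree 1, the top of the resolution, where the
      differential is 0.\<close>
    case 0
    then show ?thesis using l H_slot_zero[OF g] by (simp add: res_d_def)
  next
    case (Suc k)
    then have lb: "length b = Suc (Suc k)" using l by simp
    have deg: "3 - int (length b) = 1 - int k" "2 - int (length b) = - int k" using lb by auto
    have del: "length (del i b) = Suc k" if "i < length b" for i using that lb by (simp add: length_del)
    have ph: "phi j k (del i b) \<in> carrier (P (1 - int k))" if "i < length b" for i
      using phi_closed[OF del[OF that]] .
    interpret F: module A "P (1 - int k)" by (rule A.module_free)
    note g' = g[unfolded deg]
    have "w (H (us @ (1 - int k, faces j k b) # vs)) =
        (\<Sum>i<length b. w (H (us @ (1 - int k, x (b ! i) \<odot>\<^bsub>P (1 - int k)\<^esub> phi j k (del i b)) # vs)))"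
      unfolding faces_def using ph x_closed by (intro H_slot_finsum g') (auto simp del: free_module_simps)
    also have "\<dots> = (\<Sum>i<length b. w (H (us @ (1 - int k, phi j k (del i b)) # vs)))"
      using ph x_closed H_smult[OF g'] H_closed[OF g'] b(2)
      by (intro sum.cong) (simp_all add: pointD[OF w] del: free_module_simps)
    also have "\<dots> = (\<Sum>i<length b. w (H (us @ (2 - int (length (del i b)), phi j (length (del i b) - 1) (del i b)) # vs)))"
      by (intro sum.cong) (simp_all add: del)
    finally have eq: "w (H (us @ (1 - int k, faces j k b) # vs)) =
      (\<Sum>i<length b. w (H (us @ (2 - int (length (del i b)), phi j (length (del i b) - 1) (del i b)) # vs)))" .
    have "length b - 1 = Suc k" using lb by simp
    then show ?thesis
      unfolding deg using phi_diff[OF lb, of j] eq lb by (simp del: sum.lessThan_Suc)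
  qed
qed

lemma H_boundary:
  assumes "us @ Phi j t \<in> res.G n 0" "\<forall>b \<in> set t. b \<noteq> [] \<and> (\<forall>a \<in> set b. w (x a) = 1)"
  shows "(\<Sum>l<length t. w (H (tensor_step res_d (us @ Phi j t) (length us + l)))) =
    bdry t (\<lambda>t'. w (H (us @ Phi j t')))"
  using assms
proof (induction t arbitrary: us j)
  case (Cons b t)
  let ?z = "(2 - int (length b), phi j (length b - 1) b)"
  have "(\<Sum>l<length t. w (H (tensor_step res_d ((us @ [?z]) @ Phi (Suc j) t) (length (us @ [?z]) + l)))) =
    bdry t (\<lambda>t'. w (H ((us @ [?z]) @ Phi (Suc j) t')))"
    using Cons.prems by (intro Cons.IH) simp_all
  moreover have "w (H (tensor_step res_d (us @ ?z # Phi (Suc j) t) (length us))) =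
    (if 2 \<le> length b then \<Sum>i<length b. w (H (us @ Phi j (del i b # t))) else 0)"
    using H_slot_step[of b us j "Phi (Suc j) t"] Cons.prems by (simp add: tensor_step_middle)
  ultimately show ?case
    by (simp add: sum.lessThan_Suc_shift del: sum.lessThan_Suc)
qed simp

end

text \<open>\<open>b\<close> is the functional \<open>H\<close> pulled back along the
  Alexander-Whitney cuts and the lifts. Its coboundary is \<open>H\<close> applied to the
  differential of the lifted tensors, thus their value in the base, and there only the cut into
  edges survives.\<close>

theorem descendable_cochain:
  assumes "descendable_index_le A B f n" "0 < n"
  shows "\<exists>b. (\<forall>as. length as = n \<longrightarrow> b as \<in> carrier A) \<and>
    (\<forall>as w. is_point A w \<longrightarrow> length as = Suc n \<longrightarrow> (\<forall>a \<in> set as. w (x a) = 1) \<longrightarrow>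
      (\<Sum>i<Suc n. w (b (del i as))) = (\<Prod>j<n. w (c j (as ! j) (as ! Suc j))))"
proof -
  obtain H where H: "\<And>t. t \<in> res.G n 1 \<Longrightarrow> H t \<in> carrier A"
    "\<And>us i z z' vs. us @ (i, z) # vs \<in> res.G n 1 \<Longrightarrow> us @ (i, z') # vs \<in> res.G n 1 \<Longrightarrow>
       H (us @ (i, z \<oplus>\<^bsub>P i\<^esub> z') # vs) = H (us @ (i, z) # vs) \<oplus>\<^bsub>A\<^esub> H (us @ (i, z') # vs)"
    "\<And>us i z vs r. us @ (i, z) # vs \<in> res.G n 1 \<Longrightarrow> r \<in> carrier A \<Longrightarrow>
       H (us @ (i, r \<odot>\<^bsub>P i\<^esub> z) # vs) = r \<otimes>\<^bsub>A\<^esub> H (us @ (i, z) # vs)"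
    and eq: "\<And>t. t \<in> res.G n 0 \<Longrightarrow>
       finsum A (\<lambda>j. H (tensor_step res_d t j)) {..<n} = A.tensor_value res_eps t"
    by (rule descendable_functional[OF assms(1)], rule that)
  define b where "b as = foldr (\<lambda>t r. H (Phi 0 t) \<oplus>\<^bsub>A\<^esub> r) (aw_terms n as) \<zero>\<^bsub>A\<^esub>" for as
  have Hc: "H (Phi 0 t) \<in> carrier A" if "t \<in> set (aw_terms n as)" "length as = n" for t as
    using Phi_gens[OF that(1), of 0] that(2) by (intro H(1)) simp
  have fold: "foldr (\<lambda>t r. H (Phi 0 t) \<oplus>\<^bsub>A\<^esub> r) ts \<zero>\<^bsub>A\<^esub> \<in> carrier A \<and>
      (is_point A w \<longrightarrow> w (foldr (\<lambda>t r. H (Phi 0 t) \<oplus>\<^bsub>A\<^esub> r) ts \<zero>\<^bsub>A\<^esub>) = (\<Sum>t\<leftarrow>ts. w (H (Phi 0 t))))"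
    if "\<And>t. t \<in> set ts \<Longrightarrow> H (Phi 0 t) \<in> carrier A" for ts w
    using that
  proof (induction ts)
    case Nil
    then show ?case using A.point_zero[of w] by simp
  next
    case (Cons t ts)
    then show ?case using pointD(2)[of A w] by simp
  qed
  have b_closed: "b as \<in> carrier A" if "length as = n" for as
    unfolding b_def using fold[OF Hc[OF _ that]] by blast
  have b_point: "w (b as) = aw_sum n as (\<lambda>t. w (H (Phi 0 t)))" if "length as = n" "is_point A w" for as w
    unfolding b_def aw_sum_def using fold[OF Hc[OF _ that(1)]] that(2) by blast
  have "(\<Sum>i<Suc n. w (b (del i as))) = (\<Prod>j<n. w (c j (as ! j) (as ! Suc j)))"
    if w: "is_point A w" and len: "length as = Suc n" and wx: "\<forall>a \<in> set as. w (x a) = 1" for as w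
  proof -
    have "(\<Sum>i<Suc n. w (b (del i as))) = (\<Sum>i<length as. aw_sum n (del i as) (\<lambda>t. w (H (Phi 0 t))))"
      using len w by (intro sum.cong) (simp_all add: b_point length_del)
    \<comment> \<open>Since \<open>0 < n\<close>, the list has at least two entries, as the formula
      with faces requires.\<close>
    also have "\<dots> = aw_sum n as (\<lambda>t. bdry t (\<lambda>t'. w (H (Phi 0 t'))))"
      using alexander_whitney[of n as "\<lambda>t. w (H (Phi 0 t))"] len assms(2) by simp
    also have "\<dots> = aw_sum n as (tprod (\<lambda>j b. if length b = 2 then w (c j (b ! 0) (b ! 1)) else 0) 0)"
      unfolding aw_sum_def
    proof (intro arg_cong[where f = sum_list] map_cong refl)
      fix t assume t: "t \<in> set (aw_terms n as)"
      note p = aw_terms_props[OF t]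
      have G: "Phi 0 t \<in> res.G n 0" using Phi_gens[OF t, of 0] len by simp
      have st: "H (tensor_step res_d (Phi 0 t) j) \<in> carrier A" if "j < n" for j
        using res.gens_step[OF G that] by (intro H(1)) simp
      have pt: "\<forall>b \<in> set t. b \<noteq> [] \<and> (\<forall>a \<in> set b. w (x a) = 1)" using p wx by blast
      have "bdry t (\<lambda>t'. w (H (Phi 0 t'))) = (\<Sum>l<n. w (H (tensor_step res_d (Phi 0 t) l)))"
        using H_boundary[OF H(1-3) w, where us = "[]" and j = 0 and t = t] G pt p by simp
      also have "\<dots> = w (finsum A (\<lambda>j. H (tensor_step res_d (Phi 0 t) j)) {..<n})"
      proof -
        have "w (finsum A h S) = (\<Sum>s\<in>S. w (h s))" if "h \<in> S \<rightarrow> carrier A" for h and S :: "nat set"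
          using that
          by (induction S rule: infinite_finite_induct) (simp_all add: A.point_zero[OF w] pointD[OF w] Pi_iff)
        then show ?thesis using st by auto
      qed
      also have "\<dots> = tprod (\<lambda>j b. if length b = 2 then w (c j (b ! 0) (b ! 1)) else 0) 0 t"
        using eq[OF G] point_tensor_value[OF w, of t 0] p by simp
      finally show "bdry t (\<lambda>t'. w (H (Phi 0 t'))) =
        tprod (\<lambda>j b. if length b = 2 then w (c j (b ! 0) (b ! 1)) else 0) 0 t" .
    qed
    also have "\<dots> = (\<Prod>j<n. w (c j (as ! j) (as ! Suc j)))"
      by (subst aw_sum_tprod) (use len in auto)
    finally show ?thesis .
  qed
  then show ?thesis using b_closed by blast
qed

end

text \<open>The empty tensor power is \<open>A\<close> in degree 0 and its map to \<open>A\<close>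
  is the identity. The homotopy equation for the empty tensor compares an empty sum with 1.\<close>

lemma (in bool_ext) not_descendable_zero:
  assumes "\<one>\<^bsub>A\<^esub> \<noteq> \<zero>\<^bsub>A\<^esub>"
  shows "\<not> descendable_index_le A B f 0"
proof
  assume d: "descendable_index_le A B f 0"
  obtain H where "\<And>t. t \<in> res.G 0 0 \<Longrightarrow>
       finsum A (\<lambda>j. H (tensor_step res_d t j)) {..<0 :: nat} = A.tensor_value res_eps t"
    by (rule descendable_functional[OF d], rule that)
  from this[of "[]"] show False
    using assms by (simp add: tensor_power_gens_def A.tensor_value_def)
qed

section \<open>Free sets and alephs\<close>

lemma is_aleph_infinite: "is_aleph m r \<Longrightarrow> infinite (Field r)"
proof (induction m arbitrary: r)
  case 0
  then have "(natLeq, r) \<in> ordLeq"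
    by (simp add: ordIso_symmetric ordIso_imp_ordLeq)
  then have "(card_of (Field natLeq), card_of (Field r)) \<in> ordLeq" by (rule card_of_mono2)
  then show ?case
    using card_of_ordLeq_infinite Field_natLeq infinite_UNIV_nat by metis
next
  case (Suc m)
  then obtain s :: "'a rel" where s: "is_aleph m s" "(r, cardSuc s) \<in> ordIso" by auto
  have "(s, r) \<in> ordLeq"
    using s ordLess_ordIso_trans[OF cardSuc_greater[OF is_aleph_Card_order[OF s(1)]] ordIso_symmetric[OF s(2)]]
    by (simp add: ordLess_imp_ordLeq)
  then have "(card_of (Field s), card_of (Field r)) \<in> ordLeq" by (rule card_of_mono2)
  then show ?case using Suc.IH[OF s(1)] card_of_ordLeq_infinite by blast
qed

lemma is_aleph_less:
  assumes "is_aleph (m + Suc l) K"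
  shows "\<exists>s :: 'a rel. is_aleph m s \<and> (s, K :: 'a rel) \<in> ordLess"
  using assms
proof (induction l arbitrary: K)
  case 0
  then obtain s :: "'a rel" where s: "is_aleph m s" "(K, cardSuc s) \<in> ordIso" by auto
  then show ?case
    using ordLess_ordIso_trans[OF cardSuc_greater[OF is_aleph_Card_order[OF s(1)]] ordIso_symmetric[OF s(2)]] by blast
next
  case (Suc l)
  then obtain t :: "'a rel" where t: "is_aleph (m + Suc l) t" "(K, cardSuc t) \<in> ordIso" by auto
  then have tK: "(t, K) \<in> ordLess"
    using ordLess_ordIso_trans[OF cardSuc_greater[OF is_aleph_Card_order[OF t(1)]] ordIso_symmetric[OF t(2)]] by blast
  obtain s :: "'a rel" where "is_aleph m s" "(s, t) \<in> ordLess" using Suc.IH[OF t(1)] by blast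
  then show ?case using ordLess_transitive[OF _ tK] by blast
qed

text \<open>The easy half of the Kuratowski-Sierpinski characterisation of aleph-n by free sets.\<close>

lemma free_list:
  fixes Z :: "'i set" and r :: "'i rel"
  assumes "is_aleph n r" "(r, card_of Z) \<in> ordLeq" "\<And>as. finite (F as)"
  shows "\<exists>as. length as = Suc n \<and> distinct as \<and> set as \<subseteq> Z \<and> (\<forall>i \<le> n. as ! i \<notin> F (del i as))"
  using assms
proof (induction n arbitrary: r Z F)
  case 0
  have "infinite Z"
    using is_aleph_infinite[OF 0(1)] card_of_mono2[OF 0(2)] card_of_ordLeq_infinite by (metis Field_card_of)
  then obtain a where "a \<in> Z" "a \<notin> F []"
    using 0(3)[of "[]"] by (meson finite_subset subsetI)
  then show ?case by (intro exI[of _ "[a]"]) (simp add: del_def)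
next
  case (Suc n)
  then obtain s :: "'i rel" where s: "is_aleph n s" "(r, cardSuc s) \<in> ordIso" by auto
  note cs = is_aleph_Card_order[OF s(1)]
  have sZ: "(s, card_of Z) \<in> ordLess"
    using ordLess_ordIso_trans[OF cardSuc_greater[OF cs] ordIso_symmetric[OF s(2)]] Suc.prems(2)
    by (rule ordLess_ordLeq_trans)
  then have "(card_of (Field s), card_of Z) \<in> ordLeq"
    using card_of_mono2[OF ordLess_imp_ordLeq[OF sZ]] by simp
  then obtain g where g: "inj_on g (Field s)" "g ` Field s \<subseteq> Z" unfolding card_of_ordLeq[symmetric] by blast
  \<comment> \<open>A part of \<open>Z\<close> of size aleph-n, strictly smaller than
    \<open>Z\<close>, on which the induction hypothesis will act.\<close>
  define Y where "Y = g ` Field s"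
  have Ys: "(card_of Y, s) \<in> ordIso"
  proof -
    have "(card_of (Field s), card_of Y) \<in> ordIso"
      using g(1) unfolding Y_def by (intro card_of_ordIsoI) (rule inj_on_imp_bij_betw)
    then show ?thesis
      using card_of_Field_ordIso[OF cs] ordIso_symmetric ordIso_transitive by blast
  qed
  have infY: "infinite Y" using is_aleph_infinite[OF s(1)] g(1) by (simp add: Y_def finite_image_iff)
  \<comment> \<open>All values of \<open>F\<close> on lists from \<open>Y\<close>. There are at most
    as many as elements of \<open>Y\<close>, so some \<open>b\<close> in \<open>Z\<close> avoids
    \<open>Y\<close> and \<open>U\<close>; it serves as the last entry.\<close>
  define U where "U = (\<Union>as\<in>lists Y. F as)"
  have "(card_of U, card_of Y) \<in> ordLeq" unfolding U_def
  proof (rule card_of_UNION_ordLeq_infinite[OF infY])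
    show "(card_of (lists Y), card_of Y) \<in> ordLeq"
      using card_of_lists_infinite[OF infY] by (rule ordIso_imp_ordLeq)
    show "\<forall>as\<in>lists Y. (card_of (F as), card_of Y) \<in> ordLeq"
      using Suc.prems(3) infY by (auto intro!: ordLess_imp_ordLeq finite_ordLess_infinite2)
  qed
  then have "(card_of (Y \<union> U), card_of Y) \<in> ordLeq"
    using card_of_Un_ordLeq_infinite[OF infY, of Y U] card_of_refl ordIso_imp_ordLeq by blast
  then have "(card_of (Y \<union> U), card_of Z) \<in> ordLess"
    using ordLeq_ordLess_trans[OF _ ordIso_ordLess_trans[OF Ys sZ]] by blast
  then have "\<not> Z \<subseteq> Y \<union> U"
    using card_of_mono1[of Z "Y \<union> U"] not_ordLess_ordLeq by blast
  then obtain b where b: "b \<in> Z" "b \<notin> Y" "b \<notin> U" by blast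
  \<comment> \<open>The entry \<open>b\<close> is built into \<open>F\<close>, because deleting any
    earlier entry of the longer list leaves \<open>b\<close> at its end.\<close>
  obtain as where as: "length as = Suc n" "distinct as" "set as \<subseteq> Y" "\<forall>i \<le> n. as ! i \<notin> F (del i as @ [b])"
    using Suc.IH[OF s(1) ordIso_imp_ordLeq[OF ordIso_symmetric[OF Ys]], of "\<lambda>as. F (as @ [b])"] Suc.prems(3) by blast
  show ?case
  proof (intro exI[of _ "as @ [b]"] conjI allI impI)
    show "set (as @ [b]) \<subseteq> Z" using as(3) g(2) b(1) by (auto simp: Y_def)
    fix i assume "i \<le> Suc n"
    then consider "i \<le> n" | "i = Suc n" by linarith
    then show "(as @ [b]) ! i \<notin> F (del i (as @ [b]))"
    proof cases
      case 1
      then have "del i (as @ [b]) = del i as @ [b]" using as(1) by (simp add: del_def)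
      then show ?thesis using 1 as(1,4) by (simp add: nth_append)
    next
      case 2
      then have "del i (as @ [b]) = as" using as(1) by (simp add: del_def)
      moreover have "as \<in> lists Y" using as(3) by blast
      ultimately show ?thesis using 2 as(1) b(3) by (auto simp: U_def nth_append)
    qed
  qed (use as b(2) in auto)
qed

section \<open>Sums over injective maps\<close>

definition inj_maps :: "nat \<Rightarrow> (nat \<Rightarrow> nat) set" where
  "inj_maps n = {m \<in> {..<n} \<rightarrow>\<^sub>E {..n}. inj_on m {..<n}}"

lemma finite_inj_maps: "finite (inj_maps n)"
  unfolding inj_maps_def by (rule finite_subset[OF _ finite_PiE[of "{..<n}" "\<lambda>_. {..n}"]]) auto

definition swap_values :: "nat \<Rightarrow> nat \<Rightarrow> nat \<Rightarrow> (nat \<Rightarrow> nat) \<Rightarrow> nat \<Rightarrow> nat" where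
  "swap_values n i i' m = restrict (\<lambda>j. if m j = i then i' else if m j = i' then i else m j) {..<n}"

text \<open>A map in \<open>inj_maps n\<close> omits just one of the \<open>n + 1\<close> values. It
  therefore takes at least one of \<open>i\<close> and \<open>i'\<close>, and exchanging them
  changes the map.\<close>

lemma sum_swap_zero:
  fixes g :: "(nat \<Rightarrow> nat) \<Rightarrow> bit"
  assumes "i \<le> n" "i' \<le> n" "i \<noteq> i'" "\<And>m. m \<in> inj_maps n \<Longrightarrow> g (swap_values n i i' m) = g m"
  shows "(\<Sum>m\<in>inj_maps n. g m) = 0"
proof (rule sum_bit_involution[OF finite_inj_maps, where \<sigma> = "swap_values n i i'"])
  fix m assume m: "m \<in> inj_maps n"
  then have mm: "\<And>j. j < n \<Longrightarrow> m j \<le> n" "inj_on m {..<n}" "\<And>j. \<not> j < n \<Longrightarrow> m j = undefined"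
    by (auto simp: inj_maps_def PiE_def extensional_def)
  have "swap_values n i i' m \<in> inj_maps n"
    using mm assms(1-3) by (auto simp: inj_maps_def swap_values_def inj_on_def split: if_splits)
  moreover have "swap_values n i i' (swap_values n i i' m) = m"
    using mm(3) assms(3) by (auto simp: swap_values_def fun_eq_iff)
  moreover have "swap_values n i i' m \<noteq> m"
  proof
    assume eq: "swap_values n i i' m = m"
    have "m j \<noteq> i \<and> m j \<noteq> i'" if "j < n" for j
      using fun_cong[OF eq, of j] that assms(3) by (auto simp: swap_values_def split: if_splits)
    then have "m ` {..<n} \<subseteq> {..n} - {i, i'}" using mm(1) by auto
    then have "card (m ` {..<n}) \<le> card ({..n} - {i, i'})" by (intro card_mono) auto
    also have "\<dots> = Suc n - 2" using assms(1-3) by (simp add: card_Diff_subset)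
    finally show False using mm(2) assms(1-3) by (simp add: card_image)
  qed
  ultimately show "swap_values n i i' m \<in> inj_maps n \<and> swap_values n i i' m \<noteq> m \<and>
      swap_values n i i' (swap_values n i i' m) = m \<and> g (swap_values n i i' m) = g m"
    using assms(4)[OF m] by blast
qed

lemma sum_shift_one: "(\<Sum>m\<in>inj_maps n. \<Prod>j<n. if m j = Suc j then 1 else 0) = (1 :: bit)"
proof -
  let ?s = "restrict Suc {..<n}"
  have "(\<Prod>j<n. if m j = Suc j then 1 else 0) = (if m = ?s then 1 else (0 :: bit))" if "m \<in> inj_maps n" for m
  proof (cases "m = ?s")
    case False
    then obtain j where "m j \<noteq> ?s j" by (auto simp: fun_eq_iff)
    then have "j < n \<and> m j \<noteq> Suc j" using that by (auto simp: inj_maps_def PiE_def extensional_def split: if_splits)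
    then show ?thesis using False by (auto intro!: prod_zero)
  qed simp
  moreover have "?s \<in> inj_maps n" by (auto simp: inj_maps_def)
  ultimately show ?thesis by (simp add: sum.delta[OF finite_inj_maps] cong: sum.cong)
qed

section \<open>Rings of functions carried by an arbitrary type\<close>

text \<open>The rings have to live on the type of the given cardinal, not on a type of functions.
  \<open>e\<close> names functions by elements of that type and \<open>d\<close> decodes the
  names.\<close>

definition fun_ring :: "(('p \<Rightarrow> bit) \<Rightarrow> 'k) \<Rightarrow> ('k \<Rightarrow> 'p \<Rightarrow> bit) \<Rightarrow> ('p \<Rightarrow> bit) set \<Rightarrow> 'k ring" where
  "fun_ring e d U = \<lparr>carrier = e ` U, monoid.mult = (\<lambda>a b. e (\<lambda>p. d a p * d b p)), monoid.one = e (\<lambda>_. 1),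
     ring.zero = e (\<lambda>_. 0), add = (\<lambda>a b. e (\<lambda>p. d a p + d b p))\<rparr>"

definition fun_closed :: "('p \<Rightarrow> bit) set \<Rightarrow> bool" where
  "fun_closed U \<longleftrightarrow> (\<lambda>_. 0) \<in> U \<and> (\<lambda>_. 1) \<in> U \<and>
     (\<forall>u \<in> U. \<forall>v \<in> U. (\<lambda>p. u p + v p) \<in> U \<and> (\<lambda>p. u p * v p) \<in> U)"

lemma fun_closedD:
  assumes "fun_closed U"
  shows "(\<lambda>_. 0) \<in> U" "(\<lambda>_. 1) \<in> U" "u \<in> U \<Longrightarrow> v \<in> U \<Longrightarrow> (\<lambda>p. u p + v p) \<in> U"
    "u \<in> U \<Longrightarrow> v \<in> U \<Longrightarrow> (\<lambda>p. u p * v p) \<in> U"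
  using assms by (auto simp: fun_closed_def)

context
  fixes e :: "('p \<Rightarrow> bit) \<Rightarrow> 'k" and d U
  assumes d: "\<And>u. u \<in> U \<Longrightarrow> d (e u) = u" and U: "fun_closed U"
begin

lemma fun_ring_simps:
  "carrier (fun_ring e d U) = e ` U" "\<one>\<^bsub>fun_ring e d U\<^esub> = e (\<lambda>_. 1)" "\<zero>\<^bsub>fun_ring e d U\<^esub> = e (\<lambda>_. 0)"
  "u \<in> U \<Longrightarrow> v \<in> U \<Longrightarrow> e u \<oplus>\<^bsub>fun_ring e d U\<^esub> e v = e (\<lambda>p. u p + v p)"
  "u \<in> U \<Longrightarrow> v \<in> U \<Longrightarrow> e u \<otimes>\<^bsub>fun_ring e d U\<^esub> e v = e (\<lambda>p. u p * v p)"
  by (simp_all add: fun_ring_def d)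

lemma bool_ring_fun_ring: "bool_ring (fun_ring e d U)"
proof -
  note D = fun_closedD[OF U]
  have "cring (fun_ring e d U)"
  proof (rule cringI)
    show "abelian_group (fun_ring e d U)"
    proof (rule abelian_groupI)
      fix a assume "a \<in> carrier (fun_ring e d U)"
      then show "\<exists>b\<in>carrier (fun_ring e d U). b \<oplus>\<^bsub>fun_ring e d U\<^esub> a = \<zero>\<^bsub>fun_ring e d U\<^esub>"
        by (intro bexI[of _ a]) (auto simp: fun_ring_simps)
    qed (auto simp: fun_ring_simps D add_ac)
    show "comm_monoid (fun_ring e d U)"
      by (rule comm_monoidI) (auto simp: fun_ring_simps D mult_ac)
  qed (auto simp: fun_ring_simps D distrib_right)
  moreover have "a \<otimes>\<^bsub>fun_ring e d U\<^esub> a = a" if "a \<in> carrier (fun_ring e d U)" for a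
  proof -
    have "(\<lambda>p. u p * u p) = u" for u :: "'p \<Rightarrow> bit"
    proof
      fix p show "u p * u p = u p" by (cases "u p") simp_all
    qed
    then show ?thesis using that by (auto simp: fun_ring_simps)
  qed
  ultimately show ?thesis
    by (simp add: bool_ring_def bool_ring_axioms_def base_ring_def)
qed

lemma fun_ring_point: "is_point (fun_ring e d U) (\<lambda>a. d a p)"
  using fun_closedD[OF U] by (auto simp: is_point_def fun_ring_simps d)

end

lemma boolean_ring_of_bool_ring: "bool_ring R \<Longrightarrow> boolean_ring R"
  unfolding boolean_ring_def bool_ring_def bool_ring_axioms_def base_ring_def
  by (simp add: cring.axioms(1))

lemma bool_ext_fun_ring:
  assumes "\<And>u. u \<in> U \<Longrightarrow> d (e u) = u" "fun_closed U" "fun_closed V" "V \<subseteq> U"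
  shows "bool_ext (fun_ring e d V) (fun_ring e d U) (\<lambda>a. a)"
proof -
  have dV: "\<And>u. u \<in> V \<Longrightarrow> d (e u) = u" using assms(1,4) by blast
  show ?thesis
  proof (intro bool_ext.intro bool_ext_axioms.intro bool_ring_fun_ring assms(1-3) dV)
    show "(\<lambda>a. a) \<in> ring_hom (fun_ring e d V) (fun_ring e d U)"
      using assms(4) by (auto simp: ring_hom_def fun_ring_def)
  qed (use assms(4) in auto)
qed

section \<open>The example\<close>

text \<open>
  A point \<open>p\<close> encodes the set of all \<open>a\<close> with \<open>p (0, a)\<close> together with labellings \<open>p (j + 1, a)\<close>, and
  \<open>flip J\<close> changes the labellings with index in \<open>J\<close> at all elements of that set.
\<close>

definition depends :: "'g set \<Rightarrow> (('g \<Rightarrow> bool) \<Rightarrow> bit) \<Rightarrow> bool" where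
  "depends D u \<longleftrightarrow> (\<forall>p q. (\<forall>g \<in> D. p g = q g) \<longrightarrow> u p = u q)"

lemma dependsD: "depends D u \<Longrightarrow> (\<And>g. g \<in> D \<Longrightarrow> p g = q g) \<Longrightarrow> u p = u q"
  unfolding depends_def by blast

definition cylinders :: "'g set \<Rightarrow> (('g \<Rightarrow> bool) \<Rightarrow> bit) set" where
  "cylinders G = {u. \<exists>D. finite D \<and> D \<subseteq> G \<and> depends D u}"

definition flip :: "nat set \<Rightarrow> (nat \<times> 'k \<Rightarrow> bool) \<Rightarrow> nat \<times> 'k \<Rightarrow> bool" where
  "flip J p = (\<lambda>(i, a). if i \<noteq> 0 \<and> i - 1 \<in> J then p (0, a) \<noteq> p (i, a) else p (i, a))"

definition invariant_cylinders :: "(nat \<times> 'k) set \<Rightarrow> ((nat \<times> 'k \<Rightarrow> bool) \<Rightarrow> bit) set" where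
  "invariant_cylinders G = {u \<in> cylinders G. \<forall>J p. u (flip J p) = u p}"

lemma fun_closed_cylinders: "fun_closed (cylinders G)"
proof -
  have "(\<lambda>p. h (u p) (v p)) \<in> cylinders G" if uv: "u \<in> cylinders G" "v \<in> cylinders G" for u v h
  proof -
    obtain D E where "finite D" "D \<subseteq> G" "depends D u" "finite E" "E \<subseteq> G" "depends E v"
      using uv unfolding cylinders_def by blast
    then have "finite (D \<union> E)" "D \<union> E \<subseteq> G" "depends (D \<union> E) (\<lambda>p. h (u p) (v p))"
      unfolding depends_def by (auto intro!: arg_cong2[where f = h])
    then show ?thesis unfolding cylinders_def by blast
  qed
  moreover have "(\<lambda>_. b) \<in> cylinders G" for b
    unfolding cylinders_def depends_def by (intro CollectI exI[of _ "{}"]) auto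
  ultimately show ?thesis by (simp add: fun_closed_def)
qed

lemma fun_closed_invariant_cylinders: "fun_closed (invariant_cylinders G)"
  using fun_closed_cylinders[of G] by (auto simp: fun_closed_def invariant_cylinders_def)

text \<open>A cylinder function is given by a finite set \<open>D\<close> of coordinates and the
  finite family of those subsets of \<open>D\<close> on which it is 1. An infinite set admits no
  more such pairs than it has elements.\<close>

lemma card_cylinders:
  fixes Z :: "'k set"
  assumes "infinite Z"
  shows "\<exists>e :: ((nat \<times> 'k \<Rightarrow> bool) \<Rightarrow> bit) \<Rightarrow> 'k. inj_on e (cylinders ({..n} \<times> Z)) \<and> e ` cylinders ({..n} \<times> Z) \<subseteq> Z"
proof -
  define G where "G = {..n} \<times> Z"
  have infG: "infinite G" using assms by (auto simp: G_def finite_cartesian_product_iff)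
  have G: "(card_of G, card_of Z) \<in> ordLeq"
    unfolding G_def
  proof (rule card_of_Times_ordLeq_infinite[OF assms])
    show "(card_of {..n}, card_of Z) \<in> ordLeq"
      using assms by (intro ordLess_imp_ordLeq finite_ordLess_infinite2) auto
    show "(card_of Z, card_of Z) \<in> ordLeq" by (intro ordIso_imp_ordLeq card_of_refl)
  qed
  have infF: "infinite (Fpow G)" using card_of_Fpow_infinite[OF infG] infG card_of_ordIso_finite by blast
  have F: "(card_of (Fpow G), card_of Z) \<in> ordLeq"
    using ordIso_ordLeq_trans[OF card_of_Fpow_infinite[OF infG] G] .
  have FF: "(card_of (Fpow (Fpow G)), card_of Z) \<in> ordLeq"
    using ordIso_ordLeq_trans[OF card_of_Fpow_infinite[OF infF] F] .
  let ?h = "\<lambda>(D, S) p. if {g \<in> D. p g} \<in> S then 1 else (0 :: bit)"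
  have "cylinders G \<subseteq> ?h ` (Fpow G \<times> Fpow (Fpow G))"
  proof
    fix u :: "(nat \<times> 'k \<Rightarrow> bool) \<Rightarrow> bit" assume "u \<in> cylinders G"
    then obtain D where D: "finite D" "D \<subseteq> G" "depends D u" unfolding cylinders_def by blast
    let ?S = "{t. t \<subseteq> D \<and> u (\<lambda>g. g \<in> t) = 1}"
    have "u p = ?h (D, ?S) p" for p
    proof -
      have "u (\<lambda>g. g \<in> {g \<in> D. p g}) = u p" using D(3) by (rule dependsD) simp
      then show ?thesis by (cases "u p") auto
    qed
    then have "u = ?h (D, ?S)" by blast
    moreover have "(D, ?S) \<in> Fpow G \<times> Fpow (Fpow G)"
      using D(1,2) by (auto simp: Fpow_def intro: finite_subset)
    ultimately show "u \<in> ?h ` (Fpow G \<times> Fpow (Fpow G))" by blast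
  qed
  then have "(card_of (cylinders G), card_of (Fpow G \<times> Fpow (Fpow G))) \<in> ordLeq" by (rule surj_imp_ordLeq)
  moreover have "(card_of (Fpow G \<times> Fpow (Fpow G)), card_of Z) \<in> ordLeq"
    by (rule card_of_Times_ordLeq_infinite[OF assms F FF])
  ultimately have "(card_of (cylinders G), card_of Z) \<in> ordLeq" by (rule ordLeq_transitive)
  then show ?thesis unfolding card_of_ordLeq[symmetric] G_def .
qed

context
  fixes n :: nat and Z :: "'k set" and s :: "'k rel" and e :: "((nat \<times> 'k \<Rightarrow> bool) \<Rightarrow> bit) \<Rightarrow> 'k" and d
  assumes n: "0 < n" and s: "is_aleph n s" "(s, card_of Z) \<in> ordLeq"
    and d: "\<And>u. u \<in> cylinders ({..n} \<times> Z) \<Longrightarrow> d (e u) = u"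
begin

abbreviation "U \<equiv> cylinders ({..n} \<times> Z)"
abbreviation "V \<equiv> invariant_cylinders ({..n} \<times> Z)"

text \<open>The value is 0 outside the allowed coordinates, so that every pair of indices yields a
  cylinder function, as \<open>bool_cocycle\<close> asks for all indices.\<close>

definition coord :: "nat \<Rightarrow> 'k \<Rightarrow> (nat \<times> 'k \<Rightarrow> bool) \<Rightarrow> bit" where
  "coord i a p = (if a \<in> Z \<and> i \<le> n \<and> p (i, a) then 1 else 0)"

definition coord_diff :: "nat \<Rightarrow> 'k \<Rightarrow> 'k \<Rightarrow> (nat \<times> 'k \<Rightarrow> bool) \<Rightarrow> bit" where
  "coord_diff j a b p = coord 0 a p * coord 0 b p * (coord (Suc j) a p + coord (Suc j) b p)"

lemma V_subset: "V \<subseteq> U"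
  by (auto simp: invariant_cylinders_def)

lemma coord_closed: "coord i a \<in> U"
proof (cases "a \<in> Z \<and> i \<le> n")
  case True
  then have "depends {(i, a)} (coord i a)" by (simp add: depends_def coord_def)
  then show ?thesis using True unfolding cylinders_def by (intro CollectI exI[of _ "{(i, a)}"]) auto
next
  case False
  then have "coord i a = (\<lambda>_. 0)" by (auto simp: coord_def)
  then show ?thesis using fun_closedD(1)[OF fun_closed_cylinders] by metis
qed

lemma coord_0_invariant: "coord 0 a \<in> V"
  using coord_closed[of 0 a] by (auto simp: invariant_cylinders_def coord_def flip_def)

text \<open>Where \<open>a\<close> and \<open>b\<close> both lie in the set, a flip changes both
  labels or neither, so their sum is unchanged; elsewhere the product is 0.\<close>

lemma coord_diff_invariant: "coord_diff j a b \<in> V"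
proof -
  note D = fun_closedD[OF fun_closed_cylinders]
  have "coord_diff j a b (flip J p) = coord_diff j a b p" for J p
    by (auto simp: coord_diff_def coord_def flip_def)
  moreover have "coord_diff j a b \<in> U"
    unfolding coord_diff_def[abs_def] by (intro D coord_closed)
  ultimately show ?thesis by (simp add: invariant_cylinders_def)
qed

lemma bool_cocycle_example:
  "bool_cocycle (fun_ring e d V) (fun_ring e d U) (\<lambda>a. a) (\<lambda>a. e (coord 0 a)) (\<lambda>j a. e (coord (Suc j) a))
     (\<lambda>j a b. e (coord_diff j a b))"
proof (intro bool_cocycle.intro bool_cocycle_axioms.intro bool_ext_fun_ring d fun_closed_cylinders
    fun_closed_invariant_cylinders V_subset)
  note U = fun_ring_simps[where U = U and d = d and e = e, OF d fun_closed_cylinders]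
  note D = fun_closedD[OF fun_closed_cylinders[of "{..n} \<times> Z"]]
  show "e (coord 0 a) \<in> carrier (fun_ring e d V)" for a
    using coord_0_invariant by (simp add: fun_ring_def)
  show "e (coord (Suc j) a) \<in> carrier (fun_ring e d U)" for j a
    using coord_closed by (simp add: fun_ring_def)
  show "e (coord_diff j a b) \<in> carrier (fun_ring e d V)" for j a b
    using coord_diff_invariant by (simp add: fun_ring_def)
  show "e (coord_diff j a b) = e (coord 0 a) \<otimes>\<^bsub>fun_ring e d U\<^esub> e (coord 0 b) \<otimes>\<^bsub>fun_ring e d U\<^esub>
      (e (coord (Suc j) a) \<oplus>\<^bsub>fun_ring e d U\<^esub> e (coord (Suc j) b))" for j a b
    using D(3)[OF coord_closed[of "Suc j" a] coord_closed[of "Suc j" b]]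
      D(4)[OF coord_closed[of 0 a] coord_closed[of 0 b]] coord_closed
    by (simp add: U coord_diff_def[abs_def])
qed

theorem example_not_descendable: "\<not> descendable_index_le (fun_ring e d V) (fun_ring e d U) (\<lambda>a. a) n"
proof
  interpret bool_cocycle "fun_ring e d V" "fun_ring e d U" "\<lambda>a. a" "\<lambda>a. e (coord 0 a)"
    "\<lambda>j a. e (coord (Suc j) a)" "\<lambda>j a b. e (coord_diff j a b)" by (rule bool_cocycle_example)
  assume "descendable_index_le (fun_ring e d V) (fun_ring e d U) (\<lambda>a. a) n"
  then obtain b where b: "\<And>as. length as = n \<Longrightarrow> b as \<in> carrier (fun_ring e d V)"
    and eq: "\<And>as w. is_point (fun_ring e d V) w \<Longrightarrow> length as = Suc n \<Longrightarrow> \<forall>a\<in>set as. w (e (coord 0 a)) = 1 \<Longrightarrow>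
      (\<Sum>i<Suc n. w (b (del i as))) = (\<Prod>j<n. w (e (coord_diff j (as ! j) (as ! Suc j))))"
    using descendable_cochain[OF _ n] by blast
  have dV: "\<And>u. u \<in> V \<Longrightarrow> d (e u) = u" using d V_subset by blast
  define u where "u as = d (b as)" for as
  have uV: "u as \<in> V" if "length as = n" for as
    using b[OF that] dV by (auto simp: u_def fun_ring_def)
  \<comment> \<open>Every member of the cochain depends on finitely many coordinates; these sets are
    fed to the free set lemma.\<close>
  have "\<exists>D. finite D \<and> (length as = n \<longrightarrow> depends D (u as))" for as
  proof (cases "length as = n")
    case True
    then show ?thesis using uV[OF True] by (auto simp: invariant_cylinders_def cylinders_def)
  qed auto
  then obtain D where D: "\<And>as. finite (D as)" "\<And>as. length as = n \<Longrightarrow> depends (D as) (u as)" by metis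
  obtain as where as: "length as = Suc n" "distinct as" "set as \<subseteq> Z" "\<forall>i \<le> n. as ! i \<notin> snd ` D (del i as)"
    using free_list[OF s, of "\<lambda>as. snd ` D as"] D(1) by blast
  \<comment> \<open>The set is all of \<open>as\<close>, and labelling \<open>j\<close> is the step
    function along \<open>as\<close> that jumps from 0 to 1 at position \<open>m j\<close>.\<close>
  define pt where "pt m = (\<lambda>(i, a). if i = 0 then a \<in> set as
      else i - 1 < n \<and> (\<exists>l \<le> n. a = as ! l \<and> m (i - 1) \<le> l))" for m :: "nat \<Rightarrow> nat"
  have pt_0: "pt m (0, a) = (a \<in> set as)" for m a by (simp add: pt_def)
  have pt_Suc: "pt m (Suc j, as ! l) = (m j \<le> l)" if "j < n" "l \<le> n" for m j l
    using that as(1,2) by (auto simp: pt_def nth_eq_iff_index_eq)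
  have pt_out: "\<not> pt m (Suc j, a)" if "n \<le> j \<or> a \<notin> set as" for m j a
    using that as(1) by (auto simp: pt_def)
  have idx: "\<exists>l \<le> n. a = as ! l" if "a \<in> set as" for a
    using that as(1) by (metis in_set_conv_nth less_Suc_eq_le)
  have inZ: "as ! l \<in> Z" if "l \<le> n" for l
    using that as(1,3) nth_mem[of l as] by auto
  \<comment> \<open>Factor \<open>j\<close> of the cocycle compares labelling \<open>j\<close> at
    the positions \<open>j\<close> and \<open>j + 1\<close>, so it is 1 exactly if the jump
    \<open>m j\<close> is at \<open>j + 1\<close>.\<close>
  have main: "(\<Sum>i<Suc n. u (del i as) (pt m)) = (\<Prod>j<n. if m j = Suc j then 1 else 0)" for m
  proof -
    let ?w = "\<lambda>a. d a (pt m)"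
    have w: "is_point (fun_ring e d V) ?w"
      by (rule fun_ring_point[OF dV fun_closed_invariant_cylinders])
    have "?w (e (coord 0 a)) = 1" if "a \<in> set as" for a
      using that as(3) by (auto simp: d[OF coord_closed] coord_def pt_0)
    then have "(\<Sum>i<Suc n. ?w (b (del i as))) = (\<Prod>j<n. ?w (e (coord_diff j (as ! j) (as ! Suc j))))"
      using eq[OF w as(1)] by blast
    also have "\<dots> = (\<Prod>j<n. if m j = Suc j then 1 else 0)"
    proof (rule prod.cong[OF refl])
      fix j assume "j \<in> {..<n}"
      then have j: "j < n" by simp
      have "as ! j \<in> set as" "as ! Suc j \<in> set as" using j as(1) by auto
      then show "?w (e (coord_diff j (as ! j) (as ! Suc j))) = (if m j = Suc j then 1 else 0)"
        using j inZ[of j] inZ[of "Suc j"] dV[OF coord_diff_invariant]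
        by (auto simp: coord_diff_def coord_def pt_0 pt_Suc)
    qed
    finally show ?thesis by (simp add: u_def)
  qed
  have zero: "(\<Sum>m\<in>inj_maps n. u (del i as) (pt m)) = 0" if i: "i \<le> n" for i
  proof -
    have li: "length (del i as) = n" using i as(1) by (simp add: length_del)
    have away: "a \<noteq> as ! i" if "(k, a) \<in> D (del i as)" for k a
      using as(4) i that by force
    show ?thesis
    proof (cases "i < n")
      case True
      \<comment> \<open>Moving a jump between \<open>i\<close> and \<open>i + 1\<close> alters a
        step function only at position \<open>i\<close>, and the coordinates of
        \<open>as ! i\<close> are invisible to this \<open>u\<close>.\<close>
      show ?thesis
      proof (rule sum_swap_zero[of i n "Suc i"])
        fix m
        show "u (del i as) (pt (swap_values n i (Suc i) m)) = u (del i as) (pt m)"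
        proof (rule dependsD[OF D(2)[OF li]])
          fix g assume g: "g \<in> D (del i as)"
          obtain k a where ka: "g = (k, a)" by (cases g)
          show "pt (swap_values n i (Suc i) m) g = pt m g"
          proof (cases "\<exists>j l. k = Suc j \<and> j < n \<and> l \<le> n \<and> a = as ! l")
            case True
            then obtain j l where jl: "k = Suc j" "j < n" "l \<le> n" "a = as ! l" by blast
            then have "l \<noteq> i" using away g ka by blast
            then show ?thesis using jl by (auto simp: ka pt_Suc swap_values_def)
          next
            case False
            then show ?thesis using idx pt_out by (cases k) (auto simp: ka pt_0 not_less)
          qed
        qed
      qed (use True in auto)
    next
      case False
      then have i_n: "i = n" using i by simp
      show ?thesis
      proof (rule sum_swap_zero[of n n 0])
        fix m
        let ?m = "swap_values n n 0 m"
        \<comment> \<open>The labellings whose jump moves between 0 and n. On positions below n a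
          jump at 0 means constantly 1 and a jump at n constantly 0, so each of these labellings is
          complemented there. Position n is invisible to \<open>u\<close>, and
          \<open>flip ?J\<close> undoes the rest.\<close>
        let ?J = "{j. j < n \<and> (m j = 0 \<or> m j = n)}"
        have "u (del i as) (pt ?m) = u (del i as) (flip ?J (pt ?m))"
          using uV[OF li] by (simp add: invariant_cylinders_def)
        also have "\<dots> = u (del i as) (pt m)"
        proof (rule dependsD[OF D(2)[OF li]])
          fix g assume g: "g \<in> D (del i as)"
          obtain k a where ka: "g = (k, a)" by (cases g)
          show "flip ?J (pt ?m) g = pt m g"
          proof (cases "\<exists>j l. k = Suc j \<and> j < n \<and> l \<le> n \<and> a = as ! l")
            case True
            then obtain j l where jl: "k = Suc j" "j < n" "l \<le> n" "a = as ! l" by blast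
            then have "l < n" using away g ka i_n by (metis le_neq_implies_less)
            moreover have "as ! l \<in> set as" using jl(3) as(1) by simp
            ultimately show ?thesis using jl n by (auto simp: ka flip_def pt_0 pt_Suc swap_values_def)
          next
            case False
            then show ?thesis using idx pt_out by (cases k) (auto simp: ka flip_def pt_0 not_less)
          qed
        qed
        finally show "u (del i as) (pt ?m) = u (del i as) (pt m)" .
      qed (use n in auto)
    qed
  qed
  \<comment> \<open>The double sum is evaluated in both orders: over \<open>i\<close> first it is 1,
    because only the successor map contributes, and over \<open>m\<close> first it is 0.\<close>
  have "(1 :: bit) = (\<Sum>m\<in>inj_maps n. \<Sum>i<Suc n. u (del i as) (pt m))"
    using sum_shift_one[of n] main by simp
  also have "\<dots> = (\<Sum>i<Suc n. \<Sum>m\<in>inj_maps n. u (del i as) (pt m))" by (rule sum.swap)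
  also have "\<dots> = 0" using zero by (intro sum.neutral) simp
  finally show False by simp
qed

end

theorem theorem3p15:
  fixes n :: nat and K :: "'k rel"
  assumes "is_aleph (2 * n) K"
  shows "\<exists>(B :: 'k ring) (B' :: 'k ring) f.
           boolean_ring B \<and> boolean_ring B' \<and> faithfully_flat B B' f \<and>
           \<not> descendable_index_le B B' f n \<and>
           (card_of (carrier B'), K) \<in> ordLess"
proof (cases "n = 0")
  case True
  have inf: "infinite (Field K)" by (rule is_aleph_infinite[OF assms])
  obtain a b where ab: "a \<noteq> b" "a \<in> Field K"
    using inf by (metis finite.emptyI finite_insert infinite_imp_nonempty insertI1 subsetI finite_subset singletonI all_not_in_conv)
  \<comment> \<open>For \<open>n = 0\<close> the ring has to be finite. The functions on a one-point
    type form the field with two elements, carried here by two elements of the given type.\<close>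
  define e where "e u = (if u = (\<lambda>_. 0) then a else b)" for u :: "unit \<Rightarrow> bit"
  define d where "d c = (\<lambda>_ :: unit. if c = a then 0 else (1 :: bit))" for c
  have UN: "u = (\<lambda>_. 0) \<or> u = (\<lambda>_. 1)" for u :: "unit \<Rightarrow> bit"
    by (cases "u ()") (auto simp: fun_eq_iff)
  have de: "d (e u) = u" for u
    using UN[of u] ab(1) by (auto simp: e_def d_def fun_eq_iff)
  have cl: "fun_closed (UNIV :: (unit \<Rightarrow> bit) set)" by (simp add: fun_closed_def)
  let ?B = "fun_ring e d UNIV"
  interpret bool_ext ?B ?B "\<lambda>a. a" using de cl by (intro bool_ext_fun_ring) auto
  have "\<one>\<^bsub>?B\<^esub> \<noteq> \<zero>\<^bsub>?B\<^esub>" using ab(1) by (auto simp: fun_ring_def e_def fun_eq_iff)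
  then have "\<not> descendable_index_le ?B ?B (\<lambda>a. a) n" using True not_descendable_zero by simp
  moreover have "finite (carrier ?B)"
    by (rule finite_subset[of _ "{a, b}"]) (auto simp: fun_ring_def e_def)
  then have "(card_of (carrier ?B), K) \<in> ordLess"
    using inf card_of_Field_ordIso[OF is_aleph_Card_order[OF assms]]
    by (intro ordLess_ordIso_trans[OF finite_ordLess_infinite2]) auto
  ultimately show ?thesis
    using faithfully_flat_extension boolean_ring_of_bool_ring[OF A.bool_ring_axioms] by blast
next
  case False
  \<comment> \<open>For \<open>n > 0\<close> the index \<open>2 * n\<close> exceeds
    \<open>n\<close>, which leaves room for a cardinal of size aleph-n strictly below
    \<open>K\<close>.\<close>
  then obtain l where l: "2 * n = n + Suc l" by (metis mult_2 Suc_pred neq0_conv)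
  obtain s :: "'k rel" where s: "is_aleph n s" "(s, K) \<in> ordLess"
    using is_aleph_less[of n l K] assms unfolding l by blast
  define Z where "Z = Field s"
  have sZ: "(card_of Z, s) \<in> ordIso"
    unfolding Z_def by (rule card_of_Field_ordIso[OF is_aleph_Card_order[OF s(1)]])
  have inf: "infinite Z" unfolding Z_def by (rule is_aleph_infinite[OF s(1)])
  let ?U = "cylinders ({..n} \<times> Z)" and ?V = "invariant_cylinders ({..n} \<times> Z)"
  obtain e where e: "inj_on e ?U" "e ` ?U \<subseteq> Z" using card_cylinders[OF inf, of n] by blast
  define d where "d = inv_into ?U e"
  have de: "d (e u) = u" if "u \<in> ?U" for u unfolding d_def by (rule inv_into_f_f[OF e(1) that])
  let ?A = "fun_ring e d ?V" and ?B = "fun_ring e d ?U"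
  interpret bool_ext ?A ?B "\<lambda>a. a"
    by (intro bool_ext_fun_ring de fun_closed_cylinders fun_closed_invariant_cylinders)
      (auto simp: invariant_cylinders_def)
  have "\<not> descendable_index_le ?A ?B (\<lambda>a. a) n"
    using False by (intro example_not_descendable[OF _ s(1) ordIso_imp_ordLeq[OF ordIso_symmetric[OF sZ]] de]) auto
  moreover have "(card_of (carrier ?B), K) \<in> ordLess"
  proof -
    have "(card_of (carrier ?B), card_of Z) \<in> ordLeq"
      using e(2) by (intro card_of_mono1) (simp add: fun_ring_def)
    then show ?thesis
      using ordLeq_ordLess_trans[OF _ ordIso_ordLess_trans[OF sZ s(2)]] by blast
  qed
  ultimately show ?thesis
    using faithfully_flat_extension boolean_ring_of_bool_ring[OF A.bool_ring_axioms]
      boolean_ring_of_bool_ring[OF B.bool_ring_axioms] by blast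
qed

end
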